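(* Let $R\to S$ be a finite faithfully flat homomorphism of commutative rings, let $P\in\operatorname{Spec}(R)$, and set $N=\sqrt{PS}/PS$. Assume that $S/\sqrt{PS}$ is a coherent ring and that $N$ is a coherent $S/PS$-module. Then $R/P$ is a coherent ring.
   Context: Rings are commutative with identity and are not assumed noetherian. A module $M$ over a ring $A$ is coherent if it is finitely generated and every finitely generated submodule of $M$ is finitely presented; the ring $A$ is coherent if it is coherent as a module over itself. $PS$ is the ideal of $S$ generated by the image of $P$ and $\sqrt{PS}$ is its radical. A finite homomorphism is one making $S$ a finitely generated $R$-module. *)

theory Defs
  imports "HOL-Algebra.Algebra"
begin

section \<open>Linear maps and finiteness conditions\<close>

text \<open>Only the additive group and the scalar multiplication of a module record are
  meaningful; its ring multiplication and unit play no role.\<close>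

definition linear_maps ::
    "('a, 'r) ring_scheme \<Rightarrow> ('a, 'b) module \<Rightarrow> ('a, 'c) module \<Rightarrow> ('b \<Rightarrow> 'c) set" where
  "linear_maps R M N =
    {h \<in> carrier M \<rightarrow> carrier N.
      (\<forall>x\<in>carrier M. \<forall>y\<in>carrier M. h (x \<oplus>\<^bsub>M\<^esub> y) = h x \<oplus>\<^bsub>N\<^esub> h y) \<and>
      (\<forall>r\<in>carrier R. \<forall>x\<in>carrier M. h (r \<odot>\<^bsub>M\<^esub> x) = r \<odot>\<^bsub>N\<^esub> h x)}"

definition module_span :: "('a, 'r) ring_scheme \<Rightarrow> ('a, 'b) module \<Rightarrow> 'b set \<Rightarrow> 'b set" where
  "module_span R M B = \<Inter>{H. submodule H R M \<and> B \<subseteq> H}"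

definition finitely_generated :: "('a, 'r) ring_scheme \<Rightarrow> ('a, 'b) module \<Rightarrow> bool" where
  "finitely_generated R M \<longleftrightarrow>
    (\<exists>B. finite B \<and> B \<subseteq> carrier M \<and> module_span R M B = carrier M)"

text \<open>The free module of rank \<open>n\<close>: sequences vanishing from index \<open>n\<close> on.\<close>

definition free_module :: "('a, 'r) ring_scheme \<Rightarrow> nat \<Rightarrow> ('a, nat \<Rightarrow> 'a) module" where
  "free_module R n =
    \<lparr>carrier = {x. (\<forall>i<n. x i \<in> carrier R) \<and> (\<forall>i\<ge>n. x i = \<zero>\<^bsub>R\<^esub>)},
     monoid.mult = undefined, monoid.one = undefined,
     ring.zero = (\<lambda>i. \<zero>\<^bsub>R\<^esub>), ring.add = (\<lambda>x y i. x i \<oplus>\<^bsub>R\<^esub> y i),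
     module.smult = (\<lambda>r x i. r \<otimes>\<^bsub>R\<^esub> x i)\<rparr>"

definition finitely_presented :: "('a, 'r) ring_scheme \<Rightarrow> ('a, 'b) module \<Rightarrow> bool" where
  "finitely_presented R M \<longleftrightarrow>
    (\<exists>n. \<exists>h \<in> linear_maps R (free_module R n) M.
      h ` carrier (free_module R n) = carrier M \<and>
      finitely_generated R ((free_module R n)
        \<lparr>carrier := kernel (add_monoid (free_module R n)) (add_monoid M) h\<rparr>))"

definition coherent_module :: "('a, 'r) ring_scheme \<Rightarrow> ('a, 'b) module \<Rightarrow> bool" where
  "coherent_module R M \<longleftrightarrow> module R M \<and> finitely_generated R M \<and>
    (\<forall>H. submodule H R M \<and> finitely_generated R (M\<lparr>carrier := H\<rparr>) \<longrightarrow>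
      finitely_presented R (M\<lparr>carrier := H\<rparr>))"

text \<open>The ring \<open>S\<close> as a module over the domain of a ring homomorphism \<open>f\<close> into \<open>S\<close>.\<close>

definition module_via :: "('a \<Rightarrow> 'b) \<Rightarrow> ('b, 's) ring_scheme \<Rightarrow> ('a, 'b) module" where
  "module_via f S =
    \<lparr>carrier = carrier S, monoid.mult = monoid.mult S, monoid.one = \<one>\<^bsub>S\<^esub>, ring.zero = \<zero>\<^bsub>S\<^esub>, ring.add = ring.add S,
     module.smult = (\<lambda>r s. f r \<otimes>\<^bsub>S\<^esub> s)\<rparr>"

abbreviation self_module :: "('a, 'r) ring_scheme \<Rightarrow> ('a, 'a) module" where
  "self_module R \<equiv> module_via (\<lambda>x. x) R"

definition coherent_ring :: "('a, 'r) ring_scheme \<Rightarrow> bool" where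
  "coherent_ring R \<longleftrightarrow> cring R \<and> coherent_module R (self_module R)"

definition finite_ring_hom ::
    "('a, 'r) ring_scheme \<Rightarrow> ('b, 's) ring_scheme \<Rightarrow> ('a \<Rightarrow> 'b) \<Rightarrow> bool" where
  "finite_ring_hom R S f \<longleftrightarrow> f \<in> ring_hom R S \<and> finitely_generated R (module_via f S)"

section \<open>Tensor products and faithful flatness\<close>

text \<open>The underlying abelian group of the tensor product is the quotient of the free abelian
  group on pairs by the bilinearity relations; exactness depends on this group only.\<close>

definition tensor_relations ::
    "('a, 'r) ring_scheme \<Rightarrow> ('a, 'b) module \<Rightarrow> ('a, 'c) module \<Rightarrow> ('b \<times> 'c \<Rightarrow>\<^sub>0 int) set" where
  "tensor_relations R L M =
    generate (free_Abelian_group (carrier L \<times> carrier M))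
     ({frag_of (x \<oplus>\<^bsub>L\<^esub> x', y) - frag_of (x, y) - frag_of (x', y) | x x' y.
         x \<in> carrier L \<and> x' \<in> carrier L \<and> y \<in> carrier M} \<union>
      {frag_of (x, y \<oplus>\<^bsub>M\<^esub> y') - frag_of (x, y) - frag_of (x, y') | x y y'.
         x \<in> carrier L \<and> y \<in> carrier M \<and> y' \<in> carrier M} \<union>
      {frag_of (r \<odot>\<^bsub>L\<^esub> x, y) - frag_of (x, r \<odot>\<^bsub>M\<^esub> y) | r x y.
         r \<in> carrier R \<and> x \<in> carrier L \<and> y \<in> carrier M})"

definition tensor_product ::
    "('a, 'r) ring_scheme \<Rightarrow> ('a, 'b) module \<Rightarrow> ('a, 'c) module \<Rightarrow>
     ('b \<times> 'c \<Rightarrow>\<^sub>0 int) set monoid" where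
  "tensor_product R L M =
    free_Abelian_group (carrier L \<times> carrier M) Mod tensor_relations R L M"

text \<open>The map \<open>id\<^sub>L \<otimes> g\<close> from \<open>L \<otimes> M\<close> to \<open>L \<otimes> N\<close> for a linear map \<open>g\<close> from
  \<open>M\<close> to \<open>N\<close>. All elements of a class \<open>K\<close> have images in the same class.\<close>

definition tensor_map ::
    "('a, 'r) ring_scheme \<Rightarrow> ('a, 'b) module \<Rightarrow> ('a, 'd) module \<Rightarrow> ('c \<Rightarrow> 'd) \<Rightarrow>
     ('b \<times> 'c \<Rightarrow>\<^sub>0 int) set \<Rightarrow> ('b \<times> 'd \<Rightarrow>\<^sub>0 int) set" where
  "tensor_map R L N g K =
    the_elem ((\<lambda>c. tensor_relations R L N #>\<^bsub>free_Abelian_group (carrier L \<times> carrier N)\<^esub>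
                     frag_extend (\<lambda>(x, y). frag_of (x, g y)) c) ` K)"

text \<open>\<open>L\<close> is faithfully flat if a sequence \<open>M\<^sub>1 \<rightarrow> M\<^sub>2 \<rightarrow> M\<^sub>3\<close> of modules is exact
  precisely when its tensor product with \<open>L\<close> is exact. HOL cannot quantify over the types of
  the modules inside a definition, so the type \<open>'u\<close> of their elements is a parameter.\<close>

definition faithfully_flat ::
    "'u itself \<Rightarrow> ('a, 'r) ring_scheme \<Rightarrow> ('a, 'b) module \<Rightarrow> bool" where
  "faithfully_flat _ R L \<longleftrightarrow> module R L \<and>
    (\<forall>(M1 :: ('a, 'u) module) (M2 :: ('a, 'u) module) (M3 :: ('a, 'u) module).
     \<forall>g \<in> linear_maps R M1 M2. \<forall>h \<in> linear_maps R M2 M3.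
      module R M1 \<and> module R M2 \<and> module R M3 \<longrightarrow>
      (g ` carrier M1 = kernel (add_monoid M2) (add_monoid M3) h \<longleftrightarrow>
       tensor_map R L M2 g ` carrier (tensor_product R L M1) =
         kernel (tensor_product R L M2) (tensor_product R L M3) (tensor_map R L M3 h)))"

text \<open>Sets of sequences in \<open>R\<close> form a large enough type: every finitely generated \<open>R\<close>-module
  is isomorphic to one whose elements are cosets in some \<open>free_module R n\<close>, and so is every
  submodule of such a module. Faithful flatness tested on these modules implies it for all modules:
  flatness can be tested on the inclusions of ideals into \<open>R\<close>, and a flat module is
  faithfully flat if no nonzero cyclic module becomes zero after tensoring.\<close>

definition faithfully_flat_ring_hom ::
    "('a, 'r) ring_scheme \<Rightarrow> ('b, 's) ring_scheme \<Rightarrow> ('a \<Rightarrow> 'b) \<Rightarrow> bool" where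
  "faithfully_flat_ring_hom R S f \<longleftrightarrow>
    f \<in> ring_hom R S \<and> faithfully_flat TYPE((nat \<Rightarrow> 'a) set) R (module_via f S)"

section \<open>Extended ideals and radicals\<close>

definition extended_ideal :: "('b, 's) ring_scheme \<Rightarrow> ('a \<Rightarrow> 'b) \<Rightarrow> 'a set \<Rightarrow> 'b set" where
  "extended_ideal S f P = Idl\<^bsub>S\<^esub> (f ` P)"

definition radical :: "('a, 'r) ring_scheme \<Rightarrow> 'a set \<Rightarrow> 'a set" where
  "radical S J = {x \<in> carrier S. \<exists>n::nat. x [^]\<^bsub>S\<^esub> n \<in> J}"

text \<open>For an ideal \<open>I\<close> containing \<open>J\<close>, the \<open>S/J\<close>-module \<open>I/J\<close>.\<close>

definition quotient_ideal_module ::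
    "('a, 'r) ring_scheme \<Rightarrow> 'a set \<Rightarrow> 'a set \<Rightarrow> ('a set, 'a set) module" where
  "quotient_ideal_module S I J =
    (self_module (S Quot J))\<lparr>carrier := (\<lambda>x. J +>\<^bsub>S\<^esub> x) ` I\<rparr>"

end

theory Submission
  imports Defs
begin

text \<open>Write \<open>A = R/P\<close>, \<open>B = S/PS\<close> and let \<open>N\<close> be the nilradical of \<open>B\<close>. Coherence of a finitely
  generated module means that every finite family of its elements has finitely generated syzygies.
  For a finite family in \<open>B\<close>, the syzygies modulo \<open>N\<close> are finitely generated because \<open>B/N\<close> is
  coherent and \<open>N\<close> is finitely generated; their generators pair with the family to a finite family in
  \<open>N\<close>, whose syzygies are finitely generated because \<open>N\<close> is coherent. Composing the two, \<open>B\<close> is coherent.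

  Coherence then descends along the faithfully flat map from \<open>A\<close> to \<open>B\<close>. For a finite family in \<open>A\<close>
  with module of syzygies \<open>K\<close>, flatness says that the syzygies over \<open>B\<close> are spanned by \<open>K\<close>, hence by
  finitely many elements of \<open>K\<close>, and by faithfulness these elements already span \<open>K\<close> over \<open>A\<close>.

  Both arguments are carried out with lifts to free modules over \<open>S\<close> and \<open>R\<close>, modulo vectors with
  entries in the ideal.\<close>

section \<open>Spans and semilinear maps\<close>

text \<open>Flatness is given for S over R, while coherence has to descend from S/PS to R/P, and
  \<open>faithfully_flat\<close> can only be applied to R-modules whose elements are sets of
  sequences in R. Both difficulties are met by staying with submodules of R^n: a submodule of
  (R/P)^n is replaced by its preimage in R^n, and finite generation by finite generation modulo P^n,
  so base change of flatness along R -> R/P never has to be formulated. For a submodule U of R^n,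
  the tensor product S \<otimes> U is compared with the S-span of U in S^n. The link is one
  evaluation map from S \<otimes> R^n to S^n, whose inverse sends y to \<Sum> y_i \<otimes> e_i; it
  turns statements about classes of formal sums into statements about vectors over S. Spans are
  intersections of submodules, so most inclusions are proved by exhibiting a suitable submodule (a
  preimage, an equalizer, a directed union) instead of by computing with linear
  combinations.\<close>

lemma submodule_zero_closed: "submodule H R M \<Longrightarrow> \<zero>\<^bsub>M\<^esub> \<in> H"
  using subgroup.one_closed[OF submodule.axioms(1)] by fastforce

lemma (in module) submodule_minus_closed:
  "\<lbrakk>submodule H R M; x \<in> H; y \<in> H\<rbrakk> \<Longrightarrow> x \<ominus>\<^bsub>M\<^esub> y \<in> H"
  unfolding a_minus_def by (simp add: submoduleE(3,5))

lemma (in module) minus_submodule_cancel: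
  assumes H: "submodule H R M" and x: "x \<in> carrier M" and y: "y \<in> H" and d: "x \<ominus>\<^bsub>M\<^esub> y \<in> H"
  shows "x \<in> H"
proof -
  have y': "y \<in> carrier M" using submoduleE(1)[OF H] y by blast
  have "x = (x \<ominus>\<^bsub>M\<^esub> y) \<oplus>\<^bsub>M\<^esub> y"
    using x y' by (simp add: a_minus_def M.a_assoc M.l_neg)
  then show ?thesis using submoduleE(5)[OF H d y] by simp
qed

lemma submodule_span:
  fixes M :: "('a, 'b) module"
  assumes "module R M" and "B \<subseteq> carrier M"
  shows "submodule (module_span R M B) R M"
proof -
  interpret module R M by fact
  have "carrier M \<in> {H. submodule H R M \<and> B \<subseteq> H}"
    using carrier_is_submodule assms(2) by simp
  then show ?thesis
    unfolding module_span_def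
    by (intro submoduleI) (auto intro: submoduleE(3-5) submodule_zero_closed)
qed

lemma span_superset: "B \<subseteq> module_span R M B"
  unfolding module_span_def by blast

lemma span_least: "\<lbrakk>submodule H R M; B \<subseteq> H\<rbrakk> \<Longrightarrow> module_span R M B \<subseteq> H"
  unfolding module_span_def by blast

lemma span_mono: "B \<subseteq> C \<Longrightarrow> module_span R M B \<subseteq> module_span R M C"
  unfolding module_span_def by blast

text \<open>The family of finite spans is directed: elements of the spans of F and G both lie in the
  span of F \<union> G. Hence the union is closed under addition.\<close>

lemma submodule_Union_finite_spans:
  fixes M :: "('a, 'b) module"
  assumes "module R M" and "B \<subseteq> carrier M"
  shows "submodule (\<Union>(module_span R M ` {F. finite F \<and> F \<subseteq> B})) R M" (is "submodule ?U R M")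
proof -
  interpret module R M by fact
  have sub: "submodule (module_span R M F) R M" if "F \<subseteq> B" for F
    using submodule_span assms that by blast
  have zero: "\<zero>\<^bsub>M\<^esub> \<in> ?U"
    using submodule_zero_closed[OF sub[of "{}"]] by blast
  have add: "a \<oplus>\<^bsub>M\<^esub> b \<in> ?U" if "a \<in> ?U" "b \<in> ?U" for a b
  proof -
    from that(1) obtain F where F: "finite F" "F \<subseteq> B" "a \<in> module_span R M F"
      by (elim UN_E CollectE conjE)
    from that(2) obtain G where G: "finite G" "G \<subseteq> B" "b \<in> module_span R M G"
      by (elim UN_E CollectE conjE)
    have "a \<in> module_span R M (F \<union> G)" "b \<in> module_span R M (F \<union> G)"
      using F(3) G(3) by (auto intro: span_mono[THEN subsetD, rotated])
    then have "a \<oplus>\<^bsub>M\<^esub> b \<in> module_span R M (F \<union> G)"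
      using submoduleE(5)[OF sub] F G by simp
    then show ?thesis using F G by blast
  qed
  show ?thesis
  proof (rule submoduleI)
    show "?U \<subseteq> carrier M" using submoduleE(1)[OF sub] by blast
    show "\<ominus>\<^bsub>M\<^esub> a \<in> ?U" if "a \<in> ?U" for a
      using that submoduleE(3)[OF sub] by blast
    show "r \<odot>\<^bsub>M\<^esub> a \<in> ?U" if "r \<in> carrier R" "a \<in> ?U" for r a
      using that submoduleE(4)[OF sub] by blast
  qed (use zero add in auto)
qed

text \<open>The union of the spans of finite subsets is a submodule containing B, hence contains the
  span of B. This recovers the finitary nature of spans from their definition as
  intersections.\<close>

lemma span_finitary:
  fixes M :: "('a, 'b) module"
  assumes "module R M" and "B \<subseteq> carrier M" and "x \<in> module_span R M B"
  obtains F where "finite F" "F \<subseteq> B" "x \<in> module_span R M F"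
proof -
  have "B \<subseteq> \<Union>(module_span R M ` {F. finite F \<and> F \<subseteq> B})"
  proof
    fix b assume "b \<in> B"
    then have "finite {b}" "{b} \<subseteq> B" "b \<in> module_span R M {b}"
      using span_superset by fast+
    then show "b \<in> \<Union>(module_span R M ` {F. finite F \<and> F \<subseteq> B})" by blast
  qed
  from span_least[OF submodule_Union_finite_spans[OF assms(1,2)] this] assms(3) that
  show thesis by blast
qed

text \<open>One notion serves three kinds of maps: linear maps (q the identity), reduction R^n ->
  (R/I)^n (q the quotient map), and base change R^n -> S^n (q the given ring homomorphism).
  Composition then mixes them freely.\<close>

locale semilinear_map = M: module R M + N: module S N
  for R :: "('a, 'r) ring_scheme" and S :: "('c, 's) ring_scheme"
    and q :: "'a \<Rightarrow> 'c" and M :: "('a, 'b) module" and N :: "('c, 'd) module" and h :: "'b \<Rightarrow> 'd" +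
  assumes scalar_closed: "q \<in> carrier R \<rightarrow> carrier S"
    and map_closed: "h \<in> carrier M \<rightarrow> carrier N"
    and map_add: "\<lbrakk>x \<in> carrier M; y \<in> carrier M\<rbrakk> \<Longrightarrow> h (x \<oplus>\<^bsub>M\<^esub> y) = h x \<oplus>\<^bsub>N\<^esub> h y"
    and map_smult: "\<lbrakk>r \<in> carrier R; x \<in> carrier M\<rbrakk> \<Longrightarrow> h (r \<odot>\<^bsub>M\<^esub> x) = q r \<odot>\<^bsub>N\<^esub> h x"
begin

sublocale group_hom "add_monoid M" "add_monoid N" h
  by unfold_locales (use map_closed map_add in \<open>auto simp: hom_def\<close>)

lemma map_zero [simp]: "h \<zero>\<^bsub>M\<^esub> = \<zero>\<^bsub>N\<^esub>"
  using hom_one by simp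

lemma map_minus: "x \<in> carrier M \<Longrightarrow> h (\<ominus>\<^bsub>M\<^esub> x) = \<ominus>\<^bsub>N\<^esub> h x"
  using hom_inv by (simp add: a_inv_def)

lemma map_mem: "x \<in> carrier M \<Longrightarrow> h x \<in> carrier N"
  using map_closed by blast

lemma map_diff:
  "\<lbrakk>x \<in> carrier M; y \<in> carrier M\<rbrakk> \<Longrightarrow> h (x \<ominus>\<^bsub>M\<^esub> y) = h x \<ominus>\<^bsub>N\<^esub> h y"
  by (simp add: a_minus_def map_add map_minus)

lemma submodule_preimage:
  assumes "submodule H S N"
  shows "submodule {x \<in> carrier M. h x \<in> H} R M"
  using N.submoduleE(3-5)[OF assms] scalar_closed submodule_zero_closed[OF assms] map_minus
  by (intro M.submoduleI) (auto simp: map_add map_smult Pi_iff)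

lemma submodule_image:
  assumes H: "submodule H R M" and q: "q ` carrier R = carrier S"
  shows "submodule (h ` H) S N"
proof (rule N.submoduleI)
  note HE = M.submoduleE[OF H]
  show "h ` H \<subseteq> carrier N" using HE(1) map_mem by blast
  show "\<zero>\<^bsub>N\<^esub> \<in> h ` H" using submodule_zero_closed[OF H] map_zero by (metis imageI)
  show "\<ominus>\<^bsub>N\<^esub> a \<in> h ` H" if "a \<in> h ` H" for a
  proof -
    from \<open>a \<in> h ` H\<close> obtain x where x: "a = h x" "x \<in> H" by (elim imageE)
    then have "\<ominus>\<^bsub>N\<^esub> a = h (\<ominus>\<^bsub>M\<^esub> x)" using map_minus HE(1)[THEN subsetD] by simp
    then show ?thesis using x HE(3) by simp
  qed
  show "a \<oplus>\<^bsub>N\<^esub> b \<in> h ` H" if "a \<in> h ` H" "b \<in> h ` H" for a b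
  proof -
    from \<open>a \<in> h ` H\<close> \<open>b \<in> h ` H\<close> obtain x y
      where xy: "a = h x" "x \<in> H" "b = h y" "y \<in> H" by (elim imageE)
    then have "a \<oplus>\<^bsub>N\<^esub> b = h (x \<oplus>\<^bsub>M\<^esub> y)" using map_add HE(1)[THEN subsetD] by simp
    then show ?thesis using xy HE(5) by simp
  qed
  show "a \<odot>\<^bsub>N\<^esub> b \<in> h ` H" if a: "a \<in> carrier S" "b \<in> h ` H" for a b
  proof -
    \<comment> \<open>A scalar of S has to be lifted to R in order to act on H; this is where
      surjectivity of q enters.\<close>
    from a[folded q] obtain r x where "a = q r" "r \<in> carrier R" "b = h x" "x \<in> H"
      by (elim imageE)
    then have "a \<odot>\<^bsub>N\<^esub> b = h (r \<odot>\<^bsub>M\<^esub> x)" "r \<odot>\<^bsub>M\<^esub> x \<in> H"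
      using HE(4) map_smult HE(1)[THEN subsetD] by simp_all
    then show ?thesis by simp
  qed
qed

lemma span_image:
  assumes "B \<subseteq> carrier M"
  shows "h ` module_span R M B \<subseteq> module_span S N (h ` B)"
proof -
  have "h ` B \<subseteq> carrier N" using assms map_mem by blast
  then have "submodule {x \<in> carrier M. h x \<in> module_span S N (h ` B)} R M"
    using submodule_preimage submodule_span N.module_axioms by blast
  moreover have "B \<subseteq> {x \<in> carrier M. h x \<in> module_span S N (h ` B)}"
    using assms span_superset[of "h ` B"] by blast
  ultimately show ?thesis using span_least by blast
qed

lemma semilinear_restrict:
  assumes H: "submodule H S N" and "h ` carrier M \<subseteq> H"
  shows "semilinear_map R S q M (N\<lparr>carrier := H\<rparr>) h"
proof -
  have "module S (N\<lparr>carrier := H\<rparr>)"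
    using submodule.submodule_is_module[OF H N.module_axioms] .
  then show ?thesis
    using assms(2) scalar_closed M.module_axioms
    by (auto simp: semilinear_map_def semilinear_map_axioms_def map_add map_smult)
qed

end

lemma semilinear_compose:
  assumes "semilinear_map R S q M N h" and "semilinear_map S T p N L g"
  shows "semilinear_map R T (p \<circ> q) M L (g \<circ> h)"
proof -
  interpret h: semilinear_map R S q M N h by fact
  interpret g: semilinear_map S T p N L g by fact
  show ?thesis
    using h.scalar_closed h.map_closed g.scalar_closed g.map_closed
    by unfold_locales (auto simp: h.map_add h.map_smult g.map_add g.map_smult Pi_iff)
qed

abbreviation linear_map ::
    "('a, 'r) ring_scheme \<Rightarrow> ('a, 'b) module \<Rightarrow> ('a, 'c) module \<Rightarrow> ('b \<Rightarrow> 'c) \<Rightarrow> bool" where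
  "linear_map R M N h \<equiv> semilinear_map R R (\<lambda>r. r) M N h"

lemma linear_map_iff:
  "linear_map R M N h \<longleftrightarrow> module R M \<and> module R N \<and> h \<in> linear_maps R M N"
  by (auto simp: semilinear_map_def semilinear_map_axioms_def linear_maps_def)

lemma submodule_restrict_iff:
  fixes M :: "('a, 'b) module"
  assumes "module R M" and "submodule H R M"
  shows "submodule G R (M\<lparr>carrier := H\<rparr>) \<longleftrightarrow> submodule G R M \<and> G \<subseteq> H"
proof -
  interpret module R M by fact
  interpret H: module R "M\<lparr>carrier := H\<rparr>"
    using submodule.submodule_is_module[OF assms(2,1)] .
  note HE = submoduleE[OF assms(2)]
  show ?thesis
  proof (intro iffI conjI)
    assume G: "submodule G R (M\<lparr>carrier := H\<rparr>)"
    then show GH: "G \<subseteq> H" using H.submoduleE(1) by fastforce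
    have "module R (M\<lparr>carrier := G\<rparr>)"
      using submodule.submodule_is_module[OF G H.module_axioms] by simp
    then show "submodule G R M"
      using module_incl_imp_submodule GH HE(1) by blast
  next
    assume G: "submodule G R M \<and> G \<subseteq> H"
    have "module R (M\<lparr>carrier := G\<rparr>)"
      using submodule.submodule_is_module[OF _ module_axioms] G by blast
    then show "submodule G R (M\<lparr>carrier := H\<rparr>)"
      using H.module_incl_imp_submodule[of G] G by simp
  qed
qed

section \<open>Finite generation of submodules, absolute and modulo another submodule\<close>

lemma finitely_generated_submodule_iff:
  fixes M :: "('a, 'b) module"
  assumes M: "module R M" and H: "submodule H R M"
  shows "finitely_generated R (M\<lparr>carrier := H\<rparr>) \<longleftrightarrow>
    (\<exists>B. finite B \<and> B \<subseteq> H \<and> H = module_span R M B)"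
proof -
  have "module_span R (M\<lparr>carrier := H\<rparr>) B = module_span R M B" if B: "B \<subseteq> H" for B
  proof
    have "submodule (module_span R M B) R M"
      using B module.submoduleE(1)[OF M H] by (intro submodule_span[OF M]) blast
    then show "module_span R (M\<lparr>carrier := H\<rparr>) B \<subseteq> module_span R M B"
      by (intro span_least) (auto simp: submodule_restrict_iff[OF M H] span_superset span_least[OF H B]
          intro: span_superset[THEN subsetD])
  next
    show "module_span R M B \<subseteq> module_span R (M\<lparr>carrier := H\<rparr>) B"
      unfolding module_span_def by (auto simp: submodule_restrict_iff[OF M H])
  qed
  then show ?thesis unfolding finitely_generated_def by (simp cong: conj_cong) blast
qed

text \<open>For submodules W \<subseteq> H this says that H/W is finitely generated, without
  constructing H/W. Generators are required to lie in H itself, so they can be used as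
  representatives.\<close>

definition finite_modulo ::
    "('a, 'r) ring_scheme \<Rightarrow> ('a, 'b) module \<Rightarrow> 'b set \<Rightarrow> 'b set \<Rightarrow> bool" where
  "finite_modulo R M W H \<longleftrightarrow> (\<exists>B. finite B \<and> B \<subseteq> H \<and> H \<subseteq> module_span R M (B \<union> W))"

text \<open>Since h is onto, H is the preimage of H modulo the kernel of h, and since q is onto,
  S-spans in N are images of R-spans in M. This is the passage between modules over a quotient ring
  and lifts over the ring.\<close>

lemma (in semilinear_map) finitely_generated_image_iff:
  assumes q: "q ` carrier R = carrier S" and h: "h ` carrier M = carrier N" and H: "submodule H S N"
  shows "finitely_generated S (N\<lparr>carrier := H\<rparr>) \<longleftrightarrow>
    finite_modulo R M {x \<in> carrier M. h x = \<zero>\<^bsub>N\<^esub>} {x \<in> carrier M. h x \<in> H}"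
    (is "_ \<longleftrightarrow> finite_modulo R M ?W ?H")
proof -
  have HN: "H \<subseteq> carrier N" using N.submoduleE(1)[OF H] .
  have im: "h ` ?H = H" using h HN by auto
  show ?thesis
    unfolding finitely_generated_submodule_iff[OF N.module_axioms H]
  proof
    assume "\<exists>B. finite B \<and> B \<subseteq> H \<and> H = module_span S N B"
    then obtain B where B: "finite B" "B \<subseteq> H" "H = module_span S N B" by (elim exE conjE)
    obtain C where C: "finite C" "C \<subseteq> ?H" "B = h ` C"
      using finite_subset_image[of B h ?H] B(1,2) unfolding im by metis
    let ?T = "module_span R M (C \<union> ?W)"
    have CW: "C \<union> ?W \<subseteq> carrier M" using C by blast
    note T = submodule_span[OF M.module_axioms CW]
    have "B \<subseteq> h ` ?T"
      unfolding C(3) using span_superset[of "C \<union> ?W" R M] by (intro image_mono) simp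
    then have "H \<subseteq> h ` ?T"
      unfolding B(3) by (intro span_least submodule_image[OF T q])
    have "?H \<subseteq> ?T"
    proof
      fix x assume x: "x \<in> ?H"
      then have "h x \<in> h ` ?T" using \<open>H \<subseteq> h ` ?T\<close> by auto
      then obtain y where y: "h x = h y" "y \<in> ?T" by (elim imageE)
      have y': "y \<in> carrier M" using M.submoduleE(1)[OF T] y(2) by (rule subsetD)
      \<comment> \<open>Two elements with the same image differ by an element of the kernel, and the
        kernel is part of the generating set of \<open>?T\<close>.\<close>
      have "x \<ominus>\<^bsub>M\<^esub> y \<in> ?W"
        using x y' map_mem[OF y'] by (simp add: map_diff y(1)) (simp add: a_minus_def N.M.r_neg)
      then have "x \<ominus>\<^bsub>M\<^esub> y \<in> ?T" using span_superset[of "C \<union> ?W" R M] by (meson UnI2 subsetD)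
      then show "x \<in> ?T" using M.minus_submodule_cancel[OF T] x y by simp
    qed
    then show "finite_modulo R M ?W ?H"
      unfolding finite_modulo_def using C(1,2) by (intro exI[of _ C] conjI)
  next
    assume "finite_modulo R M ?W ?H"
    then obtain C where C: "finite C" "C \<subseteq> ?H" "?H \<subseteq> module_span R M (C \<union> ?W)"
      unfolding finite_modulo_def by (elim exE conjE)
    have hC: "h ` C \<subseteq> H" using C(2) by auto
    note T = submodule_span[OF N.module_axioms order_trans[OF hC HN]]
    have "H \<subseteq> h ` module_span R M (C \<union> ?W)" using image_mono[OF C(3), of h] unfolding im .
    also have "\<dots> \<subseteq> module_span S N (h ` (C \<union> ?W))" by (rule span_image) (use C(2) in auto)
    also have "\<dots> \<subseteq> module_span S N (h ` C)"
      using span_superset[of "h ` C" S N] submodule_zero_closed[OF T]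
      by (intro span_least[OF T]) auto
    finally have "H = module_span S N (h ` C)" using span_least[OF H hC] by (rule antisym)
    then show "\<exists>B. finite B \<and> B \<subseteq> H \<and> H = module_span S N B"
      using C(1) hC by (intro exI[of _ "h ` C"]) simp
  qed
qed

section \<open>Free modules and syzygies\<close>

definition unit_vector :: "('a, 'r) ring_scheme \<Rightarrow> nat \<Rightarrow> nat \<Rightarrow> 'a" where
  "unit_vector R i = (\<lambda>j. if j = i then \<one>\<^bsub>R\<^esub> else \<zero>\<^bsub>R\<^esub>)"

lemma carrier_free_module:
  "x \<in> carrier (free_module R n) \<longleftrightarrow> (\<forall>i<n. x i \<in> carrier R) \<and> (\<forall>i\<ge>n. x i = \<zero>\<^bsub>R\<^esub>)"
  by (simp add: free_module_def)

lemma zero_free_module: "\<zero>\<^bsub>free_module R n\<^esub> = (\<lambda>i. \<zero>\<^bsub>R\<^esub>)"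
  and add_free_module: "x \<oplus>\<^bsub>free_module R n\<^esub> y = (\<lambda>i. x i \<oplus>\<^bsub>R\<^esub> y i)"
  and smult_free_module: "r \<odot>\<^bsub>free_module R n\<^esub> x = (\<lambda>i. r \<otimes>\<^bsub>R\<^esub> x i)"
  by (simp_all add: free_module_def)

lemma free_module_component:
  assumes "cring R" and "x \<in> carrier (free_module R n)"
  shows "x i \<in> carrier R"
proof -
  interpret cring R by fact
  show ?thesis using assms(2) by (cases "i < n") (auto simp: carrier_free_module)
qed

lemma module_free_module:
  assumes "cring R"
  shows "module R (free_module R n)"
proof -
  interpret cring R by fact
  note simps = carrier_free_module zero_free_module add_free_module smult_free_module
  show ?thesis
  proof (intro moduleI abelian_groupI)
    fix x assume x: "x \<in> carrier (free_module R n)"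
    show "\<exists>y\<in>carrier (free_module R n). y \<oplus>\<^bsub>free_module R n\<^esub> x = \<zero>\<^bsub>free_module R n\<^esub>"
      using x free_module_component[OF assms x]
      by (intro bexI[of _ "\<lambda>i. \<ominus>\<^bsub>R\<^esub> x i"]) (auto simp: simps l_neg)
  next
    fix x y assume x: "x \<in> carrier (free_module R n)" and y: "y \<in> carrier (free_module R n)"
    show "x \<oplus>\<^bsub>free_module R n\<^esub> y = y \<oplus>\<^bsub>free_module R n\<^esub> x"
      using free_module_component[OF assms x] free_module_component[OF assms y]
      by (simp add: simps a_comm)
    fix z assume z: "z \<in> carrier (free_module R n)"
    show "x \<oplus>\<^bsub>free_module R n\<^esub> y \<oplus>\<^bsub>free_module R n\<^esub> z = x \<oplus>\<^bsub>free_module R n\<^esub> (y \<oplus>\<^bsub>free_module R n\<^esub> z)"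
      using free_module_component[OF assms x] free_module_component[OF assms y]
        free_module_component[OF assms z]
      by (simp add: simps a_assoc)
  next
    fix a b x assume x: "x \<in> carrier (free_module R n)" and "a \<in> carrier R" "b \<in> carrier R"
    then show "(a \<oplus>\<^bsub>R\<^esub> b) \<odot>\<^bsub>free_module R n\<^esub> x =
        a \<odot>\<^bsub>free_module R n\<^esub> x \<oplus>\<^bsub>free_module R n\<^esub> b \<odot>\<^bsub>free_module R n\<^esub> x"
      "a \<otimes>\<^bsub>R\<^esub> b \<odot>\<^bsub>free_module R n\<^esub> x = a \<odot>\<^bsub>free_module R n\<^esub> (b \<odot>\<^bsub>free_module R n\<^esub> x)"
      using free_module_component[OF assms x] by (simp_all add: simps l_distr m_assoc)
  next
    fix a x y assume x: "x \<in> carrier (free_module R n)" and y: "y \<in> carrier (free_module R n)"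
      and "a \<in> carrier R"
    then show "a \<odot>\<^bsub>free_module R n\<^esub> (x \<oplus>\<^bsub>free_module R n\<^esub> y) =
        a \<odot>\<^bsub>free_module R n\<^esub> x \<oplus>\<^bsub>free_module R n\<^esub> a \<odot>\<^bsub>free_module R n\<^esub> y"
      using free_module_component[OF assms x] free_module_component[OF assms y]
      by (simp add: simps r_distr)
  next
    fix x assume x: "x \<in> carrier (free_module R n)"
    show "\<one>\<^bsub>R\<^esub> \<odot>\<^bsub>free_module R n\<^esub> x = x" "\<zero>\<^bsub>free_module R n\<^esub> \<oplus>\<^bsub>free_module R n\<^esub> x = x"
      using free_module_component[OF assms x] by (simp_all add: simps)
  qed (use assms in \<open>auto simp: simps\<close>)
qed

lemma unit_vector_closed:
  assumes "cring R" and "i < n"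
  shows "unit_vector R i \<in> carrier (free_module R n)"
proof -
  interpret cring R by fact
  show ?thesis using assms(2) by (simp add: carrier_free_module unit_vector_def)
qed

text \<open>Stands in for the expansion x = \<Sum> x_i e_i: a submodule containing every summand
  contains x. The truncations of x to its first k entries lie in H by induction on k.\<close>

lemma free_module_memI:
  assumes R: "cring R" and H: "submodule H R (free_module R n)"
    and x: "x \<in> carrier (free_module R n)"
    and mem: "\<And>i. i < n \<Longrightarrow> x i \<odot>\<^bsub>free_module R n\<^esub> unit_vector R i \<in> H"
  shows "x \<in> H"
proof -
  interpret cring R by fact
  interpret F: module R "free_module R n" using module_free_module[OF R] .
  have "(\<lambda>i. if i < k then x i else \<zero>\<^bsub>R\<^esub>) \<in> H" if "k \<le> n" for k
    using that
  proof (induction k)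
    case 0
    then show ?case using submodule_zero_closed[OF H] by (simp add: zero_free_module)
  next
    case (Suc k)
    have "(\<lambda>i. if i < Suc k then x i else \<zero>\<^bsub>R\<^esub>) = (\<lambda>i. if i < k then x i else \<zero>\<^bsub>R\<^esub>)
        \<oplus>\<^bsub>free_module R n\<^esub> x k \<odot>\<^bsub>free_module R n\<^esub> unit_vector R k"
      using free_module_component[OF R x]
      by (auto simp: add_free_module smult_free_module unit_vector_def fun_eq_iff less_Suc_eq)
    also have "\<dots> \<in> H"
      using Suc mem by (intro F.submoduleE(5)[OF H]) simp_all
    finally show ?case .
  qed
  from this[of n] have "(\<lambda>i. if i < n then x i else \<zero>\<^bsub>R\<^esub>) \<in> H" by simp
  also have "(\<lambda>i. if i < n then x i else \<zero>\<^bsub>R\<^esub>) = x"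
    using x by (auto simp: carrier_free_module fun_eq_iff)
  finally show ?thesis .
qed

text \<open>The equalizer of the two maps is a submodule, and it contains the unit vectors. All
  identities between composed maps on free modules are reduced to unit vectors in this way.\<close>

lemma semilinear_free_eqI:
  assumes R: "cring R"
    and h: "semilinear_map R S q (free_module R n) N h"
    and g: "semilinear_map R S q (free_module R n) N g"
    and eq: "\<And>i. i < n \<Longrightarrow> h (unit_vector R i) = g (unit_vector R i)"
    and x: "x \<in> carrier (free_module R n)"
  shows "h x = g x"
proof -
  interpret h: semilinear_map R S q "free_module R n" N h by fact
  interpret g: semilinear_map R S q "free_module R n" N g by fact
  let ?H = "{x \<in> carrier (free_module R n). h x = g x}"
  have H: "submodule ?H R (free_module R n)"
    by (intro h.M.submoduleI)
      (auto simp: h.map_add g.map_add h.map_minus g.map_minus h.map_smult g.map_smult)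
  have "x \<in> ?H"
  proof (rule free_module_memI[OF R H x])
    fix i assume i: "i < n"
    have "unit_vector R i \<in> ?H" using unit_vector_closed[OF R i] eq[OF i] by simp
    then show "x i \<odot>\<^bsub>free_module R n\<^esub> unit_vector R i \<in> ?H"
      by (rule h.M.submoduleE(4)[OF H free_module_component[OF R x]])
  qed
  then show ?thesis by simp
qed

section \<open>Linear combinations of a finite family and its syzygies\<close>

definition lincomb :: "('a, 'b) module \<Rightarrow> nat \<Rightarrow> (nat \<Rightarrow> 'b) \<Rightarrow> (nat \<Rightarrow> 'a) \<Rightarrow> 'b" where
  "lincomb M n m x = (\<Oplus>\<^bsub>M\<^esub>i\<in>{..<n}. x i \<odot>\<^bsub>M\<^esub> m i)"

definition syzygies ::
    "('a, 'r) ring_scheme \<Rightarrow> ('a, 'b) module \<Rightarrow> nat \<Rightarrow> (nat \<Rightarrow> 'b) \<Rightarrow> (nat \<Rightarrow> 'a) set" where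
  "syzygies R M n m = {x \<in> carrier (free_module R n). lincomb M n m x = \<zero>\<^bsub>M\<^esub>}"

lemma linear_lincomb:
  assumes M: "module R M" and m: "m \<in> {..<n} \<rightarrow> carrier M"
  shows "linear_map R (free_module R n) M (lincomb M n m)"
proof -
  interpret module R M by fact
  have comp: "x i \<in> carrier R" if "x \<in> carrier (free_module R n)" for x i
    using free_module_component[OF R.is_cring that] .
  interpret F: module R "free_module R n" using module_free_module[OF R.is_cring] .
  show ?thesis
  proof
    show "lincomb M n m \<in> carrier (free_module R n) \<rightarrow> carrier M"
    proof
      fix x assume x: "x \<in> carrier (free_module R n)"
      show "lincomb M n m x \<in> carrier M"
        unfolding lincomb_def using m comp[OF x] by (intro M.finsum_closed) auto
    qed
  next
    fix x y assume x: "x \<in> carrier (free_module R n)" and y: "y \<in> carrier (free_module R n)"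
    have "lincomb M n m (x \<oplus>\<^bsub>free_module R n\<^esub> y) =
        (\<Oplus>\<^bsub>M\<^esub>i\<in>{..<n}. x i \<odot>\<^bsub>M\<^esub> m i \<oplus>\<^bsub>M\<^esub> y i \<odot>\<^bsub>M\<^esub> m i)"
      unfolding lincomb_def add_free_module using m comp[OF x] comp[OF y]
      by (intro M.finsum_cong') (auto simp: smult_l_distr Pi_iff)
    also have "\<dots> = lincomb M n m x \<oplus>\<^bsub>M\<^esub> lincomb M n m y"
      unfolding lincomb_def using m comp[OF x] comp[OF y] by (intro M.finsum_addf) auto
    finally show "lincomb M n m (x \<oplus>\<^bsub>free_module R n\<^esub> y) = lincomb M n m x \<oplus>\<^bsub>M\<^esub> lincomb M n m y" .
  next
    fix r x assume r: "r \<in> carrier R" and x: "x \<in> carrier (free_module R n)"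
    have "lincomb M n m (r \<odot>\<^bsub>free_module R n\<^esub> x) = (\<Oplus>\<^bsub>M\<^esub>i\<in>{..<n}. r \<odot>\<^bsub>M\<^esub> (x i \<odot>\<^bsub>M\<^esub> m i))"
      unfolding lincomb_def smult_free_module using m r comp[OF x]
      by (intro M.finsum_cong') (auto simp: smult_assoc1 Pi_iff)
    also have "\<dots> = r \<odot>\<^bsub>M\<^esub> lincomb M n m x"
      unfolding lincomb_def using m r comp[OF x] by (intro finsum_smult_ldistr[symmetric]) auto
    finally show "lincomb M n m (r \<odot>\<^bsub>free_module R n\<^esub> x) = r \<odot>\<^bsub>M\<^esub> lincomb M n m x" .
  qed auto
qed

lemma lincomb_unit_vector:
  assumes M: "module R M" and m: "m \<in> {..<n} \<rightarrow> carrier M" and i: "i < n"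
  shows "lincomb M n m (unit_vector R i) = m i"
proof -
  interpret module R M by fact
  have "lincomb M n m (unit_vector R i) = (\<Oplus>\<^bsub>M\<^esub>j\<in>{..<n}. if i = j then m j else \<zero>\<^bsub>M\<^esub>)"
    unfolding lincomb_def unit_vector_def using m
    by (intro M.finsum_cong') (auto simp: Pi_iff)
  also have "\<dots> = m i" using m i by (intro M.finsum_singleton) auto
  finally show ?thesis .
qed

text \<open>One inclusion holds because the preimage of the span is a submodule containing the unit
  vectors, the other because the image is a submodule containing the family.\<close>

lemma lincomb_image:
  assumes M: "module R M" and m: "m \<in> {..<n} \<rightarrow> carrier M"
  shows "lincomb M n m ` carrier (free_module R n) = module_span R M (m ` {..<n})"
proof
  interpret h: semilinear_map R R "\<lambda>r. r" "free_module R n" M "lincomb M n m"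
    using linear_lincomb[OF assms] .
  note R = h.M.R.is_cring
  have mM: "m ` {..<n} \<subseteq> carrier M" using m by auto
  have "submodule {x \<in> carrier (free_module R n). lincomb M n m x \<in> module_span R M (m ` {..<n})} R
      (free_module R n)" (is "submodule ?H _ _")
    using h.submodule_preimage submodule_span[OF M mM] by simp
  note H = this
  have "x \<in> ?H" if x: "x \<in> carrier (free_module R n)" for x
  proof (rule free_module_memI[OF R H x])
    fix i assume i: "i < n"
    have "unit_vector R i \<in> ?H"
      using unit_vector_closed[OF R i] lincomb_unit_vector[OF M m i] i
        span_superset[of "m ` {..<n}" R M] by auto
    then show "x i \<odot>\<^bsub>free_module R n\<^esub> unit_vector R i \<in> ?H"
      by (rule h.M.submoduleE(4)[OF H free_module_component[OF R x]])
  qed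
  then show "lincomb M n m ` carrier (free_module R n) \<subseteq> module_span R M (m ` {..<n})" by auto
  have "m i \<in> lincomb M n m ` carrier (free_module R n)" if "i < n" for i
    using lincomb_unit_vector[OF M m that] unit_vector_closed[OF R that] by (metis imageI)
  then show "module_span R M (m ` {..<n}) \<subseteq> lincomb M n m ` carrier (free_module R n)"
    by (intro span_least h.submodule_image h.M.carrier_is_submodule) auto
qed

lemma submodule_syzygies:
  assumes "module R M" and "m \<in> {..<n} \<rightarrow> carrier M"
  shows "submodule (syzygies R M n m) R (free_module R n)"
proof -
  interpret h: semilinear_map R R "\<lambda>r. r" "free_module R n" M "lincomb M n m"
    using linear_lincomb[OF assms] .
  have "submodule {\<zero>\<^bsub>M\<^esub>} R M" by (intro h.N.submoduleI) auto
  from h.submodule_preimage[OF this] show ?thesis by (simp add: syzygies_def)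
qed

lemma finite_indexing:
  assumes "finite B"
  obtains n :: nat and m :: "nat \<Rightarrow> 'b" where "m ` {..<n} = B"
  using finite_imp_nat_seg_image_inj_on[OF assms] by (auto simp: lessThan_def)

text \<open>Schanuel's argument: \<open>A\<close> and \<open>B\<close> lift the identity between the free module on \<open>m\<close> and the free
  module of a given finite presentation. The syzygies of \<open>m\<close> are then generated by the \<open>B\<close>-images of
  the given ones and the elements \<open>e\<^sub>j - B (A e\<^sub>j)\<close>.\<close>

lemma coherent_module_iff:
  fixes M :: "('a, 'b) module"
  assumes M: "module R M"
  shows "coherent_module R M \<longleftrightarrow> finitely_generated R M \<and>
    (\<forall>n. \<forall>m \<in> {..<n} \<rightarrow> carrier M.
      finitely_generated R ((free_module R n)\<lparr>carrier := syzygies R M n m\<rparr>))"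
proof (intro iffI conjI allI ballI)
  interpret module R M by fact
  note F = module_free_module[OF R.is_cring]
  assume coh: "coherent_module R M"
  then show "finitely_generated R M" by (simp add: coherent_module_def)
  fix n :: nat and m :: "nat \<Rightarrow> 'b" assume m: "m \<in> {..<n} \<rightarrow> carrier M"
  define H where "H = module_span R M (m ` {..<n})"
  have mM: "m ` {..<n} \<subseteq> carrier M" using m by auto
  have H: "submodule H R M" unfolding H_def by (rule submodule_span[OF M mM])
  note mH = span_superset[of "m ` {..<n}" R M, folded H_def]
  have "finitely_generated R (M\<lparr>carrier := H\<rparr>)"
    unfolding finitely_generated_submodule_iff[OF M H]
    using mH by (intro exI[of _ "m ` {..<n}"] conjI) (simp_all only: H_def finite_imageI finite_lessThan)
  then have "finitely_presented R (M\<lparr>carrier := H\<rparr>)"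
    using coh H by (simp add: coherent_module_def)
  then obtain p h where h: "h \<in> linear_maps R (free_module R p) (M\<lparr>carrier := H\<rparr>)"
    and im: "h ` carrier (free_module R p) = H"
    and fg: "finitely_generated R ((free_module R p)\<lparr>carrier :=
      kernel (add_monoid (free_module R p)) (add_monoid (M\<lparr>carrier := H\<rparr>)) h\<rparr>)"
    unfolding finitely_presented_def by (auto simp: linear_maps_def)
  have hl: "linear_map R (free_module R p) M h"
    using h submoduleE(1)[OF H] M F by (auto simp: linear_map_iff linear_maps_def)
  interpret h: semilinear_map R R "\<lambda>r. r" "free_module R p" M h by (rule hl)
  let ?K = "{x \<in> carrier (free_module R p). h x = \<zero>\<^bsub>M\<^esub>}"
  have "submodule {\<zero>\<^bsub>M\<^esub>} R M" by (intro submoduleI) auto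
  from h.submodule_preimage[OF this] have K: "submodule ?K R (free_module R p)" by simp
  have "finitely_generated R ((free_module R p)\<lparr>carrier := ?K\<rparr>)"
    using fg by (simp add: kernel_def)
  then obtain W where W: "finite W" "W \<subseteq> ?K" "?K = module_span R (free_module R p) W"
    unfolding finitely_generated_submodule_iff[OF F K] by (elim exE conjE)
  have "\<forall>j. \<exists>v. j < n \<longrightarrow> v \<in> carrier (free_module R p) \<and> h v = m j"
  proof
    fix j
    show "\<exists>v. j < n \<longrightarrow> v \<in> carrier (free_module R p) \<and> h v = m j"
    proof (cases "j < n")
      case True
      then have "m j \<in> h ` carrier (free_module R p)" using mH im by auto
      then show ?thesis by (elim imageE) auto
    qed simp
  qed
  then obtain \<alpha> where \<alpha>: "\<And>j. j < n \<Longrightarrow> \<alpha> j \<in> carrier (free_module R p)" "\<And>j. j < n \<Longrightarrow> h (\<alpha> j) = m j"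
    by metis
  have "\<forall>i. \<exists>v. i < p \<longrightarrow> v \<in> carrier (free_module R n) \<and> lincomb M n m v = h (unit_vector R i)"
  proof
    fix i
    show "\<exists>v. i < p \<longrightarrow> v \<in> carrier (free_module R n) \<and> lincomb M n m v = h (unit_vector R i)"
    proof (cases "i < p")
      case True
      then have "h (unit_vector R i) \<in> lincomb M n m ` carrier (free_module R n)"
        unfolding lincomb_image[OF M m] H_def[symmetric] im[symmetric]
        using unit_vector_closed[OF R.is_cring] by (intro imageI) simp
      then show ?thesis by (elim imageE) auto
    qed simp
  qed
  then obtain \<beta> where \<beta>: "\<And>i. i < p \<Longrightarrow> \<beta> i \<in> carrier (free_module R n)"
      "\<And>i. i < p \<Longrightarrow> lincomb M n m (\<beta> i) = h (unit_vector R i)"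
    by metis
  define A where "A = lincomb (free_module R p) n \<alpha>"
  define B where "B = lincomb (free_module R n) p \<beta>"
  have \<alpha>': "\<alpha> \<in> {..<n} \<rightarrow> carrier (free_module R p)" and \<beta>': "\<beta> \<in> {..<p} \<rightarrow> carrier (free_module R n)"
    using \<alpha> \<beta> by auto
  interpret l: semilinear_map R R "\<lambda>r. r" "free_module R n" M "lincomb M n m"
    by (rule linear_lincomb[OF M m])
  interpret A: semilinear_map R R "\<lambda>r. r" "free_module R n" "free_module R p" A
    unfolding A_def by (rule linear_lincomb[OF F \<alpha>'])
  interpret B: semilinear_map R R "\<lambda>r. r" "free_module R p" "free_module R n" B
    unfolding B_def by (rule linear_lincomb[OF F \<beta>'])
  have Ae: "A (unit_vector R j) = \<alpha> j" if "j < n" for j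
    unfolding A_def by (rule lincomb_unit_vector[OF F \<alpha>' that])
  have Be: "B (unit_vector R i) = \<beta> i" if "i < p" for i
    unfolding B_def by (rule lincomb_unit_vector[OF F \<beta>' that])
  have hA: "h (A x) = lincomb M n m x" if "x \<in> carrier (free_module R n)" for x
    using semilinear_free_eqI[OF R.is_cring semilinear_compose[OF A.semilinear_map_axioms h.semilinear_map_axioms, unfolded comp_def]
        l.semilinear_map_axioms _ that] Ae \<alpha> lincomb_unit_vector[OF M m] by simp
  have lB: "lincomb M n m (B y) = h y" if "y \<in> carrier (free_module R p)" for y
    using semilinear_free_eqI[OF R.is_cring semilinear_compose[OF B.semilinear_map_axioms l.semilinear_map_axioms, unfolded comp_def]
        h.semilinear_map_axioms _ that] Be \<beta> by simp
  let ?F = "free_module R n"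
  define Z where "Z = B ` W \<union> (\<lambda>j. unit_vector R j \<ominus>\<^bsub>?F\<^esub> B (\<alpha> j)) ` {..<n}"
  \<comment> \<open>\<open>B w\<close> pairs with \<open>m\<close> to \<open>h w\<close>, which
    vanishes on the kernel; and \<open>unit_vector R j\<close> and \<open>B (\<alpha> j)\<close>
    both pair with \<open>m\<close> to \<open>m j\<close>, so their difference pairs to
    zero.\<close>
  have Zsyz: "Z \<subseteq> syzygies R M n m"
  proof -
    have "lincomb M n m (B w) = \<zero>\<^bsub>M\<^esub>" "B w \<in> carrier ?F" if "w \<in> W" for w
      using W(2) that lB B.map_mem by auto
    moreover have "unit_vector R j \<ominus>\<^bsub>?F\<^esub> B (\<alpha> j) \<in> carrier ?F"
      "lincomb M n m (unit_vector R j \<ominus>\<^bsub>?F\<^esub> B (\<alpha> j)) = \<zero>\<^bsub>M\<^esub>" if j: "j < n" for j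
    proof -
      have e: "unit_vector R j \<in> carrier ?F" "B (\<alpha> j) \<in> carrier ?F"
        using unit_vector_closed[OF R.is_cring j] B.map_mem[OF \<alpha>(1)[OF j]] .
      then show "unit_vector R j \<ominus>\<^bsub>?F\<^esub> B (\<alpha> j) \<in> carrier ?F" by (simp add: l.M.minus_closed)
      have "m j \<in> carrier M" using m j by auto
      then show "lincomb M n m (unit_vector R j \<ominus>\<^bsub>?F\<^esub> B (\<alpha> j)) = \<zero>\<^bsub>M\<^esub>"
        using e j by (simp add: l.map_diff lincomb_unit_vector[OF M m] lB \<alpha>) (simp add: a_minus_def M.r_neg)
    qed
    ultimately show ?thesis by (auto simp: Z_def syzygies_def)
  qed
  have ZF: "Z \<subseteq> carrier ?F" using Zsyz by (auto simp: syzygies_def)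
  note T = submodule_span[OF F ZF]
  \<comment> \<open>The map x -> x - B (A x) is linear and sends unit vectors into \<open>Z\<close>,
    so it sends everything into the span.\<close>
  have diff: "x \<ominus>\<^bsub>?F\<^esub> B (A x) \<in> module_span R ?F Z" if x: "x \<in> carrier ?F" for x
  proof -
    interpret D: semilinear_map R R "\<lambda>r. r" ?F ?F "\<lambda>x. x \<ominus>\<^bsub>?F\<^esub> B (A x)"
    proof
      fix x y assume "x \<in> carrier ?F" "y \<in> carrier ?F"
      then show "x \<oplus>\<^bsub>?F\<^esub> y \<ominus>\<^bsub>?F\<^esub> B (A (x \<oplus>\<^bsub>?F\<^esub> y)) =
          (x \<ominus>\<^bsub>?F\<^esub> B (A x)) \<oplus>\<^bsub>?F\<^esub> (y \<ominus>\<^bsub>?F\<^esub> B (A y))"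
        using A.map_mem B.map_mem
        by (simp add: A.map_add B.map_add a_minus_def l.M.minus_add l.M.a_ac)
    next
      fix r x assume "r \<in> carrier R" "x \<in> carrier ?F"
      then show "r \<odot>\<^bsub>?F\<^esub> x \<ominus>\<^bsub>?F\<^esub> B (A (r \<odot>\<^bsub>?F\<^esub> x)) = r \<odot>\<^bsub>?F\<^esub> (x \<ominus>\<^bsub>?F\<^esub> B (A x))"
        using A.map_mem B.map_mem
        by (simp add: A.map_smult B.map_smult a_minus_def l.M.smult_r_distr l.M.smult_r_minus)
    qed (use A.map_mem B.map_mem in \<open>auto simp: l.M.minus_closed\<close>)
    note P = D.submodule_preimage[OF T]
    have "x \<in> {x \<in> carrier ?F. x \<ominus>\<^bsub>?F\<^esub> B (A x) \<in> module_span R ?F Z}" (is "x \<in> ?P")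
    proof (rule free_module_memI[OF R.is_cring P x])
      fix i assume i: "i < n"
      have "unit_vector R i \<ominus>\<^bsub>?F\<^esub> B (\<alpha> i) \<in> Z" using i by (simp add: Z_def)
      then have "unit_vector R i \<in> ?P"
        using unit_vector_closed[OF R.is_cring i] span_superset[of Z R ?F] Ae[OF i] by auto
      then show "x i \<odot>\<^bsub>?F\<^esub> unit_vector R i \<in> ?P"
        by (rule l.M.submoduleE(4)[OF P free_module_component[OF R.is_cring x]])
    qed
    then show ?thesis by simp
  qed
  \<comment> \<open>Decompose a syzygy as x = (x - B (A x)) + B (A x). Because
    \<open>h (A x)\<close> equals the pairing of x with \<open>m\<close>, \<open>A x\<close> lies in
    the kernel of \<open>h\<close>, which \<open>W\<close> spans.\<close>
  have "syzygies R M n m \<subseteq> module_span R ?F Z"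
  proof
    fix x assume "x \<in> syzygies R M n m"
    then have x: "x \<in> carrier ?F" "lincomb M n m x = \<zero>\<^bsub>M\<^esub>" by (simp_all add: syzygies_def)
    then have "A x \<in> ?K" using hA A.map_mem by simp
    then have "A x \<in> module_span R (free_module R p) W" using W(3) by simp
    then have "B (A x) \<in> B ` module_span R (free_module R p) W" by (rule imageI)
    also have "\<dots> \<subseteq> module_span R ?F (B ` W)" by (rule B.span_image) (use W(2) in auto)
    also have "\<dots> \<subseteq> module_span R ?F Z" by (rule span_mono) (simp add: Z_def)
    finally show "x \<in> module_span R ?F Z"
      using l.M.minus_submodule_cancel[OF T x(1) _ diff[OF x(1)]] by simp
  qed
  then have "syzygies R M n m = module_span R ?F Z"
    using span_least[OF submodule_syzygies[OF M m] Zsyz] by simp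
  then show "finitely_generated R (?F\<lparr>carrier := syzygies R M n m\<rparr>)"
    unfolding finitely_generated_submodule_iff[OF F submodule_syzygies[OF M m]]
    using W(1) Zsyz by (intro exI[of _ Z]) (simp add: Z_def)
next
  interpret module R M by fact
  note F = module_free_module[OF R.is_cring]
  assume asm: "finitely_generated R M \<and>
    (\<forall>n. \<forall>m \<in> {..<n} \<rightarrow> carrier M.
      finitely_generated R ((free_module R n)\<lparr>carrier := syzygies R M n m\<rparr>))"
  have "finitely_presented R (M\<lparr>carrier := H\<rparr>)"
    if H: "submodule H R M" and fg: "finitely_generated R (M\<lparr>carrier := H\<rparr>)" for H
  proof -
    \<comment> \<open>For the converse any finite generating family of H gives a presentation: its
      linear combinations map R^n onto H, with the syzygies as kernel.\<close>
    obtain B where B: "finite B" "B \<subseteq> H" "H = module_span R M B"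
      using fg unfolding finitely_generated_submodule_iff[OF M H] by (elim exE conjE)
    obtain n :: nat and m where nm: "m ` {..<n} = B" using finite_indexing[OF B(1)] .
    have m: "m \<in> {..<n} \<rightarrow> carrier M" using nm B(2) submoduleE(1)[OF H] by auto
    have im: "lincomb M n m ` carrier (free_module R n) = H"
      using lincomb_image[OF M m] nm B(3) by simp
    interpret l: semilinear_map R R "\<lambda>r. r" "free_module R n" M "lincomb M n m"
      by (rule linear_lincomb[OF M m])
    have "linear_map R (free_module R n) (M\<lparr>carrier := H\<rparr>) (lincomb M n m)"
      using l.semilinear_restrict[OF H] im by simp
    then show ?thesis
      unfolding finitely_presented_def linear_map_iff
      using asm m im
      by (intro exI[of _ n] bexI[of _ "lincomb M n m"]) (auto simp: kernel_def syzygies_def)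
  qed
  then show "coherent_module R M"
    using asm M by (simp add: coherent_module_def)
qed

section \<open>Relations modulo an ideal\<close>

lemma carrier_self [simp]: "carrier (self_module R) = carrier R"
  and zero_self [simp]: "\<zero>\<^bsub>self_module R\<^esub> = \<zero>\<^bsub>R\<^esub>"
  and add_self [simp]: "x \<oplus>\<^bsub>self_module R\<^esub> y = x \<oplus>\<^bsub>R\<^esub> y"
  and smult_self [simp]: "r \<odot>\<^bsub>self_module R\<^esub> x = r \<otimes>\<^bsub>R\<^esub> x"
  by (simp_all add: module_via_def)

lemma module_self:
  assumes "cring R"
  shows "module R (self_module R)"
proof -
  interpret cring R by fact
  show ?thesis
    by (intro moduleI abelian_groupI)
      (use assms in \<open>auto simp: a_ac m_assoc l_distr r_distr intro: l_neg a_inv_closed\<close>)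
qed

lemma ideal_submodule_self:
  assumes "cring R" and I: "ideal I R"
  shows "submodule I R (self_module R)"
proof -
  interpret M: module R "self_module R" by (rule module_self[OF assms(1)])
  interpret ideal I R by fact
  have neg: "\<ominus>\<^bsub>self_module R\<^esub> a = \<ominus>\<^bsub>R\<^esub> a" for a
    by (simp add: a_inv_def m_inv_def module_via_def)
  show ?thesis
    by (intro M.submoduleI) (use a_subset in \<open>auto simp: neg I_l_closed\<close>)
qed

text \<open>The elements congruent modulo W to something in the span of G form a submodule
  containing both G and W. The lemma splits an element of a span modulo W into a part over finitely
  many generators and an error in W.\<close>

lemma span_Un_decompose:
  fixes M :: "('a, 'b) module"
  assumes M: "module R M" and G: "G \<subseteq> carrier M" and W: "submodule W R M"
    and x: "x \<in> module_span R M (G \<union> W)"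
  obtains y where "y \<in> module_span R M G" "x \<ominus>\<^bsub>M\<^esub> y \<in> W"
proof -
  interpret module R M by fact
  note S = submodule_span[OF M G]
  note WE = submoduleE[OF W] and SE = submoduleE[OF S]
  have neg_zero: "\<ominus>\<^bsub>M\<^esub> \<zero>\<^bsub>M\<^esub> = \<zero>\<^bsub>M\<^esub>" using M.r_neg[OF M.zero_closed] by simp
  let ?H = "{x \<in> carrier M. \<exists>y \<in> module_span R M G. x \<ominus>\<^bsub>M\<^esub> y \<in> W}"
  have "submodule ?H R M"
  proof (rule submoduleI)
    show "\<zero>\<^bsub>M\<^esub> \<in> ?H"
      using submodule_zero_closed[OF S] submodule_zero_closed[OF W]
      by (auto intro!: bexI[of _ "\<zero>\<^bsub>M\<^esub>"] simp: a_minus_def neg_zero)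
    show "\<ominus>\<^bsub>M\<^esub> a \<in> ?H" if "a \<in> ?H" for a
    proof -
      obtain y where y: "y \<in> module_span R M G" "a \<ominus>\<^bsub>M\<^esub> y \<in> W" and a: "a \<in> carrier M"
        using \<open>a \<in> ?H\<close> by auto
      have yM: "y \<in> carrier M" using y(1) SE(1) by auto
      have "\<ominus>\<^bsub>M\<^esub> a \<ominus>\<^bsub>M\<^esub> (\<ominus>\<^bsub>M\<^esub> y) = \<ominus>\<^bsub>M\<^esub> (a \<ominus>\<^bsub>M\<^esub> y)"
        using a yM by (simp add: a_minus_def M.minus_add)
      with WE(3)[OF y(2)] SE(3)[OF y(1)] a show ?thesis
        by (auto intro!: bexI[of _ "\<ominus>\<^bsub>M\<^esub> y"])
    qed
    show "a \<oplus>\<^bsub>M\<^esub> b \<in> ?H" if "a \<in> ?H" "b \<in> ?H" for a b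
    proof -
      obtain y where y: "y \<in> module_span R M G" "a \<ominus>\<^bsub>M\<^esub> y \<in> W" "a \<in> carrier M"
        using \<open>a \<in> ?H\<close> by auto
      obtain z where z: "z \<in> module_span R M G" "b \<ominus>\<^bsub>M\<^esub> z \<in> W" "b \<in> carrier M"
        using \<open>b \<in> ?H\<close> by auto
      have yM: "y \<in> carrier M" "z \<in> carrier M" using y(1) z(1) SE(1) by auto
      have "a \<oplus>\<^bsub>M\<^esub> b \<ominus>\<^bsub>M\<^esub> (y \<oplus>\<^bsub>M\<^esub> z) = (a \<ominus>\<^bsub>M\<^esub> y) \<oplus>\<^bsub>M\<^esub> (b \<ominus>\<^bsub>M\<^esub> z)"
        using y(3) z(3) yM by (simp add: a_minus_def M.minus_add M.a_ac)
      with WE(5)[OF y(2) z(2)] SE(5)[OF y(1) z(1)] y(3) z(3) show ?thesis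
        by (auto intro!: bexI[of _ "y \<oplus>\<^bsub>M\<^esub> z"])
    qed
    show "r \<odot>\<^bsub>M\<^esub> a \<in> ?H" if r: "r \<in> carrier R" and "a \<in> ?H" for r a
    proof -
      obtain y where y: "y \<in> module_span R M G" "a \<ominus>\<^bsub>M\<^esub> y \<in> W" and a: "a \<in> carrier M"
        using \<open>a \<in> ?H\<close> by auto
      have yM: "y \<in> carrier M" using y(1) SE(1) by auto
      have "r \<odot>\<^bsub>M\<^esub> a \<ominus>\<^bsub>M\<^esub> (r \<odot>\<^bsub>M\<^esub> y) = r \<odot>\<^bsub>M\<^esub> (a \<ominus>\<^bsub>M\<^esub> y)"
        using r a yM by (simp add: a_minus_def smult_r_distr smult_r_minus)
      with WE(4)[OF r y(2)] SE(4)[OF r y(1)] r a show ?thesis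
        by (auto intro!: bexI[of _ "r \<odot>\<^bsub>M\<^esub> y"])
    qed
  qed auto
  moreover have "G \<union> W \<subseteq> ?H"
  proof
    fix g assume g: "g \<in> G \<union> W"
    then have gM: "g \<in> carrier M" using G WE(1) by auto
    show "g \<in> ?H"
    proof (cases "g \<in> G")
      case True
      then show ?thesis
        using gM submodule_zero_closed[OF W] span_superset[of G R M]
        by (auto intro!: bexI[of _ g] simp: a_minus_def M.r_neg)
    next
      case False
      then show ?thesis
        using g gM submodule_zero_closed[OF S]
        by (auto intro!: bexI[of _ "\<zero>\<^bsub>M\<^esub>"] simp: a_minus_def neg_zero)
    qed
  qed
  ultimately have "x \<in> ?H" using x span_least by blast
  then show thesis using that by auto
qed

text \<open>This is J^n inside R^n, the kernel of R^n -> (R/J)^n. The condition may range over all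
  indices because the entries from n on are zero.\<close>

definition vectors_in :: "('a, 'r) ring_scheme \<Rightarrow> 'a set \<Rightarrow> nat \<Rightarrow> (nat \<Rightarrow> 'a) set" where
  "vectors_in R J n = {x \<in> carrier (free_module R n). \<forall>i. x i \<in> J}"

text \<open>The preimage in R^n of the syzygies over R/J of the classes of b_0, ...,
  b_(n-1).\<close>

definition relations ::
    "('a, 'r) ring_scheme \<Rightarrow> 'a set \<Rightarrow> nat \<Rightarrow> (nat \<Rightarrow> 'a) \<Rightarrow> (nat \<Rightarrow> 'a) set" where
  "relations R J n b = {x \<in> carrier (free_module R n). lincomb (self_module R) n b x \<in> J}"

text \<open>For ideals J \<subseteq> I, the syzygy half of coherence of I/J as an R/J-module, stated
  on representatives. Finite generation of I/J is the other half and is expressed separately by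
  \<open>finite_modulo\<close>.\<close>

definition coherent_modulo :: "('a, 'r) ring_scheme \<Rightarrow> 'a set \<Rightarrow> 'a set \<Rightarrow> bool" where
  "coherent_modulo R J I \<longleftrightarrow> (\<forall>n. \<forall>b \<in> {..<n} \<rightarrow> I.
    finite_modulo R (free_module R n) (vectors_in R J n) (relations R J n b))"

lemma submodule_vectors_in:
  assumes R: "cring R" and J: "ideal J R"
  shows "submodule (vectors_in R J n) R (free_module R n)"
proof -
  interpret ideal J R by fact
  interpret F: module R "free_module R n" by (rule module_free_module[OF R])
  have neg: "\<ominus>\<^bsub>free_module R n\<^esub> a = (\<lambda>i. \<ominus>\<^bsub>R\<^esub> a i)" if a: "a \<in> carrier (free_module R n)" for a
  proof (rule F.M.minus_equality)
    show a': "(\<lambda>i. \<ominus>\<^bsub>R\<^esub> a i) \<in> carrier (free_module R n)"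
      using a by (auto simp: carrier_free_module)
    show "(\<lambda>i. \<ominus>\<^bsub>R\<^esub> a i) \<oplus>\<^bsub>free_module R n\<^esub> a = \<zero>\<^bsub>free_module R n\<^esub>"
      using free_module_component[OF R a] by (simp add: add_free_module zero_free_module l_neg)
  qed (rule a)
  show ?thesis
    by (intro F.submoduleI)
      (auto simp: vectors_in_def neg zero_free_module add_free_module smult_free_module
        carrier_free_module I_l_closed)
qed

lemma linear_pairing:
  assumes "cring R" and "b \<in> {..<n} \<rightarrow> carrier R"
  shows "linear_map R (free_module R n) (self_module R) (lincomb (self_module R) n b)"
  by (rule linear_lincomb[OF module_self[OF assms(1)]]) (use assms(2) in simp)

lemma pairing_unit_vector:
  assumes "cring R" and "b \<in> {..<n} \<rightarrow> carrier R" and "i < n"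
  shows "lincomb (self_module R) n b (unit_vector R i) = b i"
  by (rule lincomb_unit_vector[OF module_self[OF assms(1)]]) (use assms(2,3) in simp_all)

lemma submodule_relations:
  assumes R: "cring R" and J: "ideal J R" and b: "b \<in> {..<n} \<rightarrow> carrier R"
  shows "submodule (relations R J n b) R (free_module R n)"
  using semilinear_map.submodule_preimage[OF linear_pairing[OF R b] ideal_submodule_self[OF R J]]
  by (simp add: relations_def)

text \<open>This inclusion is what makes \<open>finite_modulo\<close> with J^n a statement about the
  quotient of the relations by J^n.\<close>

lemma vectors_in_subset_relations:
  assumes R: "cring R" and J: "ideal J R" and b: "b \<in> {..<n} \<rightarrow> carrier R"
  shows "vectors_in R J n \<subseteq> relations R J n b"
proof
  interpret ideal J R by fact
  interpret l: semilinear_map R R "\<lambda>r. r" "free_module R n" "self_module R" "lincomb (self_module R) n b"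
    by (rule linear_pairing[OF R b])
  fix x assume "x \<in> vectors_in R J n"
  then have x: "x \<in> carrier (free_module R n)" "\<And>i. x i \<in> J" by (auto simp: vectors_in_def)
  show "x \<in> relations R J n b"
  proof (rule free_module_memI[OF R submodule_relations[OF assms] x(1)])
    fix i assume i: "i < n"
    have "b i \<in> carrier R" using b i by auto
    then have "x i \<otimes>\<^bsub>R\<^esub> b i \<in> J" using x(2) I_r_closed by simp
    then show "x i \<odot>\<^bsub>free_module R n\<^esub> unit_vector R i \<in> relations R J n b"
      using unit_vector_closed[OF R i] free_module_component[OF R x(1)]
      by (simp add: relations_def l.map_smult pairing_unit_vector[OF R b i])
  qed
qed

text \<open>Coherence modulo J' gives generators of the relations modulo J' only up to J'^n. As J'
  is finitely generated up to J, so is J'^n up to J^n, which yields one finite set G that works up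
  to J^n. The elements of G pair with b to a finite family w in J'. A relation modulo J is, up to
  J^n, a combination of G whose coefficients form a relation of w modulo J, and these coefficient
  vectors are finitely generated up to J by coherence of J'/J.\<close>

lemma coherent_modulo_extension:
  assumes R: "cring R" and J: "ideal J R" and J': "ideal J' R" and JJ': "J \<subseteq> J'"
    and quot: "coherent_modulo R J' (carrier R)"
    and fg: "finite_modulo R (self_module R) J J'" and coh: "coherent_modulo R J J'"
  shows "coherent_modulo R J (carrier R)"
  unfolding coherent_modulo_def
proof (intro allI ballI)
  fix n :: nat and b assume b: "b \<in> {..<n} \<rightarrow> carrier R"
  let ?F = "free_module R n" and ?A = "self_module R"
  let ?K = "relations R J n b" and ?K' = "relations R J' n b"
  interpret J: ideal J R by (rule J)
  interpret J': ideal J' R by (rule J')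
  note MF = module_free_module[OF R]
  interpret l: semilinear_map R R "\<lambda>r. r" ?F ?A "lincomb ?A n b"
    by (rule linear_pairing[OF R b])
  note VJ = submodule_vectors_in[OF R J, of n]
  note KE = submodule_relations[OF R J b]
  obtain Z where Z: "finite Z" "Z \<subseteq> ?K'" "?K' \<subseteq> module_span R ?F (Z \<union> vectors_in R J' n)"
    using quot b unfolding coherent_modulo_def finite_modulo_def by metis
  obtain U where U: "finite U" "U \<subseteq> J'" "J' \<subseteq> module_span R ?A (U \<union> J)"
    using fg unfolding finite_modulo_def by metis
  \<comment> \<open>The products u e_i, with u among the generators of J' up to J, generate J'^n up
    to J^n.\<close>
  define U' where "U' = (\<lambda>(u, i). u \<odot>\<^bsub>?F\<^esub> unit_vector R i) ` (U \<times> {..<n})"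
  have JR: "J' \<subseteq> carrier R" using J'.a_subset .
  have scaled: "s \<odot>\<^bsub>?F\<^esub> unit_vector R i \<in> vectors_in R I n"
    if "ideal I R" "s \<in> I" "i < n" for I s i
  proof -
    interpret I: ideal I R by fact
    have "s \<in> carrier R" using that(2) I.a_subset by auto
    moreover have "s \<odot>\<^bsub>?F\<^esub> unit_vector R i \<in> carrier ?F"
      using calculation unit_vector_closed[OF R that(3)] by simp
    ultimately show ?thesis
      using that by (auto simp: vectors_in_def smult_free_module unit_vector_def)
  qed
  have U'V: "U' \<subseteq> vectors_in R J' n" using U(2) scaled[OF J'] by (auto simp: U'_def)
  define G where "G = Z \<union> U'"
  have finG: "finite G" using Z(1) U(1) by (simp add: G_def U'_def)
  have GK: "G \<subseteq> ?K'" using Z(2) U'V vectors_in_subset_relations[OF R J' b] by (auto simp: G_def)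
  have GF: "G \<subseteq> carrier ?F" using GK by (auto simp: relations_def)
  have GVF: "G \<union> vectors_in R J n \<subseteq> carrier ?F" using GF by (auto simp: vectors_in_def)
  note T = submodule_span[OF MF GVF]
  have V'T: "vectors_in R J' n \<subseteq> module_span R ?F (G \<union> vectors_in R J n)" (is "_ \<subseteq> ?T")
  proof
    fix x assume "x \<in> vectors_in R J' n"
    then have x: "x \<in> carrier ?F" "\<And>i. x i \<in> J'" by (auto simp: vectors_in_def)
    show "x \<in> ?T"
    proof (rule free_module_memI[OF R T x(1)])
      fix i assume i: "i < n"
      \<comment> \<open>Multiplication into the i-th coordinate is linear, so it carries the
        decomposition of x_i over \<open>U\<close> and J to one over \<open>U'\<close> and
        J^n.\<close>
      interpret s: semilinear_map R R "\<lambda>r. r" ?A ?F "\<lambda>s. s \<odot>\<^bsub>?F\<^esub> unit_vector R i"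
        by unfold_locales
          (use unit_vector_closed[OF R i] in \<open>auto simp: l.M.smult_l_distr l.M.smult_assoc1\<close>)
      have "x i \<in> module_span R ?A (U \<union> J)" using x(2) U(3) by auto
      then have "x i \<odot>\<^bsub>?F\<^esub> unit_vector R i \<in>
          (\<lambda>s. s \<odot>\<^bsub>?F\<^esub> unit_vector R i) ` module_span R ?A (U \<union> J)" by (rule imageI)
      also have "\<dots> \<subseteq> module_span R ?F ((\<lambda>s. s \<odot>\<^bsub>?F\<^esub> unit_vector R i) ` (U \<union> J))"
        by (rule s.span_image) (use U(2) JJ' JR in auto)
      also have "\<dots> \<subseteq> ?T"
        by (rule span_mono) (use i scaled[OF J] in \<open>auto simp: G_def U'_def\<close>)
      finally show "x i \<odot>\<^bsub>?F\<^esub> unit_vector R i \<in> ?T" .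
    qed
  qed
  have "module_span R ?F (Z \<union> vectors_in R J' n) \<subseteq> ?T"
    by (rule span_least[OF T]) (use V'T span_superset[of "G \<union> vectors_in R J n" R ?F] in \<open>auto simp: G_def\<close>)
  with Z(3) have K'T: "?K' \<subseteq> ?T" by simp
  obtain T :: nat and g where g: "g ` {..<T} = G" using finite_indexing[OF finG] .
  define \<phi> where "\<phi> = lincomb ?F T g"
  \<comment> \<open>Since \<open>G\<close> consists of relations modulo J', the entries of
    \<open>w\<close> lie in J', so that coherence of J'/J applies to this family.\<close>
  define w where "w = (\<lambda>t. lincomb ?A n b (g t))"
  have gF: "g \<in> {..<T} \<rightarrow> carrier ?F" using g GF by auto
  interpret \<phi>: semilinear_map R R "\<lambda>r. r" "free_module R T" ?F \<phi>
    unfolding \<phi>_def by (rule linear_lincomb[OF MF gF])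
  have \<phi>e: "\<phi> (unit_vector R t) = g t" if "t < T" for t
    unfolding \<phi>_def by (rule lincomb_unit_vector[OF MF gF that])
  have wJ: "w \<in> {..<T} \<rightarrow> J'" using g GK by (auto simp: w_def relations_def)
  then have wR: "w \<in> {..<T} \<rightarrow> carrier R" using JR by auto
  have l\<phi>: "lincomb ?A n b (\<phi> c) = lincomb ?A T w c" if "c \<in> carrier (free_module R T)" for c
    using semilinear_free_eqI[OF R semilinear_compose[OF \<phi>.semilinear_map_axioms l.semilinear_map_axioms, unfolded comp_def]
        linear_pairing[OF R wR] _ that] \<phi>e pairing_unit_vector[OF R wR] by (simp add: w_def)
  obtain V where V: "finite V" "V \<subseteq> relations R J T w"
      "relations R J T w \<subseteq> module_span R (free_module R T) (V \<union> vectors_in R J T)"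
    using coh wJ unfolding coherent_modulo_def finite_modulo_def by metis
  have VF: "V \<subseteq> carrier (free_module R T)" using V(2) by (auto simp: relations_def)
  have \<phi>V: "\<phi> ` V \<subseteq> ?K" using V(2) l\<phi> \<phi>.map_mem by (auto simp: relations_def)
  \<comment> \<open>The coefficient vectors are known only up to J^T; \<open>\<phi>\<close> moves
    this ambiguity into J^n, where it is harmless.\<close>
  have \<phi>J: "\<phi> ` vectors_in R J T \<subseteq> vectors_in R J n"
  proof
    fix y assume "y \<in> \<phi> ` vectors_in R J T"
    then obtain c where c: "y = \<phi> c" "c \<in> carrier (free_module R T)" "\<And>i. c i \<in> J"
      by (auto simp: vectors_in_def)
    have "c \<in> {c \<in> carrier (free_module R T). \<phi> c \<in> vectors_in R J n}"
    proof (rule free_module_memI[OF R \<phi>.submodule_preimage[OF VJ] c(2)])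
      fix t assume t: "t < T"
      have ct: "c t \<in> carrier R" by (rule free_module_component[OF R c(2)])
      have gt: "g t \<in> carrier ?F" using gF t by auto
      have "c t \<odot>\<^bsub>?F\<^esub> g t \<in> carrier ?F" using ct gt by simp
      then have "c t \<odot>\<^bsub>?F\<^esub> g t \<in> vectors_in R J n"
        using c(3)[of t] free_module_component[OF R gt]
        by (simp add: vectors_in_def smult_free_module J.I_r_closed)
      then show "c t \<odot>\<^bsub>free_module R T\<^esub> unit_vector R t
          \<in> {c \<in> carrier (free_module R T). \<phi> c \<in> vectors_in R J n}"
        using ct unit_vector_closed[OF R t] \<phi>e[OF t] by (simp add: \<phi>.map_smult)
    qed
    then show "y \<in> vectors_in R J n" using c(1) by simp
  qed
  have BF: "\<phi> ` V \<union> vectors_in R J n \<subseteq> carrier ?F"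
    using VF \<phi>.map_mem by (auto simp: vectors_in_def)
  note Q = submodule_span[OF MF BF]
  have "?K \<subseteq> module_span R ?F (\<phi> ` V \<union> vectors_in R J n)" (is "_ \<subseteq> ?Q")
  proof
    fix x assume x: "x \<in> ?K"
    then have xF: "x \<in> carrier ?F" by (simp add: relations_def)
    have "x \<in> ?T" using x K'T JJ' by (auto simp: relations_def)
    then obtain y where y: "y \<in> module_span R ?F G" "x \<ominus>\<^bsub>?F\<^esub> y \<in> vectors_in R J n"
      using span_Un_decompose[OF MF GF VJ] by metis
    then obtain c where c: "y = \<phi> c" "c \<in> carrier (free_module R T)"
      using lincomb_image[OF MF gF, unfolded g, folded \<phi>_def] by (metis imageE)
    have yF: "y \<in> carrier ?F" using c \<phi>.map_mem by simp
    \<comment> \<open>The error x - y lies in J^n and hence among the relations, so y is again a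
      relation modulo J; pairing it with b shows that its coefficients \<open>c\<close> are a
      relation of \<open>w\<close>.\<close>
    have "x \<ominus>\<^bsub>?F\<^esub> y \<in> ?K" using y(2) vectors_in_subset_relations[OF R J b] by auto
    then have "x \<ominus>\<^bsub>?F\<^esub> (x \<ominus>\<^bsub>?F\<^esub> y) \<in> ?K" by (rule l.M.submodule_minus_closed[OF KE x])
    also have "x \<ominus>\<^bsub>?F\<^esub> (x \<ominus>\<^bsub>?F\<^esub> y) = y"
      using xF yF by (simp add: a_minus_def l.M.minus_add l.M.r_neg2)
    finally have "c \<in> relations R J T w"
      using c l\<phi> by (simp add: relations_def)
    then have "y \<in> \<phi> ` module_span R (free_module R T) (V \<union> vectors_in R J T)"
      using V(3) c(1) by auto
    also have "\<dots> \<subseteq> module_span R ?F (\<phi> ` (V \<union> vectors_in R J T))"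
      by (rule \<phi>.span_image) (use VF in \<open>auto simp: vectors_in_def\<close>)
    also have "\<dots> \<subseteq> ?Q" by (rule span_mono) (use \<phi>J in auto)
    finally have "y \<in> ?Q" .
    moreover have "x \<ominus>\<^bsub>?F\<^esub> y \<in> ?Q"
      using y(2) span_superset[of "\<phi> ` V \<union> vectors_in R J n" R ?F] by auto
    ultimately show "x \<in> ?Q" by (rule l.M.minus_submodule_cancel[OF Q xF])
  qed
  then show "finite_modulo R ?F (vectors_in R J n) ?K"
    unfolding finite_modulo_def using V(1) \<phi>V by (intro exI[of _ "\<phi> ` V"]) simp
qed

section \<open>Coherence over a quotient ring\<close>

context ideal
begin

lemma carrier_quotient: "carrier (R Quot I) = (+>) I ` carrier R"
  by (auto simp: FactRing_def A_RCOSETS_def')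

lemma zero_quotient: "\<zero>\<^bsub>R Quot I\<^esub> = I"
  by (simp add: FactRing_def)

lemma coset_eq_zero_iff:
  assumes "x \<in> carrier R"
  shows "I +> x = I \<longleftrightarrow> x \<in> I"
  using assms a_rcos_self a_rcos_const by blast

text \<open>Equal cosets of I differ by an element of I, and I \<subseteq> K, so membership in K
  depends only on the coset.\<close>

lemma coset_mem_image_iff:
  assumes K: "ideal K R" and IK: "I \<subseteq> K" and x: "x \<in> carrier R"
  shows "I +> x \<in> (+>) I ` K \<longleftrightarrow> x \<in> K"
proof
  interpret K: ideal K R by (rule K)
  assume "I +> x \<in> (+>) I ` K"
  then obtain y where y: "I +> x = I +> y" "y \<in> K" by (elim imageE)
  have "x \<in> I +> y" using a_rcos_self[OF x] y(1) by simp
  then obtain h where "h \<in> I" "x = h \<oplus> y" by (auto simp: a_r_coset_def')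
  then show "x \<in> K" using IK y(2) K.a_closed by auto
qed (rule imageI)

lemma semilinear_quotient:
  assumes "cring R"
  shows "semilinear_map R (R Quot I) ((+>) I) (self_module R) (self_module (R Quot I)) ((+>) I)"
proof -
  interpret M: module R "self_module R" by (rule module_self[OF assms])
  interpret N: module "R Quot I" "self_module (R Quot I)"
    by (rule module_self[OF quotient_is_cring[OF assms]])
  show ?thesis
    by unfold_locales
      (use rcos_ring_hom in \<open>auto simp: ring_hom_closed ring_hom_add ring_hom_mult\<close>)
qed

lemma semilinear_free_quotient:
  assumes R: "cring R"
  shows "semilinear_map R (R Quot I) ((+>) I) (free_module R n) (free_module (R Quot I) n)
    (\<lambda>x i. I +> x i)" (is "semilinear_map _ _ _ _ _ ?p")
    and "(\<lambda>x i. I +> x i) ` carrier (free_module R n) = carrier (free_module (R Quot I) n)"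
    and "{x \<in> carrier (free_module R n). (\<lambda>i. I +> x i) = \<zero>\<^bsub>free_module (R Quot I) n\<^esub>} = vectors_in R I n"
proof -
  note Q = quotient_is_cring[OF R]
  note comp = free_module_component[OF R]
  interpret M: module R "free_module R n" by (rule module_free_module[OF R])
  interpret N: module "R Quot I" "free_module (R Quot I) n" by (rule module_free_module[OF Q])
  note hom = rcos_ring_hom
  have p_closed: "?p x \<in> carrier (free_module (R Quot I) n)" if x: "x \<in> carrier (free_module R n)" for x
    using x comp[OF x] ring_hom_closed[OF hom] coset_eq_zero_iff[OF zero_closed]
    by (auto simp: carrier_free_module zero_quotient)
  show "semilinear_map R (R Quot I) ((+>) I) (free_module R n) (free_module (R Quot I) n) ?p"
  proof
    fix x y assume x: "x \<in> carrier (free_module R n)" and y: "y \<in> carrier (free_module R n)"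
    show "?p (x \<oplus>\<^bsub>free_module R n\<^esub> y) = ?p x \<oplus>\<^bsub>free_module (R Quot I) n\<^esub> ?p y"
      using comp[OF x] comp[OF y] by (simp add: add_free_module ring_hom_add[OF hom])
  next
    fix r x assume x: "x \<in> carrier (free_module R n)" and r: "r \<in> carrier R"
    show "?p (r \<odot>\<^bsub>free_module R n\<^esub> x) = (I +> r) \<odot>\<^bsub>free_module (R Quot I) n\<^esub> ?p x"
      using comp[OF x] r by (simp add: smult_free_module ring_hom_mult[OF hom])
  qed (use p_closed ring_hom_closed[OF hom] in auto)
  show "?p ` carrier (free_module R n) = carrier (free_module (R Quot I) n)"
  proof
    show "carrier (free_module (R Quot I) n) \<subseteq> ?p ` carrier (free_module R n)"
    proof
      fix y assume y: "y \<in> carrier (free_module (R Quot I) n)"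
      \<comment> \<open>Representatives beyond index n must be chosen as zero itself, not just in I,
        for the lift to belong to R^n.\<close>
      have "\<forall>i. \<exists>x. x \<in> carrier R \<and> (i \<ge> n \<longrightarrow> x = \<zero>) \<and> I +> x = y i"
      proof
        fix i
        show "\<exists>x. x \<in> carrier R \<and> (i \<ge> n \<longrightarrow> x = \<zero>) \<and> I +> x = y i"
        proof (cases "i < n")
          case True
          then have "y i \<in> (+>) I ` carrier R" using y by (simp add: carrier_free_module carrier_quotient)
          then show ?thesis using True by auto
        next
          case False
          then have "y i = I" using y by (simp add: carrier_free_module zero_quotient)
          then show ?thesis
            using coset_eq_zero_iff[OF zero_closed] by (intro exI[of _ \<zero>]) simp
        qed
      qed
      then obtain x where x: "\<And>i. x i \<in> carrier R" "\<And>i. i \<ge> n \<Longrightarrow> x i = \<zero>" "\<And>i. I +> x i = y i"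
        by metis
      then have "x \<in> carrier (free_module R n)" "y = ?p x"
        by (auto simp: carrier_free_module fun_eq_iff)
      then show "y \<in> ?p ` carrier (free_module R n)" by simp
    qed
  qed (use p_closed in auto)
  show "{x \<in> carrier (free_module R n). ?p x = \<zero>\<^bsub>free_module (R Quot I) n\<^esub>} = vectors_in R I n"
  unfolding vectors_in_def
  proof (rule Collect_cong)
    fix x
    show "x \<in> carrier (free_module R n) \<and> ?p x = \<zero>\<^bsub>free_module (R Quot I) n\<^esub> \<longleftrightarrow>
        x \<in> carrier (free_module R n) \<and> (\<forall>i. x i \<in> I)"
      using coset_eq_zero_iff[OF comp[of x]] unfolding zero_free_module zero_quotient fun_eq_iff by metis
  qed
qed

lemma coset_unit_vector: "(\<lambda>i. I +> unit_vector R j i) = unit_vector (R Quot I) j"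
  using coset_eq_zero_iff[OF zero_closed]
  by (auto simp: unit_vector_def FactRing_def fun_eq_iff)

lemma submodule_quotient_ideal:
  assumes R: "cring R" and K: "ideal K R"
  shows "submodule ((+>) I ` K) (R Quot I) (self_module (R Quot I))"
  using semilinear_map.submodule_image[OF semilinear_quotient[OF R] ideal_submodule_self[OF R K]]
  by (simp add: carrier_quotient)

lemma module_quotient_ideal:
  assumes R: "cring R" and K: "ideal K R"
  shows "module (R Quot I) (quotient_ideal_module R K I)"
  unfolding quotient_ideal_module_def
  by (rule submodule.submodule_is_module[OF submodule_quotient_ideal[OF assms]
      module_self[OF quotient_is_cring[OF R]]])

text \<open>The preimage of the syzygies under R^n -> (R/I)^n is \<open>relations R I n b\<close>,
  and the kernel of that map is I^n; the criterion for images then applies.\<close>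

lemma finitely_generated_syzygies_quotient_iff:
  assumes R: "cring R" and K: "ideal K R" and IK: "I \<subseteq> K"
    and b: "b \<in> {..<n} \<rightarrow> K" and m: "\<And>i. i < n \<Longrightarrow> m i = I +> b i"
  defines "M \<equiv> quotient_ideal_module R K I"
  shows "finitely_generated (R Quot I) (free_module (R Quot I) n\<lparr>carrier := syzygies (R Quot I) M n m\<rparr>)
    \<longleftrightarrow> finite_modulo R (free_module R n) (vectors_in R I n) (relations R I n b)"
proof -
  note MM = module_quotient_ideal[OF R K, folded M_def]
  note Q = quotient_is_cring[OF R]
  interpret K: ideal K R by (rule K)
  interpret p: semilinear_map R "R Quot I" "(+>) I" "free_module R n" "free_module (R Quot I) n" "\<lambda>x i. I +> x i"
    by (rule semilinear_free_quotient(1)[OF R])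
  have bR: "b \<in> {..<n} \<rightarrow> carrier R" using b K.a_subset by auto
  have mM: "m \<in> {..<n} \<rightarrow> carrier M" using b m by (auto simp: M_def quotient_ideal_module_def)
  interpret l: semilinear_map R R "\<lambda>r. r" "free_module R n" "self_module R" "lincomb (self_module R) n b"
    by (rule linear_pairing[OF R bR])
  interpret l': semilinear_map "R Quot I" "R Quot I" "\<lambda>r. r" "free_module (R Quot I) n" M
      "lincomb M n m"
    by (rule linear_lincomb[OF MM mM])
  \<comment> \<open>All pairings with b lie in K because b does. This lets the composite with the
    quotient map be restricted to a map into K/I.\<close>
  have "relations R K n b = carrier (free_module R n)"
  proof
    show "carrier (free_module R n) \<subseteq> relations R K n b"
    proof
      fix x assume x: "x \<in> carrier (free_module R n)"
      note S = submodule_relations[OF R K bR]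
      show "x \<in> relations R K n b"
      proof (rule free_module_memI[OF R S x])
        fix i assume i: "i < n"
        have "unit_vector R i \<in> relations R K n b"
          using b i unit_vector_closed[OF R i] pairing_unit_vector[OF R bR i] by (auto simp: relations_def)
        then show "x i \<odot>\<^bsub>free_module R n\<^esub> unit_vector R i \<in> relations R K n b"
          by (rule p.M.submoduleE(4)[OF S free_module_component[OF R x]])
      qed
    qed
  qed (simp add: relations_def)
  then have im: "((+>) I \<circ> lincomb (self_module R) n b) ` carrier (free_module R n) \<subseteq> (+>) I ` K"
    by (auto simp: relations_def)
  have ql: "semilinear_map R (R Quot I) ((+>) I) (free_module R n) M
      ((+>) I \<circ> lincomb (self_module R) n b)"
    unfolding M_def quotient_ideal_module_def
    using semilinear_map.semilinear_restrict[OF semilinear_compose[OF l.semilinear_map_axioms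
        semilinear_quotient[OF R]] submodule_quotient_ideal[OF R K] im]
    by (simp add: comp_def)
  have lp: "semilinear_map R (R Quot I) ((+>) I) (free_module R n) M
      (lincomb M n m \<circ> (\<lambda>x i. I +> x i))"
    using semilinear_compose[OF p.semilinear_map_axioms l'.semilinear_map_axioms]
    by (simp add: comp_def)
  \<comment> \<open>Both sides are maps semilinear along R -> R/I, and on the i-th unit vector both
    give the class of b_i.\<close>
  have key: "lincomb M n m (\<lambda>i. I +> x i) = I +> lincomb (self_module R) n b x"
    if x: "x \<in> carrier (free_module R n)" for x
    using semilinear_free_eqI[OF R lp ql _ x] coset_unit_vector m
      lincomb_unit_vector[OF MM mM] pairing_unit_vector[OF R bR] by simp
  have "{x \<in> carrier (free_module R n). (\<lambda>i. I +> x i) \<in> syzygies (R Quot I) M n m} = relations R I n b"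
    unfolding relations_def
  proof (rule Collect_cong)
    fix x
    have zero_M: "\<zero>\<^bsub>M\<^esub> = I" by (simp add: M_def quotient_ideal_module_def zero_quotient)
    show "x \<in> carrier (free_module R n) \<and> (\<lambda>i. I +> x i) \<in> syzygies (R Quot I) M n m \<longleftrightarrow>
        x \<in> carrier (free_module R n) \<and> lincomb (self_module R) n b x \<in> I"
      using key[of x] p.map_mem[of x] l.map_mem[of x] coset_eq_zero_iff[of "lincomb (self_module R) n b x"]
      unfolding syzygies_def zero_M by auto
  qed
  then show ?thesis
    using p.finitely_generated_image_iff[OF carrier_quotient[symmetric] semilinear_free_quotient(2)[OF R]
        submodule_syzygies[OF MM mM]]
    by (simp add: semilinear_free_quotient(3)[OF R])
qed

text \<open>Every finite family in K/I lifts to one in K and conversely, so the syzygy conditions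
  over R/I and over R range over the same families.\<close>

lemma coherent_quotient_module_iff:
  assumes R: "cring R" and K: "ideal K R" and IK: "I \<subseteq> K"
  shows "coherent_module (R Quot I) (quotient_ideal_module R K I) \<longleftrightarrow>
    finite_modulo R (self_module R) I K \<and> coherent_modulo R I K"
proof -
  let ?M = "quotient_ideal_module R K I"
  interpret q: semilinear_map R "R Quot I" "(+>) I" "self_module R" "self_module (R Quot I)" "(+>) I"
    by (rule semilinear_quotient[OF R])
  interpret K: ideal K R by (rule K)
  have carrier_M: "carrier ?M = (+>) I ` K" by (simp add: quotient_ideal_module_def)
  have "{x \<in> carrier R. I +> x = I} = I" using coset_eq_zero_iff a_subset by blast
  moreover have "{x \<in> carrier R. I +> x \<in> (+>) I ` K} = K"
    using coset_mem_image_iff[OF K IK] K.a_subset by blast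
  ultimately have fg: "finitely_generated (R Quot I) ?M \<longleftrightarrow> finite_modulo R (self_module R) I K"
    unfolding quotient_ideal_module_def
    using q.finitely_generated_image_iff[OF carrier_quotient[symmetric] _ submodule_quotient_ideal[OF R K]]
    by (simp add: carrier_quotient zero_quotient)
  have "(\<forall>n. \<forall>m \<in> {..<n} \<rightarrow> carrier ?M.
      finitely_generated (R Quot I) (free_module (R Quot I) n\<lparr>carrier := syzygies (R Quot I) ?M n m\<rparr>))
    \<longleftrightarrow> coherent_modulo R I K" (is "?L \<longleftrightarrow> _")
  proof
    assume L: ?L
    show "coherent_modulo R I K"
      unfolding coherent_modulo_def
    proof (intro allI ballI)
      fix n :: nat and b assume b: "b \<in> {..<n} \<rightarrow> K"
      then have "(\<lambda>i. I +> b i) \<in> {..<n} \<rightarrow> carrier ?M" by (auto simp: carrier_M)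
      then show "finite_modulo R (free_module R n) (vectors_in R I n) (relations R I n b)"
        using L finitely_generated_syzygies_quotient_iff[OF R K IK b, of "\<lambda>i. I +> b i"] by blast
    qed
  next
    assume coh: "coherent_modulo R I K"
    show ?L
    proof (intro allI ballI)
      fix n :: nat and m assume m: "m \<in> {..<n} \<rightarrow> carrier ?M"
      have "\<forall>i. \<exists>x. i < n \<longrightarrow> x \<in> K \<and> m i = I +> x"
        using m by (auto simp: carrier_M Pi_iff)
      then obtain b where b: "\<And>i. i < n \<Longrightarrow> b i \<in> K" "\<And>i. i < n \<Longrightarrow> m i = I +> b i" by metis
      then have "b \<in> {..<n} \<rightarrow> K" by auto
      with coh b(2) show "finitely_generated (R Quot I)
          (free_module (R Quot I) n\<lparr>carrier := syzygies (R Quot I) ?M n m\<rparr>)"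
        using finitely_generated_syzygies_quotient_iff[OF R K IK, of b n m]
        by (simp add: coherent_modulo_def)
    qed
  qed
  with fg show ?thesis
    by (simp add: coherent_module_iff[OF module_quotient_ideal[OF R K]])
qed

text \<open>The case K = R of the module criterion, where finite generation modulo I is witnessed by
  the single generator 1.\<close>

lemma coherent_quotient_ring_iff:
  assumes R: "cring R"
  shows "coherent_ring (R Quot I) \<longleftrightarrow> coherent_modulo R I (carrier R)"
proof -
  have "quotient_ideal_module R (carrier R) I = self_module (R Quot I)"
    by (simp add: quotient_ideal_module_def carrier_quotient[symmetric] module_via_def)
  moreover have "finite_modulo R (self_module R) I (carrier R)"
    unfolding finite_modulo_def
  proof (intro exI conjI)
    have "submodule (module_span R (self_module R) ({\<one>} \<union> I)) R (self_module R)"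
      by (rule submodule_span[OF module_self[OF R]]) (use a_subset in auto)
    note S = module.submoduleE[OF module_self[OF R] this]
    show "carrier R \<subseteq> module_span R (self_module R) ({\<one>} \<union> I)"
    proof
      fix x assume x: "x \<in> carrier R"
      have "\<one> \<in> module_span R (self_module R) ({\<one>} \<union> I)"
        using span_superset[of "{\<one>} \<union> I" R "self_module R"] by auto
      from S(4)[OF x this] show "x \<in> module_span R (self_module R) ({\<one>} \<union> I)" using x by simp
    qed
  qed auto
  ultimately show ?thesis
    using coherent_quotient_module_iff[OF R oneideal a_subset] quotient_is_cring[OF R]
    by (simp add: coherent_ring_def)
qed

end

section \<open>Tensor products on representatives\<close>

lemma keys_diff_subset:
  "\<lbrakk>Poly_Mapping.keys a \<subseteq> A; Poly_Mapping.keys b \<subseteq> A\<rbrakk> \<Longrightarrow> Poly_Mapping.keys (a - b) \<subseteq> A"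
  using keys_diff[of a b] by blast

lemma keys_frag_of_diff:
  "\<lbrakk>p \<in> A; p' \<in> A\<rbrakk> \<Longrightarrow> Poly_Mapping.keys (frag_of p - frag_of p') \<subseteq> A"
  by (intro keys_diff_subset) (simp_all add: keys_frag_of)

lemma keys_frag_of_diff2:
  "\<lbrakk>p \<in> A; p' \<in> A; p'' \<in> A\<rbrakk> \<Longrightarrow> Poly_Mapping.keys (frag_of p - frag_of p' - frag_of p'') \<subseteq> A"
  by (intro keys_diff_subset) (simp_all add: keys_frag_of)

text \<open>Sums and inverses in an abelian group are both obtained from zero and differences, so
  one closure case replaces two. The support is carried along with \<open>P\<close> because maps out
  of the free group are controlled only on formal sums supported on the two carriers.\<close>

lemma tensor_relations_induct [consumes 3, case_names zero diff left right scalar]: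
  fixes L :: "('a, 'b) module" and M :: "('a, 'c) module"
  assumes L: "module R L" and M: "module R M" and c: "c \<in> tensor_relations R L M"
    and zero: "P 0"
    and diff: "\<And>a b. \<lbrakk>Poly_Mapping.keys a \<subseteq> carrier L \<times> carrier M;
      Poly_Mapping.keys b \<subseteq> carrier L \<times> carrier M; P a; P b\<rbrakk> \<Longrightarrow> P (a - b)"
    and left: "\<And>x x' y. \<lbrakk>x \<in> carrier L; x' \<in> carrier L; y \<in> carrier M\<rbrakk> \<Longrightarrow>
      P (frag_of (x \<oplus>\<^bsub>L\<^esub> x', y) - frag_of (x, y) - frag_of (x', y))"
    and right: "\<And>x y y'. \<lbrakk>x \<in> carrier L; y \<in> carrier M; y' \<in> carrier M\<rbrakk> \<Longrightarrow>
      P (frag_of (x, y \<oplus>\<^bsub>M\<^esub> y') - frag_of (x, y) - frag_of (x, y'))"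
    and scalar: "\<And>r x y. \<lbrakk>r \<in> carrier R; x \<in> carrier L; y \<in> carrier M\<rbrakk> \<Longrightarrow>
      P (frag_of (r \<odot>\<^bsub>L\<^esub> x, y) - frag_of (x, r \<odot>\<^bsub>M\<^esub> y))"
  shows "Poly_Mapping.keys c \<subseteq> carrier L \<times> carrier M \<and> P c"
proof -
  interpret L: module R L by fact
  interpret M: module R M by fact
  let ?X = "carrier L \<times> carrier M"
  let ?A = "{frag_of (x \<oplus>\<^bsub>L\<^esub> x', y) - frag_of (x, y) - frag_of (x', y) | x x' y.
         x \<in> carrier L \<and> x' \<in> carrier L \<and> y \<in> carrier M} \<union>
      {frag_of (x, y \<oplus>\<^bsub>M\<^esub> y') - frag_of (x, y) - frag_of (x, y') | x y y'.
         x \<in> carrier L \<and> y \<in> carrier M \<and> y' \<in> carrier M} \<union>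
      {frag_of (r \<odot>\<^bsub>L\<^esub> x, y) - frag_of (x, r \<odot>\<^bsub>M\<^esub> y) | r x y.
         r \<in> carrier R \<and> x \<in> carrier L \<and> y \<in> carrier M}"
  have gen: "Poly_Mapping.keys h \<subseteq> ?X \<and> P h" if "h \<in> ?A" for h
    using that
    by (elim UnE CollectE exE conjE)
      (simp_all add: left right scalar keys_frag_of_diff keys_frag_of_diff2)
  have "c \<in> generate (free_Abelian_group ?X) ?A"
    using c by (simp add: tensor_relations_def)
  then show ?thesis
  proof (induction rule: generate.induct)
    case one
    then show ?case by (simp add: zero)
  next
    case (incl h)
    then show ?case by (rule gen)
  next
    case (inv h)
    then show ?case using gen[OF inv] diff[of 0 h] zero by (simp add: keys_minus)
  next
    case (eng h1 h2)
    then have h1: "Poly_Mapping.keys h1 \<subseteq> ?X" "P h1" and h2: "Poly_Mapping.keys h2 \<subseteq> ?X" "P h2"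
      by simp_all
    have h2': "Poly_Mapping.keys (0 - h2) \<subseteq> ?X" "P (0 - h2)"
      using keys_diff_subset[of 0 ?X h2] diff[of 0 h2] h2 zero by simp_all
    \<comment> \<open>Addition is written as a double difference so that only \<open>diff\<close> is
      used.\<close>
    have "h1 \<otimes>\<^bsub>free_Abelian_group ?X\<^esub> h2 = h1 - (0 - h2)" by simp
    with keys_diff_subset[OF h1(1) h2'(1)] diff[OF h1(1) h2'(1) h1(2) h2'(2)] show ?case
      by (simp only: simp_thms)
  qed
qed

lemma subgroup_tensor_relations:
  fixes L :: "('a, 'b) module" and M :: "('a, 'c) module"
  assumes L: "module R L" and M: "module R M"
  shows "subgroup (tensor_relations R L M) (free_Abelian_group (carrier L \<times> carrier M))"
proof -
  interpret L: module R L by fact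
  interpret M: module R M by fact
  show ?thesis
    unfolding tensor_relations_def
    by (intro group.generate_is_subgroup group_free_Abelian_group subsetI; elim UnE CollectE exE conjE)
      (simp_all add: keys_frag_of_diff keys_frag_of_diff2)
qed

context
  fixes R :: "('a, 'r) ring_scheme" and L :: "('a, 'b) module" and M :: "('a, 'c) module"
  assumes L: "module R L" and M: "module R M"
begin

lemma tensor_relations_keys: "c \<in> tensor_relations R L M \<Longrightarrow> Poly_Mapping.keys c \<subseteq> carrier L \<times> carrier M"
  using tensor_relations_induct[OF L M, of c "\<lambda>_. True"] by simp

lemma tensor_relations_zero: "0 \<in> tensor_relations R L M"
  using subgroup.one_closed[OF subgroup_tensor_relations[OF L M]] by simp

lemma tensor_relations_diff:
  assumes "a \<in> tensor_relations R L M" and "b \<in> tensor_relations R L M"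
  shows "a - b \<in> tensor_relations R L M"
proof -
  note S = subgroup_tensor_relations[OF L M]
  have "- b \<in> tensor_relations R L M"
    using subgroup.m_inv_closed[OF S assms(2)] tensor_relations_keys[OF assms(2)] by simp
  from subgroup.m_closed[OF S assms(1) this] show ?thesis by simp
qed

lemma tensor_relations_add:
  assumes "a \<in> tensor_relations R L M" and "b \<in> tensor_relations R L M"
  shows "a + b \<in> tensor_relations R L M"
  using subgroup.m_closed[OF subgroup_tensor_relations[OF L M] assms] by simp

lemma tensor_relations_left:
  "\<lbrakk>x \<in> carrier L; x' \<in> carrier L; y \<in> carrier M\<rbrakk> \<Longrightarrow>
    frag_of (x \<oplus>\<^bsub>L\<^esub> x', y) - frag_of (x, y) - frag_of (x', y) \<in> tensor_relations R L M"
  unfolding tensor_relations_def by (rule generate.incl) blast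

lemma tensor_relations_right:
  "\<lbrakk>x \<in> carrier L; y \<in> carrier M; y' \<in> carrier M\<rbrakk> \<Longrightarrow>
    frag_of (x, y \<oplus>\<^bsub>M\<^esub> y') - frag_of (x, y) - frag_of (x, y') \<in> tensor_relations R L M"
  unfolding tensor_relations_def by (rule generate.incl) blast

lemma tensor_relations_scalar:
  "\<lbrakk>r \<in> carrier R; x \<in> carrier L; y \<in> carrier M\<rbrakk> \<Longrightarrow>
    frag_of (r \<odot>\<^bsub>L\<^esub> x, y) - frag_of (x, r \<odot>\<^bsub>M\<^esub> y) \<in> tensor_relations R L M"
  unfolding tensor_relations_def by (rule generate.incl) blast

text \<open>Equality of tensors becomes membership of a difference in the relations; from here on,
  tensors are handled through formal sums.\<close>

lemma tensor_coset_eq_iff: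
  assumes c: "Poly_Mapping.keys c \<subseteq> carrier L \<times> carrier M"
    and d: "Poly_Mapping.keys d \<subseteq> carrier L \<times> carrier M"
  shows "tensor_relations R L M #>\<^bsub>free_Abelian_group (carrier L \<times> carrier M)\<^esub> c =
      tensor_relations R L M #>\<^bsub>free_Abelian_group (carrier L \<times> carrier M)\<^esub> d \<longleftrightarrow>
    c - d \<in> tensor_relations R L M"
    (is "?T #>\<^bsub>?G\<^esub> c = _ \<longleftrightarrow> _")
proof
  note S = subgroup_tensor_relations[OF L M]
  assume eq: "?T #>\<^bsub>?G\<^esub> c = ?T #>\<^bsub>?G\<^esub> d"
  have "c \<in> ?T #>\<^bsub>?G\<^esub> c" using group.rcos_self[OF _ _ S] c by simp
  then have "c \<in> ?T #>\<^bsub>?G\<^esub> d" using eq by simp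
  then obtain t where "t \<in> ?T" "c = t + d" by (auto simp: r_coset_def)
  then show "c - d \<in> ?T" by simp
next
  note S = subgroup_tensor_relations[OF L M]
  assume t: "c - d \<in> ?T"
  have "c = (c - d) + d" by simp
  then have "c \<in> ?T #>\<^bsub>?G\<^esub> d" using t unfolding r_coset_def mult_free_Abelian_group by blast
  then show "?T #>\<^bsub>?G\<^esub> c = ?T #>\<^bsub>?G\<^esub> d"
    using group.repr_independence[OF _ _ _ S] d by simp
qed

end

section \<open>The map id \<otimes> g on formal sums, and exactness of tensored sequences\<close>

definition tensor_push :: "('c \<Rightarrow> 'd) \<Rightarrow> ('b \<times> 'c \<Rightarrow>\<^sub>0 int) \<Rightarrow> ('b \<times> 'd \<Rightarrow>\<^sub>0 int)" where
  "tensor_push g = frag_extend (\<lambda>(x, y). frag_of (x, g y))"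

lemma tensor_push_simps [simp]:
  "tensor_push g 0 = 0" "tensor_push g (frag_of (x, y)) = frag_of (x, g y)"
  "tensor_push g (a - b) = tensor_push g a - tensor_push g b"
  by (simp_all add: tensor_push_def frag_extend_diff)

lemma tensor_push_keys:
  assumes "Poly_Mapping.keys c \<subseteq> A \<times> B" and "g \<in> B \<rightarrow> C"
  shows "Poly_Mapping.keys (tensor_push g c) \<subseteq> A \<times> C"
  using assms(1)
proof (induction c rule: frag_induction)
  case (diff a b)
  then show ?case by (simp add: keys_diff_subset)
qed (use assms(2) in \<open>auto simp: keys_frag_of\<close>)

lemma tensor_push_push: "tensor_push g (tensor_push h c) = tensor_push (\<lambda>y. g (h y)) c"
  using subset_UNIV by (induction c rule: frag_induction) auto

lemma tensor_push_ident:
  assumes "Poly_Mapping.keys c \<subseteq> A \<times> B" and "\<And>y. y \<in> B \<Longrightarrow> g y = y"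
  shows "tensor_push g c = c"
  using assms(1) by (induction c rule: frag_induction) (use assms(2) in auto)

lemma tensor_push_relations:
  fixes L :: "('a, 'b) module"
  assumes L: "module R L" and g: "linear_map R M N g" and c: "c \<in> tensor_relations R L M"
  shows "tensor_push g c \<in> tensor_relations R L N"
proof -
  interpret g: semilinear_map R R "\<lambda>r. r" M N g by (rule g)
  note N = g.N.module_axioms
  show ?thesis
    using L g.M.module_axioms c
  proof (induction c rule: tensor_relations_induct[THEN conjunct2, consumes 3, case_names zero diff left right scalar])
    case zero
    then show ?case by (simp add: tensor_relations_zero[OF L N])
  next
    case (diff a b)
    then show ?case by (simp add: tensor_relations_diff[OF L N])
  next
    case (left x x' y)
    then show ?case by (simp add: tensor_relations_left[OF L N] g.map_mem)
  next
    case (right x y y')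
    then show ?case by (simp add: tensor_relations_right[OF L N] g.map_mem g.map_add)
  next
    case (scalar r x y)
    then show ?case by (simp add: tensor_relations_scalar[OF L N] g.map_mem g.map_smult)
  qed
qed

text \<open>Representatives of one class differ by a relation, and \<open>tensor_push g\<close> maps
  relations to relations. So the image set inside \<open>the_elem\<close> is a singleton and the
  value can be read off from any representative.\<close>

lemma tensor_map_coset:
  fixes L :: "('a, 'b) module"
  assumes L: "module R L" and g: "linear_map R M N g"
    and c: "Poly_Mapping.keys c \<subseteq> carrier L \<times> carrier M"
  shows "tensor_map R L N g (tensor_relations R L M #>\<^bsub>free_Abelian_group (carrier L \<times> carrier M)\<^esub> c) =
    tensor_relations R L N #>\<^bsub>free_Abelian_group (carrier L \<times> carrier N)\<^esub> tensor_push g c"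
    (is "tensor_map R L N g (?T #>\<^bsub>?G\<^esub> c) = ?C")
proof -
  interpret g: semilinear_map R R "\<lambda>r. r" M N g by (rule g)
  note M = g.M.module_axioms and N = g.N.module_axioms
  have closed: "g \<in> carrier M \<rightarrow> carrier N" using g.map_closed .
  have "tensor_relations R L N #>\<^bsub>free_Abelian_group (carrier L \<times> carrier N)\<^esub> tensor_push g d = ?C"
    if d: "d \<in> ?T #>\<^bsub>?G\<^esub> c" for d
  proof -
    obtain t where t: "t \<in> ?T" "d = t + c" using d by (auto simp: r_coset_def)
    have "Poly_Mapping.keys t \<subseteq> carrier L \<times> carrier M" using tensor_relations_keys[OF L M t(1)] .
    then have k: "Poly_Mapping.keys d \<subseteq> carrier L \<times> carrier M"
      using c t(2) Poly_Mapping.keys_add[of t c] by blast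
    have "tensor_push g d - tensor_push g c = tensor_push g t"
      by (simp only: tensor_push_simps(3)[symmetric] t(2) add_diff_cancel_right')
    then show ?thesis
      using tensor_coset_eq_iff[OF L N tensor_push_keys[OF k closed] tensor_push_keys[OF c closed]]
        tensor_push_relations[OF L g t(1)] by simp
  qed
  then have "(\<lambda>d. tensor_relations R L N #>\<^bsub>free_Abelian_group (carrier L \<times> carrier N)\<^esub> tensor_push g d)
      ` (?T #>\<^bsub>?G\<^esub> c) = (\<lambda>d. ?C) ` (?T #>\<^bsub>?G\<^esub> c)"
    by (intro image_cong refl)
  also have "\<dots> = {?C}"
    using group.rcos_self[OF _ _ subgroup_tensor_relations[OF L M], of c] c
    by (intro image_constant[of c]) simp
  finally have "(\<lambda>d. tensor_relations R L N #>\<^bsub>free_Abelian_group (carrier L \<times> carrier N)\<^esub> tensor_push g d)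
      ` (?T #>\<^bsub>?G\<^esub> c) = {?C}" .
  then show ?thesis by (simp add: tensor_map_def tensor_push_def)
qed

text \<open>Exactness of \<open>L \<otimes> M1 \<rightarrow> L \<otimes> M2 \<rightarrow> L \<otimes> M3\<close>, expressed by representatives in the free abelian
  groups.\<close>

definition tensor_exact ::
    "('a, 'r) ring_scheme \<Rightarrow> ('a, 'b) module \<Rightarrow> ('a, 'c) module \<Rightarrow> ('a, 'd) module \<Rightarrow> ('a, 'e) module \<Rightarrow>
      ('c \<Rightarrow> 'd) \<Rightarrow> ('d \<Rightarrow> 'e) \<Rightarrow> bool" where
  "tensor_exact R L M1 M2 M3 g h \<longleftrightarrow> (\<forall>c. Poly_Mapping.keys c \<subseteq> carrier L \<times> carrier M2 \<longrightarrow>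
    tensor_push h c \<in> tensor_relations R L M3 \<longleftrightarrow>
    (\<exists>d. Poly_Mapping.keys d \<subseteq> carrier L \<times> carrier M1 \<and> c - tensor_push g d \<in> tensor_relations R L M2))"

lemma tensor_exact_iff:
  fixes L :: "('a, 'b) module" and M1 :: "('a, 'c) module" and M2 :: "('a, 'd) module"
    and M3 :: "('a, 'e) module"
  assumes L: "module R L" and g: "linear_map R M1 M2 g" and h: "linear_map R M2 M3 h"
  shows "tensor_map R L M2 g ` carrier (tensor_product R L M1) =
      kernel (tensor_product R L M2) (tensor_product R L M3) (tensor_map R L M3 h) \<longleftrightarrow>
    tensor_exact R L M1 M2 M3 g h"
proof -
  interpret g: semilinear_map R R "\<lambda>r. r" M1 M2 g by (rule g)
  interpret h: semilinear_map R R "\<lambda>r. r" M2 M3 h by (rule h)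
  note M1 = g.M.module_axioms and M2 = g.N.module_axioms and M3 = h.N.module_axioms
  have gc: "g \<in> carrier M1 \<rightarrow> carrier M2" and hc: "h \<in> carrier M2 \<rightarrow> carrier M3"
    using g.map_closed h.map_closed .
  let ?X1 = "carrier L \<times> carrier M1" and ?X2 = "carrier L \<times> carrier M2" and ?X3 = "carrier L \<times> carrier M3"
  define q where "q = (\<lambda>c. tensor_relations R L M2 #>\<^bsub>free_Abelian_group ?X2\<^esub> c)"
  have q_eq: "q c = q d \<longleftrightarrow> c - d \<in> tensor_relations R L M2"
    if "Poly_Mapping.keys c \<subseteq> ?X2" "Poly_Mapping.keys d \<subseteq> ?X2" for c d
    unfolding q_def by (rule tensor_coset_eq_iff[OF L M2 that])
  have im: "tensor_map R L M2 g ` carrier (tensor_product R L M1) =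
      (\<lambda>d. q (tensor_push g d)) ` {d. Poly_Mapping.keys d \<subseteq> ?X1}"
    unfolding tensor_product_def carrier_FactGroup image_image q_def
    by (rule image_cong) (auto simp: tensor_map_coset[OF L g])
  have zero: "tensor_relations R L M3 = tensor_relations R L M3 #>\<^bsub>free_Abelian_group ?X3\<^esub> 0"
    using group.coset_join2[OF _ _ subgroup_tensor_relations[OF L M3] tensor_relations_zero[OF L M3]]
    by simp
  have "tensor_map R L M3 h (q c) = tensor_relations R L M3 \<longleftrightarrow> tensor_push h c \<in> tensor_relations R L M3"
    if c: "Poly_Mapping.keys c \<subseteq> ?X2" for c
    using tensor_coset_eq_iff[OF L M3 tensor_push_keys[OF c hc], of 0]
    unfolding q_def tensor_map_coset[OF L h c] by (simp add: zero[symmetric])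
  then have ker: "kernel (tensor_product R L M2) (tensor_product R L M3) (tensor_map R L M3 h) =
      q ` {c. Poly_Mapping.keys c \<subseteq> ?X2 \<and> tensor_push h c \<in> tensor_relations R L M3}"
    unfolding tensor_product_def kernel_def carrier_FactGroup one_FactGroup q_def[symmetric]
    by auto
  show ?thesis
    unfolding im ker tensor_exact_def
  proof (intro iffI allI impI)
    fix c :: "'b \<times> 'd \<Rightarrow>\<^sub>0 int"
    assume eq: "(\<lambda>d. q (tensor_push g d)) ` {d. Poly_Mapping.keys d \<subseteq> ?X1} =
        q ` {c. Poly_Mapping.keys c \<subseteq> ?X2 \<and> tensor_push h c \<in> tensor_relations R L M3}"
      and c: "Poly_Mapping.keys c \<subseteq> ?X2"
    assume "tensor_push h c \<in> tensor_relations R L M3"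
    then have "q c \<in> (\<lambda>d. q (tensor_push g d)) ` {d. Poly_Mapping.keys d \<subseteq> ?X1}"
      unfolding eq using c by simp
    then obtain d where d: "Poly_Mapping.keys d \<subseteq> ?X1" "q c = q (tensor_push g d)" by auto
    then show "\<exists>d. Poly_Mapping.keys d \<subseteq> ?X1 \<and> c - tensor_push g d \<in> tensor_relations R L M2"
      using q_eq[OF c tensor_push_keys[OF d(1) gc]] by blast
  next
    fix c :: "'b \<times> 'd \<Rightarrow>\<^sub>0 int"
    assume eq: "(\<lambda>d. q (tensor_push g d)) ` {d. Poly_Mapping.keys d \<subseteq> ?X1} =
        q ` {c. Poly_Mapping.keys c \<subseteq> ?X2 \<and> tensor_push h c \<in> tensor_relations R L M3}"
      and c: "Poly_Mapping.keys c \<subseteq> ?X2"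
    assume "\<exists>d. Poly_Mapping.keys d \<subseteq> ?X1 \<and> c - tensor_push g d \<in> tensor_relations R L M2"
    then obtain d where d: "Poly_Mapping.keys d \<subseteq> ?X1" "c - tensor_push g d \<in> tensor_relations R L M2"
      by blast
    then have "q (tensor_push g d) \<in> q ` {c. Poly_Mapping.keys c \<subseteq> ?X2 \<and> tensor_push h c \<in> tensor_relations R L M3}"
      unfolding eq[symmetric] by blast
    \<comment> \<open>Equality of the two sets of classes yields only some other representative c'
      killed by h; c - c' is a relation, and pushing it along h transfers the vanishing to
      c.\<close>
    then obtain c' where c': "Poly_Mapping.keys c' \<subseteq> ?X2" "tensor_push h c' \<in> tensor_relations R L M3"
        "q (tensor_push g d) = q c'" by auto
    have "q c = q c'" using q_eq[OF c tensor_push_keys[OF d(1) gc]] d(2) c'(3) by simp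
    then have "c - c' \<in> tensor_relations R L M2" using q_eq[OF c c'(1)] by simp
    from tensor_relations_add[OF L M3 tensor_push_relations[OF L h this] c'(2)]
    show "tensor_push h c \<in> tensor_relations R L M3" by simp
  next
    assume ex: "\<forall>c. Poly_Mapping.keys c \<subseteq> ?X2 \<longrightarrow>
        tensor_push h c \<in> tensor_relations R L M3 \<longleftrightarrow>
        (\<exists>d. Poly_Mapping.keys d \<subseteq> ?X1 \<and> c - tensor_push g d \<in> tensor_relations R L M2)"
    show "(\<lambda>d. q (tensor_push g d)) ` {d. Poly_Mapping.keys d \<subseteq> ?X1} =
        q ` {c. Poly_Mapping.keys c \<subseteq> ?X2 \<and> tensor_push h c \<in> tensor_relations R L M3}"
    proof (intro equalityI subsetI)
      fix z assume "z \<in> (\<lambda>d. q (tensor_push g d)) ` {d. Poly_Mapping.keys d \<subseteq> ?X1}"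
      then obtain d where d: "Poly_Mapping.keys d \<subseteq> ?X1" "z = q (tensor_push g d)" by auto
      note k = tensor_push_keys[OF d(1) gc]
      have "tensor_push g d - tensor_push g d \<in> tensor_relations R L M2"
        by (simp add: tensor_relations_zero[OF L M2])
      then have "tensor_push h (tensor_push g d) \<in> tensor_relations R L M3"
        using ex k d(1) by blast
      then show "z \<in> q ` {c. Poly_Mapping.keys c \<subseteq> ?X2 \<and> tensor_push h c \<in> tensor_relations R L M3}"
        using d(2) k by blast
    next
      fix z assume "z \<in> q ` {c. Poly_Mapping.keys c \<subseteq> ?X2 \<and> tensor_push h c \<in> tensor_relations R L M3}"
      then obtain c where c: "z = q c" "Poly_Mapping.keys c \<subseteq> ?X2" "tensor_push h c \<in> tensor_relations R L M3"
        by auto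
      then obtain d where d: "Poly_Mapping.keys d \<subseteq> ?X1" "c - tensor_push g d \<in> tensor_relations R L M2"
        using ex by blast
      then have "z = q (tensor_push g d)" using c q_eq[OF c(2) tensor_push_keys[OF d(1) gc]] by simp
      then show "z \<in> (\<lambda>d. q (tensor_push g d)) ` {d. Poly_Mapping.keys d \<subseteq> ?X1}" using d(1) by blast
    qed
  qed
qed

section \<open>Applying the exactness test to modules of sequences\<close>

text \<open>Faithful flatness is tested on modules whose elements are sets of sequences. Replacing elements
  by singletons makes submodules of free modules, whose elements are sequences, available as test
  modules.\<close>

definition singleton_module :: "('a, 'b) module \<Rightarrow> ('a, 'b set) module" where
  "singleton_module M =
    \<lparr>carrier = (\<lambda>x. {x}) ` carrier M, monoid.mult = undefined, monoid.one = undefined,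
     ring.zero = {\<zero>\<^bsub>M\<^esub>}, ring.add = (\<lambda>U V. {the_elem U \<oplus>\<^bsub>M\<^esub> the_elem V}),
     module.smult = (\<lambda>r U. {r \<odot>\<^bsub>M\<^esub> the_elem U})\<rparr>"

lemma singleton_module_simps [simp]:
  "carrier (singleton_module M) = (\<lambda>x. {x}) ` carrier M"
  "\<zero>\<^bsub>singleton_module M\<^esub> = {\<zero>\<^bsub>M\<^esub>}"
  "U \<oplus>\<^bsub>singleton_module M\<^esub> V = {the_elem U \<oplus>\<^bsub>M\<^esub> the_elem V}"
  "r \<odot>\<^bsub>singleton_module M\<^esub> U = {r \<odot>\<^bsub>M\<^esub> the_elem U}"
  by (simp_all add: singleton_module_def)

lemma module_singleton:
  fixes M :: "('a, 'b) module"
  assumes "module R M"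
  shows "module R (singleton_module M)"
proof -
  interpret module R M by fact
  show ?thesis
    by (intro moduleI abelian_groupI)
      (auto simp: M.a_ac smult_l_distr smult_r_distr smult_assoc1 intro: M.l_neg M.a_inv_closed R.is_cring)
qed

lemma linear_map_singleton:
  fixes M :: "('a, 'b) module"
  assumes "module R M"
  shows "linear_map R M (singleton_module M) (\<lambda>x. {x})"
    and "linear_map R (singleton_module M) M the_elem"
  using assms module_singleton[OF assms] by (auto simp: linear_map_iff linear_maps_def)

text \<open>The map x -> {x} is an isomorphism of each module onto its singleton copy, with inverse
  \<open>the_elem\<close>. Exactness before and after tensoring is carried to the copies, where the
  definition of faithful flatness applies.\<close>

lemma faithfully_flat_exact_iff:
  fixes L :: "('a, 'c) module" and M1 M2 M3 :: "('a, 'b) module"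
  assumes ff: "faithfully_flat TYPE('b set) R L"
    and g: "linear_map R M1 M2 g" and h: "linear_map R M2 M3 h"
  shows "g ` carrier M1 = {x \<in> carrier M2. h x = \<zero>\<^bsub>M3\<^esub>} \<longleftrightarrow> tensor_exact R L M1 M2 M3 g h"
proof -
  have L: "module R L" using ff by (simp add: faithfully_flat_def)
  interpret g: semilinear_map R R "\<lambda>r. r" M1 M2 g by (rule g)
  interpret h: semilinear_map R R "\<lambda>r. r" M2 M3 h by (rule h)
  note M1 = g.M.module_axioms and M2 = g.N.module_axioms and M3 = h.N.module_axioms
  let ?s = "\<lambda>x. {x}"
  let ?g = "\<lambda>U. {g (the_elem U)}" and ?h = "\<lambda>U. {h (the_elem U)}"
  let ?N1 = "singleton_module M1" and ?N2 = "singleton_module M2" and ?N3 = "singleton_module M3"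
  have g': "linear_map R ?N1 ?N2 ?g"
    using semilinear_compose[OF semilinear_compose[OF linear_map_singleton(2)[OF M1] g] linear_map_singleton(1)[OF M2]]
    by (simp add: comp_def)
  have h': "linear_map R ?N2 ?N3 ?h"
    using semilinear_compose[OF semilinear_compose[OF linear_map_singleton(2)[OF M2] h] linear_map_singleton(1)[OF M3]]
    by (simp add: comp_def)
  \<comment> \<open>Both directions are functoriality: push along x -> {x}, and return along
    \<open>the_elem\<close>.\<close>
  have up: "tensor_push ?s c \<in> tensor_relations R L (singleton_module M) \<longleftrightarrow> c \<in> tensor_relations R L M"
    if "module R M" for M :: "('a, 'b) module" and c :: "'c \<times> _ \<Rightarrow>\<^sub>0 int"
  proof
    assume "tensor_push ?s c \<in> tensor_relations R L (singleton_module M)"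
    from tensor_push_relations[OF L linear_map_singleton(2)[OF that] this]
    show "c \<in> tensor_relations R L M"
      by (simp add: tensor_push_push tensor_push_ident[of c UNIV UNIV])
  qed (rule tensor_push_relations[OF L linear_map_singleton(1)[OF that]])
  have push_keys: "Poly_Mapping.keys (tensor_push ?s c) \<subseteq> carrier L \<times> carrier (singleton_module M)"
    if "Poly_Mapping.keys c \<subseteq> carrier L \<times> carrier M" for M :: "('a, 'b) module" and c :: "'c \<times> _ \<Rightarrow>\<^sub>0 int"
    by (rule tensor_push_keys[OF that]) auto
  have pull_keys: "Poly_Mapping.keys (tensor_push the_elem c) \<subseteq> carrier L \<times> carrier M"
    "tensor_push ?s (tensor_push the_elem c) = c"
    if c: "Poly_Mapping.keys c \<subseteq> carrier L \<times> carrier (singleton_module M)" for M :: "('a, 'b) module" and c :: "'c \<times> _ \<Rightarrow>\<^sub>0 int"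
  proof -
    show "Poly_Mapping.keys (tensor_push the_elem c) \<subseteq> carrier L \<times> carrier M"
      by (rule tensor_push_keys[OF c]) auto
    show "tensor_push ?s (tensor_push the_elem c) = c"
      unfolding tensor_push_push by (rule tensor_push_ident[OF c]) auto
  qed
  have push_g: "tensor_push ?g (tensor_push ?s d) = tensor_push ?s (tensor_push g d)" for d :: "'c \<times> 'b \<Rightarrow>\<^sub>0 int"
    by (simp add: tensor_push_push)
  have push_h: "tensor_push ?h (tensor_push ?s d) = tensor_push ?s (tensor_push h d)" for d :: "'c \<times> 'b \<Rightarrow>\<^sub>0 int"
    by (simp add: tensor_push_push)
  have "g ` carrier M1 = {x \<in> carrier M2. h x = \<zero>\<^bsub>M3\<^esub>} \<longleftrightarrow>
      ?s ` g ` carrier M1 = ?s ` {x \<in> carrier M2. h x = \<zero>\<^bsub>M3\<^esub>}"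
    by (intro inj_image_eq_iff[symmetric]) simp
  also have "?s ` g ` carrier M1 = ?g ` carrier ?N1" by (simp add: image_image)
  also have "?s ` {x \<in> carrier M2. h x = \<zero>\<^bsub>M3\<^esub>} = kernel (add_monoid ?N2) (add_monoid ?N3) ?h"
    by (auto simp: kernel_def)
  also have "?g ` carrier ?N1 = kernel (add_monoid ?N2) (add_monoid ?N3) ?h \<longleftrightarrow>
      tensor_exact R L ?N1 ?N2 ?N3 ?g ?h"
    unfolding tensor_exact_iff[OF L g' h', symmetric]
    using ff g' h' by (simp only: faithfully_flat_def linear_map_iff)
  also have "\<dots> \<longleftrightarrow> tensor_exact R L M1 M2 M3 g h"
  proof
    assume ex: "tensor_exact R L ?N1 ?N2 ?N3 ?g ?h"
    show "tensor_exact R L M1 M2 M3 g h"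
      unfolding tensor_exact_def
    proof (intro allI impI)
      fix c :: "'c \<times> 'b \<Rightarrow>\<^sub>0 int"
      assume c: "Poly_Mapping.keys c \<subseteq> carrier L \<times> carrier M2"
      have "tensor_push h c \<in> tensor_relations R L M3 \<longleftrightarrow>
          tensor_push ?h (tensor_push ?s c) \<in> tensor_relations R L ?N3"
        unfolding push_h by (rule up[OF M3, symmetric])
      also have "\<dots> \<longleftrightarrow> (\<exists>d. Poly_Mapping.keys d \<subseteq> carrier L \<times> carrier ?N1 \<and>
          tensor_push ?s c - tensor_push ?g d \<in> tensor_relations R L ?N2)"
        using ex push_keys[OF c] unfolding tensor_exact_def by blast
      also have "\<dots> \<longleftrightarrow> (\<exists>d. Poly_Mapping.keys d \<subseteq> carrier L \<times> carrier M1 \<and>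
          tensor_push ?s c - tensor_push ?g (tensor_push ?s d) \<in> tensor_relations R L ?N2)"
        using push_keys[of _ M1] pull_keys[of _ M1] by metis
      also have "\<dots> \<longleftrightarrow> (\<exists>d. Poly_Mapping.keys d \<subseteq> carrier L \<times> carrier M1 \<and>
          c - tensor_push g d \<in> tensor_relations R L M2)"
        unfolding push_g tensor_push_simps(3)[symmetric] up[OF M2] ..
      finally show "tensor_push h c \<in> tensor_relations R L M3 \<longleftrightarrow>
          (\<exists>d. Poly_Mapping.keys d \<subseteq> carrier L \<times> carrier M1 \<and>
          c - tensor_push g d \<in> tensor_relations R L M2)" .
    qed
  next
    assume ex: "tensor_exact R L M1 M2 M3 g h"
    show "tensor_exact R L ?N1 ?N2 ?N3 ?g ?h"
      unfolding tensor_exact_def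
    proof (intro allI impI)
      fix c' :: "'c \<times> 'b set \<Rightarrow>\<^sub>0 int"
      assume c': "Poly_Mapping.keys c' \<subseteq> carrier L \<times> carrier ?N2"
      define c where "c = tensor_push the_elem c'"
      have c: "Poly_Mapping.keys c \<subseteq> carrier L \<times> carrier M2" "c' = tensor_push ?s c"
        using pull_keys[OF c'] by (simp_all add: c_def)
      have "tensor_push ?h c' \<in> tensor_relations R L ?N3 \<longleftrightarrow> tensor_push h c \<in> tensor_relations R L M3"
        unfolding c(2) push_h by (rule up[OF M3])
      also have "\<dots> \<longleftrightarrow> (\<exists>d. Poly_Mapping.keys d \<subseteq> carrier L \<times> carrier M1 \<and>
          c - tensor_push g d \<in> tensor_relations R L M2)"
        using ex c(1) unfolding tensor_exact_def by blast
      also have "\<dots> \<longleftrightarrow> (\<exists>d. Poly_Mapping.keys d \<subseteq> carrier L \<times> carrier M1 \<and>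
          c' - tensor_push ?g (tensor_push ?s d) \<in> tensor_relations R L ?N2)"
        unfolding push_g c(2) tensor_push_simps(3)[symmetric] up[OF M2] ..
      also have "\<dots> \<longleftrightarrow> (\<exists>d. Poly_Mapping.keys d \<subseteq> carrier L \<times> carrier ?N1 \<and>
          c' - tensor_push ?g d \<in> tensor_relations R L ?N2)"
        using push_keys[of _ M1] pull_keys[of _ M1] by metis
      finally show "tensor_push ?h c' \<in> tensor_relations R L ?N3 \<longleftrightarrow>
          (\<exists>d. Poly_Mapping.keys d \<subseteq> carrier L \<times> carrier ?N1 \<and>
          c' - tensor_push ?g d \<in> tensor_relations R L ?N2)" .
    qed
  qed
  finally show ?thesis .
qed

section \<open>Extension of scalars for submodules of free modules\<close>

context ring_hom_cring
begin

abbreviation target_module :: "('a, 'c) module" where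
  "target_module \<equiv> module_via h S"

lemma module_target: "module R target_module"
  by (intro moduleI abelian_groupI)
    (auto simp: module_via_def R.is_cring S.a_ac S.m_assoc S.l_distr S.r_distr
      intro: S.l_neg S.a_inv_closed)

definition base_change :: "(nat \<Rightarrow> 'a) \<Rightarrow> (nat \<Rightarrow> 'c)" where
  "base_change x = (\<lambda>i. h (x i))"

lemma semilinear_base_change:
  "semilinear_map R S h (free_module R n) (free_module S n) base_change"
proof -
  interpret M: module R "free_module R n" by (rule module_free_module[OF R.is_cring])
  interpret N: module S "free_module S n" by (rule module_free_module[OF S.is_cring])
  note comp = free_module_component[OF R.is_cring]
  show ?thesis
    by unfold_locales
      (use comp in \<open>auto simp: base_change_def carrier_free_module add_free_module smult_free_module\<close>)
qed

lemma base_change_unit_vector: "base_change (unit_vector R i) = unit_vector S i"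
  by (auto simp: base_change_def unit_vector_def)

text \<open>On representatives, this is the isomorphism from S \<otimes> R^n to S^n that sends s
  \<otimes> x to s times the image of x. It is selected through the universal property of the free
  abelian group; its values are pinned down on formal sums supported on the two carriers.\<close>

definition tensor_eval :: "nat \<Rightarrow> ('c \<times> (nat \<Rightarrow> 'a) \<Rightarrow>\<^sub>0 int) \<Rightarrow> (nat \<Rightarrow> 'c)" where
  "tensor_eval n = (SOME ev.
    ev \<in> hom (free_Abelian_group (carrier S \<times> carrier (free_module R n))) (add_monoid (free_module S n)) \<and>
    (\<forall>s \<in> carrier S. \<forall>x \<in> carrier (free_module R n).
      ev (frag_of (s, x)) = s \<odot>\<^bsub>free_module S n\<^esub> base_change x))"

text \<open>For a submodule U of R^n this is the image of S \<otimes> U in S^n.\<close>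

definition extension :: "nat \<Rightarrow> (nat \<Rightarrow> 'a) set \<Rightarrow> (nat \<Rightarrow> 'c) set" where
  "extension n U = module_span S (free_module S n) (base_change ` U)"

context
  fixes n :: nat
begin

interpretation F: module R "free_module R n" by (rule module_free_module[OF R.is_cring])
interpretation G: module S "free_module S n" by (rule module_free_module[OF S.is_cring])
interpretation b: semilinear_map R S h "free_module R n" "free_module S n" base_change
  by (rule semilinear_base_change)

abbreviation (input) chains :: "(nat \<Rightarrow> 'a) set \<Rightarrow> ('c \<times> (nat \<Rightarrow> 'a) \<Rightarrow>\<^sub>0 int) set" where
  "chains U \<equiv> {c. Poly_Mapping.keys c \<subseteq> carrier S \<times> U}"

abbreviation (input) "rels \<equiv> tensor_relations R target_module (free_module R n)"

lemma tensor_eval_spec: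
  "tensor_eval n \<in> hom (free_Abelian_group (carrier S \<times> carrier (free_module R n))) (add_monoid (free_module S n)) \<and>
    (\<forall>s \<in> carrier S. \<forall>x \<in> carrier (free_module R n).
      tensor_eval n (frag_of (s, x)) = s \<odot>\<^bsub>free_module S n\<^esub> base_change x)"
proof -
  have "(\<lambda>(s, x). s \<odot>\<^bsub>free_module S n\<^esub> base_change x) ` (carrier S \<times> carrier (free_module R n))
      \<subseteq> carrier (add_monoid (free_module S n))"
    using b.map_mem by auto
  from comm_group.free_Abelian_group_universal[OF G.a_comm_group this]
  obtain ev where "ev \<in> hom (free_Abelian_group (carrier S \<times> carrier (free_module R n))) (add_monoid (free_module S n))"
    and "\<And>p. p \<in> carrier S \<times> carrier (free_module R n) \<Longrightarrow>
      ev (frag_of p) = (\<lambda>(s, x). s \<odot>\<^bsub>free_module S n\<^esub> base_change x) p" by blast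
  then have "\<exists>ev. ev \<in> hom (free_Abelian_group (carrier S \<times> carrier (free_module R n))) (add_monoid (free_module S n)) \<and>
    (\<forall>s \<in> carrier S. \<forall>x \<in> carrier (free_module R n).
      ev (frag_of (s, x)) = s \<odot>\<^bsub>free_module S n\<^esub> base_change x)"
    by (intro exI[of _ ev]) auto
  then show ?thesis unfolding tensor_eval_def by (rule someI_ex)
qed

lemma tensor_eval_of:
  "\<lbrakk>s \<in> carrier S; x \<in> carrier (free_module R n)\<rbrakk> \<Longrightarrow>
    tensor_eval n (frag_of (s, x)) = s \<odot>\<^bsub>free_module S n\<^esub> base_change x"
  using tensor_eval_spec by blast

lemma tensor_eval_closed:
  "c \<in> chains (carrier (free_module R n)) \<Longrightarrow> tensor_eval n c \<in> carrier (free_module S n)"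
  using tensor_eval_spec hom_in_carrier by fastforce

lemma tensor_eval_add:
  "\<lbrakk>c \<in> chains (carrier (free_module R n)); d \<in> chains (carrier (free_module R n))\<rbrakk> \<Longrightarrow>
    tensor_eval n (c + d) = tensor_eval n c \<oplus>\<^bsub>free_module S n\<^esub> tensor_eval n d"
  using tensor_eval_spec Group.hom_mult[of "tensor_eval n" "free_Abelian_group (carrier S \<times> carrier (free_module R n))"
      "add_monoid (free_module S n)" c d] by simp

lemma tensor_eval_zero: "tensor_eval n 0 = \<zero>\<^bsub>free_module S n\<^esub>"
  using Group.hom_one[OF conjunct1[OF tensor_eval_spec]] G.a_group by simp

lemma tensor_eval_diff:
  assumes c: "c \<in> chains (carrier (free_module R n))" and d: "d \<in> chains (carrier (free_module R n))"
  shows "tensor_eval n (c - d) = tensor_eval n c \<ominus>\<^bsub>free_module S n\<^esub> tensor_eval n d"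
proof -
  have cd: "c - d \<in> chains (carrier (free_module R n))"
    using c d by (simp add: keys_diff_subset)
  have "tensor_eval n c = tensor_eval n (c - d) \<oplus>\<^bsub>free_module S n\<^esub> tensor_eval n d"
    using tensor_eval_add[OF cd d] by simp
  then show ?thesis
    using tensor_eval_closed[OF cd] tensor_eval_closed[OF d]
    by (simp add: a_minus_def G.M.a_assoc G.M.r_neg)
qed

lemma tensor_eval_relations:
  assumes "c \<in> rels"
  shows "tensor_eval n c = \<zero>\<^bsub>free_module S n\<^esub>"
  using module_target F.module_axioms assms
proof (induction c rule: tensor_relations_induct[THEN conjunct2, consumes 3, case_names zero diff left right scalar])
  case zero
  then show ?case by (rule tensor_eval_zero)
next
  case (diff a b)
  have z: "\<zero>\<^bsub>free_module S n\<^esub> \<ominus>\<^bsub>free_module S n\<^esub> \<zero>\<^bsub>free_module S n\<^esub> = \<zero>\<^bsub>free_module S n\<^esub>"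
    using G.M.r_neg[OF G.M.zero_closed] by (simp add: a_minus_def)
  have "a \<in> chains (carrier (free_module R n))" "b \<in> chains (carrier (free_module R n))"
    using diff by (simp_all add: module_via_def)
  then show ?case using diff z by (simp add: tensor_eval_diff)
next
  case (left s s' x)
  then have s: "s \<in> carrier S" "s' \<in> carrier S" by (simp_all add: module_via_def)
  note bx = b.map_mem[OF left(3)]
  have "tensor_eval n (frag_of (s \<oplus>\<^bsub>target_module\<^esub> s', x) - frag_of (s, x) - frag_of (s', x)) =
      (s \<oplus>\<^bsub>S\<^esub> s') \<odot>\<^bsub>free_module S n\<^esub> base_change x \<ominus>\<^bsub>free_module S n\<^esub> s \<odot>\<^bsub>free_module S n\<^esub> base_change x
        \<ominus>\<^bsub>free_module S n\<^esub> s' \<odot>\<^bsub>free_module S n\<^esub> base_change x"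
    using left(3) s by (simp add: tensor_eval_diff tensor_eval_of keys_frag_of keys_frag_of_diff module_via_def)
  also have "\<dots> = \<zero>\<^bsub>free_module S n\<^esub>"
    using s bx G.smult_closed[OF s(1) bx] G.smult_closed[OF s(2) bx]
    by (simp add: G.smult_l_distr a_minus_def G.M.a_ac G.M.r_neg G.M.r_neg1 G.M.r_neg2)
  finally show ?case .
next
  case (right s x x')
  then have s: "s \<in> carrier S" by (simp add: module_via_def)
  note bx = b.map_mem[OF right(2)] and bx' = b.map_mem[OF right(3)]
  have "tensor_eval n (frag_of (s, x \<oplus>\<^bsub>free_module R n\<^esub> x') - frag_of (s, x) - frag_of (s, x')) =
      s \<odot>\<^bsub>free_module S n\<^esub> base_change (x \<oplus>\<^bsub>free_module R n\<^esub> x')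
        \<ominus>\<^bsub>free_module S n\<^esub> s \<odot>\<^bsub>free_module S n\<^esub> base_change x
        \<ominus>\<^bsub>free_module S n\<^esub> s \<odot>\<^bsub>free_module S n\<^esub> base_change x'"
    using right(2,3) s by (simp add: tensor_eval_diff tensor_eval_of keys_frag_of keys_frag_of_diff)
  also have "\<dots> = \<zero>\<^bsub>free_module S n\<^esub>"
    using s right(2,3) bx bx' G.smult_closed[OF s bx] G.smult_closed[OF s bx']
    by (simp add: b.map_add G.smult_r_distr a_minus_def G.M.a_ac G.M.r_neg G.M.r_neg1 G.M.r_neg2)
  finally show ?case .
next
  case (scalar r s x)
  then have s: "s \<in> carrier S" by (simp add: module_via_def)
  note bx = b.map_mem[OF scalar(3)]
  have "tensor_eval n (frag_of (r \<odot>\<^bsub>target_module\<^esub> s, x) - frag_of (s, r \<odot>\<^bsub>free_module R n\<^esub> x)) =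
      (h r \<otimes>\<^bsub>S\<^esub> s) \<odot>\<^bsub>free_module S n\<^esub> base_change x
        \<ominus>\<^bsub>free_module S n\<^esub> s \<odot>\<^bsub>free_module S n\<^esub> (h r \<odot>\<^bsub>free_module S n\<^esub> base_change x)"
    using scalar(1,3) s by (simp add: tensor_eval_diff tensor_eval_of keys_frag_of module_via_def b.map_smult)
  also have "(h r \<otimes>\<^bsub>S\<^esub> s) \<odot>\<^bsub>free_module S n\<^esub> base_change x =
      s \<odot>\<^bsub>free_module S n\<^esub> (h r \<odot>\<^bsub>free_module S n\<^esub> base_change x)"
    using s scalar(1) bx by (simp add: S.m_comm[of "h r" s] G.smult_assoc1)
  finally show ?case
    using s scalar(1) bx by (simp add: a_minus_def G.M.r_neg)
qed

lemma tensor_relations_sum: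
  "(\<And>i. i \<in> A \<Longrightarrow> t i \<in> rels) \<Longrightarrow> sum t A \<in> rels"
  by (induction A rule: infinite_finite_induct)
    (auto simp: tensor_relations_zero[OF module_target F.module_axioms]
      intro: tensor_relations_add[OF module_target F.module_axioms])

text \<open>Additivity for 0 + 0 = 0 gives the relation a - a - a, which is -a for the generator a
  at (0, x).\<close>

lemma tensor_relations_frag_zero:
  assumes "x \<in> carrier (free_module R n)"
  shows "frag_of (\<zero>\<^bsub>S\<^esub>, x) \<in> rels"
proof -
  note T = module_target F.module_axioms
  have "frag_of (\<zero>\<^bsub>S\<^esub>, x) - frag_of (\<zero>\<^bsub>S\<^esub>, x) - frag_of (\<zero>\<^bsub>S\<^esub>, x) \<in> rels"
    using tensor_relations_left[OF T, of "\<zero>\<^bsub>S\<^esub>" "\<zero>\<^bsub>S\<^esub>" x] assms by (simp add: module_via_def)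
  from tensor_relations_diff[OF T tensor_relations_zero[OF T] this] show ?thesis by simp
qed

text \<open>Injectivity of S \<otimes> R^n -> S^n. The candidate inverse \<open>\<sigma>\<close>
  sends y to the formal sum of the y_i \<otimes> e_i; every formal sum c is congruent to
  \<open>\<sigma> (tensor_eval n c)\<close> modulo the relations, and \<open>\<sigma>\<close> of
  zero is itself a relation.\<close>

lemma tensor_eval_eq_zero:
  assumes c: "c \<in> chains (carrier (free_module R n))" and zero: "tensor_eval n c = \<zero>\<^bsub>free_module S n\<^esub>"
  shows "c \<in> rels"
proof -
  note T = module_target F.module_axioms
  note rdiff = tensor_relations_diff[OF T] and radd = tensor_relations_add[OF T]
    and rzero = tensor_relations_zero[OF T]
  let ?F = "free_module R n" and ?G = "free_module S n"
  define \<sigma> where "\<sigma> y = (\<Sum>i<n. frag_of (y i :: 'c, unit_vector R i))" for y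
  have e: "unit_vector R i \<in> carrier ?F" if "i < n" for i using unit_vector_closed[OF R.is_cring that] .
  have \<sigma>_zero: "\<sigma> \<zero>\<^bsub>?G\<^esub> \<in> rels"
    unfolding \<sigma>_def zero_free_module using e by (intro tensor_relations_sum tensor_relations_frag_zero) simp
  have \<sigma>_add: "\<sigma> (u \<oplus>\<^bsub>?G\<^esub> v) - \<sigma> u - \<sigma> v \<in> rels" if u: "u \<in> carrier ?G" and v: "v \<in> carrier ?G" for u v
  proof -
    have "frag_of (u i \<oplus>\<^bsub>S\<^esub> v i, unit_vector R i) - frag_of (u i, unit_vector R i)
        - frag_of (v i, unit_vector R i) \<in> rels" if "i < n" for i
      using tensor_relations_left[OF T, of "u i" "v i"] e[OF that]
        free_module_component[OF S.is_cring u] free_module_component[OF S.is_cring v]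
      by (simp add: module_via_def)
    then show ?thesis
      unfolding \<sigma>_def add_free_module sum_subtractf[symmetric] by (intro tensor_relations_sum) simp
  qed
  \<comment> \<open>The quantifier over s is essential for closure under scalars: r moves across the
    tensor sign, turning the claim for s and r x into the claim for h(r) s and x.\<close>
  let ?H = "{x \<in> carrier ?F. \<forall>s \<in> carrier S. frag_of (s, x) - \<sigma> (s \<odot>\<^bsub>?G\<^esub> base_change x) \<in> rels}"
  have H_smult: "r \<odot>\<^bsub>?F\<^esub> x \<in> ?H" if r: "r \<in> carrier R" and x: "x \<in> ?H" for r x
  proof -
    have xF: "x \<in> carrier ?F" using x by simp
    have "frag_of (s, r \<odot>\<^bsub>?F\<^esub> x) - \<sigma> (s \<odot>\<^bsub>?G\<^esub> base_change (r \<odot>\<^bsub>?F\<^esub> x)) \<in> rels" if s: "s \<in> carrier S" for s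
    proof -
      have "(h r \<otimes>\<^bsub>S\<^esub> s) \<odot>\<^bsub>?G\<^esub> base_change x = s \<odot>\<^bsub>?G\<^esub> base_change (r \<odot>\<^bsub>?F\<^esub> x)"
        using s r xF b.map_mem[OF xF] by (simp add: b.map_smult S.m_comm[of "h r" s] G.smult_assoc1)
      moreover have "frag_of (h r \<otimes>\<^bsub>S\<^esub> s, x) - \<sigma> ((h r \<otimes>\<^bsub>S\<^esub> s) \<odot>\<^bsub>?G\<^esub> base_change x) \<in> rels"
        using x r s by simp
      moreover have "frag_of (h r \<otimes>\<^bsub>S\<^esub> s, x) - frag_of (s, r \<odot>\<^bsub>?F\<^esub> x) \<in> rels"
        using tensor_relations_scalar[OF T r, of s x] s xF by (simp add: module_via_def)
      ultimately show ?thesis using rdiff by fastforce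
    qed
    then show ?thesis using r xF by simp
  qed
  have H_add: "x \<oplus>\<^bsub>?F\<^esub> y \<in> ?H" if x: "x \<in> ?H" and y: "y \<in> ?H" for x y
  proof -
    have xF: "x \<in> carrier ?F" and yF: "y \<in> carrier ?F" using x y by simp_all
    note bx = b.map_mem[OF xF] and by' = b.map_mem[OF yF]
    have "frag_of (s, x \<oplus>\<^bsub>?F\<^esub> y) - \<sigma> (s \<odot>\<^bsub>?G\<^esub> base_change (x \<oplus>\<^bsub>?F\<^esub> y)) \<in> rels" if s: "s \<in> carrier S" for s
    proof -
      let ?u = "s \<odot>\<^bsub>?G\<^esub> base_change x" and ?v = "s \<odot>\<^bsub>?G\<^esub> base_change y"
      have "frag_of (s, x \<oplus>\<^bsub>?F\<^esub> y) - frag_of (s, x) - frag_of (s, y) \<in> rels"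
        using tensor_relations_right[OF T, of s x y] s xF yF by (simp add: module_via_def)
      moreover have "frag_of (s, x) - \<sigma> ?u \<in> rels" "frag_of (s, y) - \<sigma> ?v \<in> rels"
        using x y s by simp_all
      ultimately have "(frag_of (s, x \<oplus>\<^bsub>?F\<^esub> y) - frag_of (s, x) - frag_of (s, y)) +
          (frag_of (s, x) - \<sigma> ?u) + (frag_of (s, y) - \<sigma> ?v) \<in> rels"
        by (intro radd)
      from rdiff[OF this \<sigma>_add[of ?u ?v]] show ?thesis
        using s xF yF bx by' by (simp add: b.map_add G.smult_r_distr algebra_simps)
    qed
    then show ?thesis using xF yF by simp
  qed
  have H: "submodule ?H R ?F"
  proof (rule F.submoduleI)
    show "\<zero>\<^bsub>?F\<^esub> \<in> ?H"
    proof -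
      have "frag_of (s, \<zero>\<^bsub>?F\<^esub>) \<in> rels" if "s \<in> carrier S" for s
      proof -
        have "frag_of (s, \<zero>\<^bsub>?F\<^esub>) - frag_of (s, \<zero>\<^bsub>?F\<^esub>) - frag_of (s, \<zero>\<^bsub>?F\<^esub>) \<in> rels"
          using tensor_relations_right[OF T, of s "\<zero>\<^bsub>?F\<^esub>" "\<zero>\<^bsub>?F\<^esub>"] that by (simp add: module_via_def)
        from rdiff[OF rzero this] show ?thesis by simp
      qed
      then show ?thesis using \<sigma>_zero by (simp add: rdiff)
    qed
    show "\<ominus>\<^bsub>?F\<^esub> x \<in> ?H" if "x \<in> ?H" for x
      using H_smult[of "\<ominus>\<^bsub>R\<^esub> \<one>\<^bsub>R\<^esub>" x] that by (simp add: F.smult_l_minus)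
  qed (use H_smult H_add in auto)
  have eH: "unit_vector R i \<in> ?H" if i: "i < n" for i
  proof -
    have "frag_of (s, unit_vector R i) - \<sigma> (s \<odot>\<^bsub>?G\<^esub> base_change (unit_vector R i)) \<in> rels"
      if s: "s \<in> carrier S" for s
    proof -
      \<comment> \<open>For s e_i the sum has the wanted term at i and terms 0 \<otimes> e_j
        elsewhere, which are relations.\<close>
      have "\<sigma> (s \<odot>\<^bsub>?G\<^esub> base_change (unit_vector R i)) =
          frag_of (s, unit_vector R i) + (\<Sum>j\<in>{..<n} - {i}. frag_of (\<zero>\<^bsub>S\<^esub>, unit_vector R j))"
        unfolding \<sigma>_def base_change_unit_vector smult_free_module
        using i s by (subst sum.remove[of _ i]) (auto simp: unit_vector_def intro!: sum.cong)
      moreover have "(\<Sum>j\<in>{..<n} - {i}. frag_of (\<zero>\<^bsub>S\<^esub>, unit_vector R j)) \<in> rels"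
        using e by (intro tensor_relations_sum tensor_relations_frag_zero) simp
      ultimately show ?thesis using rdiff[OF rzero] by fastforce
    qed
    then show ?thesis using e[OF i] by simp
  qed
  have all: "x \<in> ?H" if x: "x \<in> carrier ?F" for x
  proof (rule free_module_memI[OF R.is_cring H x])
    fix i assume "i < n"
    from F.submoduleE(4)[OF H free_module_component[OF R.is_cring x] eH[OF this]]
    show "x i \<odot>\<^bsub>?F\<^esub> unit_vector R i \<in> ?H" .
  qed
  \<comment> \<open>\<open>\<sigma>\<close> is additive only up to relations, so the congruence is
    propagated through differences of formal sums.\<close>
  have "Poly_Mapping.keys c \<subseteq> carrier S \<times> carrier ?F \<and> c - \<sigma> (tensor_eval n c) \<in> rels"
    using c[simplified]
  proof (induction c rule: free_Abelian_group_induct[consumes 1, case_names zero diff of])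
    case zero
    then show ?case using rdiff[OF rzero \<sigma>_zero] by (simp add: tensor_eval_zero)
  next
    case (diff a d)
    then have a: "a \<in> chains (carrier ?F)" and d: "d \<in> chains (carrier ?F)"
      and ar: "a - \<sigma> (tensor_eval n a) \<in> rels" and dr: "d - \<sigma> (tensor_eval n d) \<in> rels" by simp_all
    let ?u = "tensor_eval n a \<ominus>\<^bsub>?G\<^esub> tensor_eval n d" and ?v = "tensor_eval n d"
    have ev: "?v \<in> carrier ?G" "tensor_eval n a \<in> carrier ?G"
      using tensor_eval_closed[OF d] tensor_eval_closed[OF a] .
    then have "?u \<in> carrier ?G" by (simp add: G.M.minus_closed)
    moreover have "?u \<oplus>\<^bsub>?G\<^esub> ?v = tensor_eval n a" using ev by (simp add: a_minus_def G.M.a_assoc G.M.l_neg)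
    ultimately have "\<sigma> (tensor_eval n a) - \<sigma> ?u - \<sigma> ?v \<in> rels" using \<sigma>_add[of ?u ?v] ev by simp
    from radd[OF rdiff[OF ar dr] this] show ?case
      using a d by (simp add: tensor_eval_diff keys_diff_subset algebra_simps)
  next
    case (of p)
    then show ?case using all by (auto simp: tensor_eval_of keys_frag_of)
  qed
  then show ?thesis
    using radd[OF _ \<sigma>_zero, of "c - \<sigma> \<zero>\<^bsub>?G\<^esub>"] zero by simp
qed

text \<open>The values of formal sums supported on U form an S-submodule of S^n that contains the
  base change of U and lies in its span. This provides preimages in S \<otimes> U for vectors of the
  span.\<close>

lemma tensor_eval_image:
  assumes U: "submodule U R (free_module R n)"
  shows "tensor_eval n ` chains U = extension n U"
proof
  let ?F = "free_module R n" and ?G = "free_module S n"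
  have UF: "U \<subseteq> carrier ?F" using F.submoduleE(1)[OF U] .
  have bU: "base_change ` U \<subseteq> carrier ?G" using UF b.map_mem by auto
  have chU: "c \<in> chains (carrier ?F)" if "c \<in> chains U" for c using that UF by blast
  have E: "submodule (extension n U) S ?G"
    unfolding extension_def by (rule submodule_span[OF G.module_axioms bU])
  have "Poly_Mapping.keys c \<subseteq> carrier S \<times> U \<and> tensor_eval n c \<in> extension n U" if "c \<in> chains U" for c
    using that[simplified]
  proof (induction c rule: free_Abelian_group_induct[consumes 1, case_names zero diff of])
    case zero
    then show ?case using submodule_zero_closed[OF E] by (simp add: tensor_eval_zero)
  next
    case (diff a d)
    then show ?case
      using chU[of a] chU[of d] by (simp add: tensor_eval_diff keys_diff_subset G.submodule_minus_closed[OF E])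
  next
    case (of p)
    then obtain s x where p: "p = (s, x)" "s \<in> carrier S" "x \<in> U" by auto
    then have "base_change x \<in> extension n U"
      using span_superset[of "base_change ` U" S ?G] by (auto simp: extension_def)
    then show ?case using p UF G.submoduleE(4)[OF E p(2)] by (simp add: tensor_eval_of keys_frag_of subsetD[OF UF])
  qed
  then show "tensor_eval n ` chains U \<subseteq> extension n U" by auto
  \<comment> \<open>Formal sums have only integer coefficients, so a scalar of S must be absorbed
    into the first tensor factor, generator by generator.\<close>
  have smult: "\<exists>d. d \<in> chains U \<and> tensor_eval n d = s \<odot>\<^bsub>?G\<^esub> tensor_eval n c"
    if s: "s \<in> carrier S" and c: "c \<in> chains U" for s c
    using c[simplified]
  proof (induction c rule: free_Abelian_group_induct[consumes 1, case_names zero diff of])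
    case zero
    then show ?case using s by (intro exI[of _ 0]) (simp add: tensor_eval_zero)
  next
    case (diff a c)
    then obtain d e where de: "d \<in> chains U" "tensor_eval n d = s \<odot>\<^bsub>?G\<^esub> tensor_eval n a"
      "e \<in> chains U" "tensor_eval n e = s \<odot>\<^bsub>?G\<^esub> tensor_eval n c" by blast
    have cl: "tensor_eval n a \<in> carrier ?G" "tensor_eval n c \<in> carrier ?G"
      using diff(1,2) chU tensor_eval_closed by simp_all
    have "tensor_eval n (d - e) = s \<odot>\<^bsub>?G\<^esub> tensor_eval n (a - c)"
      using diff(1,2) de(2,4) s cl tensor_eval_diff[OF chU[OF de(1)] chU[OF de(3)]] tensor_eval_diff[OF chU chU, of a c]
      by (simp add: a_minus_def G.smult_r_distr G.smult_r_minus)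
    then show ?case using de(1,3) by (intro exI[of _ "d - e"]) (simp add: keys_diff_subset)
  next
    case (of p)
    then obtain t x where p: "p = (t, x)" "t \<in> carrier S" "x \<in> U" by auto
    then have "x \<in> carrier ?F" using UF by auto
    then show ?case
      using p s b.map_mem by (intro exI[of _ "frag_of (s \<otimes>\<^bsub>S\<^esub> t, x)"]) (simp add: tensor_eval_of keys_frag_of G.smult_assoc1)
  qed
  have neg: "\<ominus>\<^bsub>?G\<^esub> y \<in> tensor_eval n ` chains U" if y: "y \<in> tensor_eval n ` chains U" for y
  proof -
    obtain c where c: "c \<in> chains U" "y = tensor_eval n c" using y by (elim imageE)
    have "tensor_eval n (0 - c) = \<ominus>\<^bsub>?G\<^esub> y"
      using tensor_eval_diff[of 0 c] chU[OF c(1)] c(2) tensor_eval_closed[OF chU[OF c(1)]]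
      by (simp add: tensor_eval_zero a_minus_def)
    moreover have "0 - c \<in> chains U" using c(1) by (simp add: keys_minus)
    ultimately show ?thesis by (metis imageI)
  qed
  have "submodule (tensor_eval n ` chains U) S ?G"
  proof (rule G.submoduleI)
    show "tensor_eval n ` chains U \<subseteq> carrier ?G"
      using chU tensor_eval_closed by auto
    show "\<zero>\<^bsub>?G\<^esub> \<in> tensor_eval n ` chains U"
      using tensor_eval_zero by (intro image_eqI[of _ _ 0]) simp_all
    show "\<ominus>\<^bsub>?G\<^esub> y \<in> tensor_eval n ` chains U" if "y \<in> tensor_eval n ` chains U" for y
      using neg[OF that] .
    show "y \<oplus>\<^bsub>?G\<^esub> z \<in> tensor_eval n ` chains U"
      if y: "y \<in> tensor_eval n ` chains U" and z: "z \<in> tensor_eval n ` chains U" for y z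
    proof -
      obtain c where c: "c \<in> chains U" "y = tensor_eval n c" using y by (elim imageE)
      obtain d where d: "d \<in> chains U" "z = tensor_eval n d" using z by (elim imageE)
      have "c + d \<in> chains U" using c(1) d(1) keys_add[of c d] by blast
      then show ?thesis
        using tensor_eval_add[OF chU[OF c(1)] chU[OF d(1)]] c(2) d(2) by (metis imageI)
    qed
    show "s \<odot>\<^bsub>?G\<^esub> y \<in> tensor_eval n ` chains U"
      if s: "s \<in> carrier S" and y: "y \<in> tensor_eval n ` chains U" for s y
    proof -
      obtain c where c: "c \<in> chains U" "y = tensor_eval n c" using y by (elim imageE)
      show ?thesis using smult[OF s c(1)] c(2) by (metis imageI)
    qed
  qed
  moreover have "base_change ` U \<subseteq> tensor_eval n ` chains U"
  proof
    fix y assume "y \<in> base_change ` U"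
    then obtain x where x: "x \<in> U" "y = base_change x" by (elim imageE)
    then have "x \<in> carrier ?F" using UF by auto
    then have "tensor_eval n (frag_of (\<one>\<^bsub>S\<^esub>, x)) = y"
      using x(2) b.map_mem by (simp add: tensor_eval_of)
    then show "y \<in> tensor_eval n ` chains U"
      using x(1) by (intro image_eqI[of _ _ "frag_of (\<one>\<^bsub>S\<^esub>, x)"]) (simp_all add: keys_frag_of)
  qed
  ultimately show "extension n U \<subseteq> tensor_eval n ` chains U"
    unfolding extension_def by (rule span_least)
qed

lemma tensor_relations_submodule:
  assumes U: "submodule U R (free_module R n)"
    and c: "c \<in> tensor_relations R target_module ((free_module R n)\<lparr>carrier := U\<rparr>)"
  shows "c \<in> rels"
proof -
  have "linear_map R ((free_module R n)\<lparr>carrier := U\<rparr>) (free_module R n) (\<lambda>x. x)"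
    using submodule.submodule_is_module[OF U F.module_axioms] F.submoduleE(1)[OF U] F.module_axioms
    by (auto simp: linear_map_iff linear_maps_def)
  from tensor_push_relations[OF module_target this c] show ?thesis
    using tensor_push_ident[of c UNIV UNIV "\<lambda>x. x"] by simp
qed

end

end

section \<open>Descent of coherence\<close>

lemma submodule_module_restrict:
  "\<lbrakk>module R M; submodule U R M\<rbrakk> \<Longrightarrow> module R (M\<lparr>carrier := U\<rparr>)"
  by (rule submodule.submodule_is_module)

lemma linear_inclusion:
  fixes M :: "('a, 'b) module"
  assumes M: "module R M" and U: "submodule U R M" and V: "submodule V R M" and "U \<subseteq> V"
  shows "linear_map R (M\<lparr>carrier := U\<rparr>) (M\<lparr>carrier := V\<rparr>) (\<lambda>x. x)"
  using assms by (auto simp: linear_map_iff linear_maps_def submodule_module_restrict)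

lemma submodule_Int:
  fixes M :: "('a, 'b) module"
  assumes "module R M" and U: "submodule U R M" and V: "submodule V R M"
  shows "submodule (U \<inter> V) R M"
proof -
  interpret module R M by fact
  show ?thesis
    by (rule submoduleI)
      (use submoduleE[OF U] submoduleE[OF V] submodule_zero_closed[OF U] submodule_zero_closed[OF V] in auto)
qed

lemma linear_restrict_domain:
  fixes M :: "('a, 'b) module"
  assumes U: "submodule U R M" and k: "linear_map R M N k"
  shows "linear_map R (M\<lparr>carrier := U\<rparr>) N k"
proof -
  interpret k: semilinear_map R R "\<lambda>r. r" M N k by (rule k)
  have "linear_map R (M\<lparr>carrier := U\<rparr>) M (\<lambda>x. x)"
    using linear_inclusion[OF k.M.module_axioms U k.M.carrier_is_submodule k.M.submoduleE(1)[OF U]] by simp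
  from semilinear_compose[OF this k] show ?thesis by (simp add: comp_def)
qed

text \<open>Copies R into R^1, so that linear forms take values in a module of sequences and can
  appear in a test sequence for faithful flatness.\<close>

definition first_coordinate :: "('a, 'r) ring_scheme \<Rightarrow> 'a \<Rightarrow> nat \<Rightarrow> 'a" where
  "first_coordinate R r = (\<lambda>j. if j = 0 then r else \<zero>\<^bsub>R\<^esub>)"

lemma linear_first_coordinate:
  assumes "cring R"
  shows "linear_map R (self_module R) (free_module R 1) (first_coordinate R)"
proof -
  interpret cring R by fact
  show ?thesis
    using module_self[OF assms] module_free_module[OF assms, of 1]
    by (auto simp: linear_map_iff linear_maps_def first_coordinate_def carrier_free_module
        add_free_module smult_free_module fun_eq_iff)
qed

lemma first_coordinate_eq_zero_iff:
  "first_coordinate R r = \<zero>\<^bsub>free_module R 1\<^esub> \<longleftrightarrow> r = \<zero>\<^bsub>R\<^esub>"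
  by (auto simp: first_coordinate_def zero_free_module fun_eq_iff)

context ring_hom_cring
begin

lemma pairing_base_change:
  assumes a: "a \<in> {..<n} \<rightarrow> carrier R" and x: "x \<in> carrier (free_module R n)"
  shows "lincomb (self_module S) n (\<lambda>i. h (a i)) (base_change x) = h (lincomb (self_module R) n a x)"
proof -
  have ha: "(\<lambda>i. h (a i)) \<in> {..<n} \<rightarrow> carrier S" using a by auto
  interpret R': module R "self_module R" by (rule module_self[OF R.is_cring])
  interpret S': module S "self_module S" by (rule module_self[OF S.is_cring])
  have hl: "semilinear_map R S h (self_module R) (self_module S) h"
    by unfold_locales auto
  have 1: "semilinear_map R S h (free_module R n) (self_module S)
      (\<lambda>x. lincomb (self_module S) n (\<lambda>i. h (a i)) (base_change x))"
    using semilinear_compose[OF semilinear_base_change linear_pairing[OF S.is_cring ha]] by (simp add: comp_def)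
  have 2: "semilinear_map R S h (free_module R n) (self_module S) (\<lambda>x. h (lincomb (self_module R) n a x))"
    using semilinear_compose[OF linear_pairing[OF R.is_cring a] hl] by (simp add: comp_def)
  show ?thesis
    using semilinear_free_eqI[OF R.is_cring 1 2 _ x]
    by (simp add: base_change_unit_vector pairing_unit_vector[OF R.is_cring a] pairing_unit_vector[OF S.is_cring ha])
qed

lemma base_change_first_coordinate: "base_change (first_coordinate R r) = first_coordinate S (h r)"
  by (auto simp: base_change_def first_coordinate_def)

text \<open>Naturality of evaluation: if k' over S extends k over R, then id \<otimes> k becomes k'
  after evaluation.\<close>

lemma tensor_eval_push:
  assumes k: "linear_map R (free_module R n) (free_module R m) k"
    and k': "linear_map S (free_module S n) (free_module S m) k'"
    and kk': "\<And>x. x \<in> carrier (free_module R n) \<Longrightarrow> k' (base_change x) = base_change (k x)"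
    and c: "Poly_Mapping.keys c \<subseteq> carrier S \<times> carrier (free_module R n)"
  shows "tensor_eval m (tensor_push k c) = k' (tensor_eval n c)"
proof -
  interpret k: semilinear_map R R "\<lambda>r. r" "free_module R n" "free_module R m" k by (rule k)
  interpret k': semilinear_map S S "\<lambda>r. r" "free_module S n" "free_module S m" k' by (rule k')
  interpret b: semilinear_map R S h "free_module R n" "free_module S n" base_change
    by (rule semilinear_base_change)
  show ?thesis
    using c
  proof (induction c rule: free_Abelian_group_induct[consumes 1, case_names zero diff of])
    case zero
    then show ?case by (simp add: tensor_eval_zero)
  next
    case (diff a c)
    then show ?case
      using tensor_push_keys[OF diff(1) k.map_closed] tensor_push_keys[OF diff(2) k.map_closed]
      by (simp add: tensor_eval_diff tensor_eval_closed k'.map_diff)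
  next
    case (of p)
    then obtain s x where "p = (s, x)" "s \<in> carrier S" "x \<in> carrier (free_module R n)" by auto
    then show ?case
      by (simp add: tensor_eval_of k.map_mem b.map_mem k'.map_smult kk')
  qed
qed

text \<open>Flatness in the language of spans: the kernel of a linear form on U, defined over R,
  spans the kernel of the extended form on the S-span of U. It is exactness of S \<otimes> W -> S
  \<otimes> U -> S \<otimes> R^1, where W is that kernel in U.\<close>

lemma extension_kernel:
  assumes ff: "faithfully_flat TYPE((nat \<Rightarrow> 'a) set) R target_module"
    and U: "submodule U R (free_module R n)" and a: "a \<in> {..<n} \<rightarrow> carrier R"
    and v: "v \<in> extension n U" and zero: "lincomb (self_module S) n (\<lambda>i. h (a i)) v = \<zero>\<^bsub>S\<^esub>"
  shows "v \<in> extension n {x \<in> U. lincomb (self_module R) n a x = \<zero>\<^bsub>R\<^esub>}" (is "_ \<in> extension n ?W")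
proof -
  let ?F = "free_module R n"
  have ha: "(\<lambda>i. h (a i)) \<in> {..<n} \<rightarrow> carrier S" using a by auto
  interpret F: module R ?F by (rule module_free_module[OF R.is_cring])
  note UF = F.submoduleE(1)[OF U]
  define k where "k = (\<lambda>x. first_coordinate R (lincomb (self_module R) n a x))"
  define k' where "k' = (\<lambda>x. first_coordinate S (lincomb (self_module S) n (\<lambda>i. h (a i)) x))"
  have k: "linear_map R ?F (free_module R 1) k"
    using semilinear_compose[OF linear_pairing[OF R.is_cring a] linear_first_coordinate[OF R.is_cring]]
    by (simp add: k_def comp_def)
  have k': "linear_map S (free_module S n) (free_module S 1) k'"
    using semilinear_compose[OF linear_pairing[OF S.is_cring ha] linear_first_coordinate[OF S.is_cring]]
    by (simp add: k'_def comp_def)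
  have kk': "k' (base_change x) = base_change (k x)" if "x \<in> carrier ?F" for x
    using pairing_base_change[OF a that] by (simp add: k_def k'_def base_change_first_coordinate)
  interpret k: semilinear_map R R "\<lambda>r. r" ?F "free_module R 1" k by (rule k)
  have self: "module R (self_module R)" by (rule module_self[OF R.is_cring])
  have "?W = U \<inter> syzygies R (self_module R) n a" using UF by (auto simp: syzygies_def)
  then have W: "submodule ?W R ?F"
    using submodule_Int[OF F.module_axioms U submodule_syzygies[OF self, of a n]] a by simp
  have incl: "linear_map R (?F\<lparr>carrier := ?W\<rparr>) (?F\<lparr>carrier := U\<rparr>) (\<lambda>x. x)"
    by (rule linear_inclusion[OF F.module_axioms W U]) auto
  have kU: "linear_map R (?F\<lparr>carrier := U\<rparr>) (free_module R 1) k"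
    by (rule linear_restrict_domain[OF U k])
  have "(\<lambda>x. x) ` carrier (?F\<lparr>carrier := ?W\<rparr>) =
      {x \<in> carrier (?F\<lparr>carrier := U\<rparr>). k x = \<zero>\<^bsub>free_module R 1\<^esub>}"
    unfolding k_def first_coordinate_eq_zero_iff by simp
  then have exact: "tensor_exact R target_module (?F\<lparr>carrier := ?W\<rparr>) (?F\<lparr>carrier := U\<rparr>) (free_module R 1) (\<lambda>x. x) k"
    using faithfully_flat_exact_iff[OF ff incl kU] by simp
  obtain c where c: "Poly_Mapping.keys c \<subseteq> carrier S \<times> U" "v = tensor_eval n c"
    using v tensor_eval_image[OF U] by auto
  have cF: "Poly_Mapping.keys c \<subseteq> carrier S \<times> carrier ?F" using c(1) UF by blast
  have "k' v = \<zero>\<^bsub>free_module S 1\<^esub>"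
    unfolding k'_def first_coordinate_eq_zero_iff by (rule zero)
  then have "tensor_eval 1 (tensor_push k c) = \<zero>\<^bsub>free_module S 1\<^esub>"
    using tensor_eval_push[OF k k' kk' cF] c(2) by simp
  \<comment> \<open>Injectivity of evaluation in rank 1 turns the vanishing of the extended form at
    v into vanishing of the tensor, which is what exactness requires.\<close>
  then have "tensor_push k c \<in> tensor_relations R target_module (free_module R 1)"
    using tensor_eval_eq_zero[of "tensor_push k c" 1] tensor_push_keys[OF cF k.map_closed] by simp
  then obtain d where d: "Poly_Mapping.keys d \<subseteq> carrier S \<times> ?W"
    "c - tensor_push (\<lambda>x. x) d \<in> tensor_relations R target_module (?F\<lparr>carrier := U\<rparr>)"
    using exact c(1) by (auto simp: tensor_exact_def module_via_def)
  have dF: "Poly_Mapping.keys d \<subseteq> carrier S \<times> carrier ?F" using d(1) UF by blast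
  \<comment> \<open>A relation over U is also a relation over R^n, so c and d evaluate to the same
    vector, and d is supported on W.\<close>
  have "c - d \<in> tensor_relations R target_module ?F"
    using tensor_relations_submodule[OF U d(2)] tensor_push_ident[OF dF] by simp
  then have "tensor_eval n c \<ominus>\<^bsub>free_module S n\<^esub> tensor_eval n d = \<zero>\<^bsub>free_module S n\<^esub>"
    using tensor_eval_relations[of "c - d" n] tensor_eval_diff[of c n d] cF dF by simp
  moreover interpret G: module S "free_module S n" by (rule module_free_module[OF S.is_cring])
  have "tensor_eval n c \<in> carrier (free_module S n)" "tensor_eval n d \<in> carrier (free_module S n)"
    using tensor_eval_closed cF dF by simp_all
  moreover from this have "tensor_eval n c =
      (tensor_eval n c \<ominus>\<^bsub>free_module S n\<^esub> tensor_eval n d) \<oplus>\<^bsub>free_module S n\<^esub> tensor_eval n d"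
    by (simp add: a_minus_def G.M.a_assoc G.M.l_neg)
  ultimately have "tensor_eval n c = tensor_eval n d" by simp
  then show ?thesis using c(2) d(1) tensor_eval_image[OF W] by auto
qed

text \<open>Faithfulness in the language of spans. Surjectivity of K0 -> K is exactness of K0 -> K
  -> 0, which may be checked after tensoring; there it follows from equality of values in S^n,
  because flatness makes S \<otimes> K -> S \<otimes> R^n injective. R^0 serves as the zero module
  of the required type.\<close>

lemma extension_reflects_subset:
  assumes ff: "faithfully_flat TYPE((nat \<Rightarrow> 'a) set) R target_module"
    and K0: "submodule K0 R (free_module R n)" and K: "submodule K R (free_module R n)"
    and sub: "K0 \<subseteq> K" and ext: "extension n K \<subseteq> extension n K0"
  shows "K \<subseteq> K0"
proof -
  let ?F = "free_module R n" and ?Z = "free_module R 0"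
  interpret F: module R ?F by (rule module_free_module[OF R.is_cring])
  interpret Z: module R ?Z by (rule module_free_module[OF R.is_cring])
  interpret G: module S "free_module S n" by (rule module_free_module[OF S.is_cring])
  note KF = F.submoduleE(1)[OF K] and K0F = F.submoduleE(1)[OF K0]
  let ?A = "?F\<lparr>carrier := K\<rparr>" and ?B = "?F\<lparr>carrier := K0\<rparr>"
  note mK = submodule_module_restrict[OF F.module_axioms K]
  \<comment> \<open>S^0 has only one element, so injectivity of evaluation in rank 0 makes every
    tensor over R^0 vanish.\<close>
  have Z_rel: "z \<in> tensor_relations R target_module ?Z" if z: "Poly_Mapping.keys z \<subseteq> carrier S \<times> carrier ?Z" for z
  proof -
    have "tensor_eval 0 z \<in> carrier (free_module S 0)" using tensor_eval_closed z by simp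
    then have "tensor_eval 0 z = \<zero>\<^bsub>free_module S 0\<^esub>"
      by (auto simp: carrier_free_module zero_free_module)
    then show ?thesis using tensor_eval_eq_zero z by simp
  qed
  have K_zero: "\<zero>\<^bsub>?F\<^esub> \<in> K" by (rule submodule_zero_closed[OF K])
  have to_zero: "linear_map R ?A ?Z (\<lambda>x. \<zero>\<^bsub>?Z\<^esub>)"
    using mK Z.module_axioms by (auto simp: linear_map_iff linear_maps_def)
  have from_zero: "linear_map R ?Z ?A (\<lambda>x. \<zero>\<^bsub>?F\<^esub>)"
    using mK Z.module_axioms K_zero by (auto simp: linear_map_iff linear_maps_def)
  have incl: "linear_map R ?A ?F (\<lambda>x. x)"
    using mK F.module_axioms KF by (auto simp: linear_map_iff linear_maps_def)
  have incl0: "linear_map R ?B ?A (\<lambda>x. x)"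
    by (rule linear_inclusion[OF F.module_axioms K0 K sub])
  have "(\<lambda>x. \<zero>\<^bsub>?F\<^esub>) ` carrier ?Z = {x \<in> carrier ?A. x = \<zero>\<^bsub>?F\<^esub>}"
    using K_zero Z.M.zero_closed by auto
  then have inj: "tensor_exact R target_module ?Z ?A ?F (\<lambda>x. \<zero>\<^bsub>?F\<^esub>) (\<lambda>x. x)"
    using faithfully_flat_exact_iff[OF ff from_zero incl] by simp
  have "tensor_exact R target_module ?B ?A ?Z (\<lambda>x. x) (\<lambda>x. \<zero>\<^bsub>?Z\<^esub>)"
    unfolding tensor_exact_def
  proof (intro allI impI iffI)
    fix c :: "'c \<times> (nat \<Rightarrow> 'a) \<Rightarrow>\<^sub>0 int"
    assume "Poly_Mapping.keys c \<subseteq> carrier target_module \<times> carrier ?A"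
    then have c: "Poly_Mapping.keys c \<subseteq> carrier S \<times> K" by (simp add: module_via_def)
    then have cF: "Poly_Mapping.keys c \<subseteq> carrier S \<times> carrier ?F" using KF by blast
    have push: "Poly_Mapping.keys (tensor_push (\<lambda>x. \<zero>\<^bsub>?Z\<^esub>) c) \<subseteq> carrier S \<times> carrier ?Z"
      by (rule tensor_push_keys[OF c]) auto
    then show "tensor_push (\<lambda>x. \<zero>\<^bsub>?Z\<^esub>) c \<in> tensor_relations R target_module ?Z" by (rule Z_rel)
    have "tensor_eval n c \<in> extension n K0"
      using tensor_eval_image[OF K] c ext by auto
    then obtain d where d: "Poly_Mapping.keys d \<subseteq> carrier S \<times> K0" "tensor_eval n c = tensor_eval n d"
      using tensor_eval_image[OF K0] by auto
    have dK: "Poly_Mapping.keys d \<subseteq> carrier S \<times> K" using d(1) sub by blast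
    have dF: "Poly_Mapping.keys d \<subseteq> carrier S \<times> carrier ?F" using dK KF by blast
    have push_id: "tensor_push (\<lambda>x. x) e = e" for e :: "'c \<times> (nat \<Rightarrow> 'a) \<Rightarrow>\<^sub>0 int"
      by (rule tensor_push_ident[of e UNIV UNIV]) auto
    have "tensor_eval n (c - d) = \<zero>\<^bsub>free_module S n\<^esub>"
      using tensor_eval_diff[of c n d] tensor_eval_closed[of d n] cF dF d(2)
      by (simp add: a_minus_def G.M.r_neg)
    then have "c - d \<in> tensor_relations R target_module ?F"
      using tensor_eval_eq_zero[of "c - d" n] cF dF by (simp add: keys_diff_subset)
    then have "tensor_push (\<lambda>x. x) (c - d) \<in> tensor_relations R target_module ?F"
      unfolding push_id .
    moreover have "Poly_Mapping.keys (c - d) \<subseteq> carrier target_module \<times> carrier ?A"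
      using keys_diff_subset[OF c dK] by (simp add: module_via_def)
    \<comment> \<open>Injectivity is expressed as exactness at K of 0 -> K -> R^n, so c - d is a
      relation over K only up to a term coming from S \<otimes> 0, which is removed next.\<close>
    ultimately obtain z where z: "Poly_Mapping.keys z \<subseteq> carrier target_module \<times> carrier ?Z"
      "c - d - tensor_push (\<lambda>x. \<zero>\<^bsub>?F\<^esub>) z \<in> tensor_relations R target_module ?A"
      using inj unfolding tensor_exact_def by blast
    have "z \<in> tensor_relations R target_module ?Z" using Z_rel z(1) by (simp add: module_via_def)
    from tensor_relations_add[OF module_target mK z(2) tensor_push_relations[OF module_target from_zero this]]
    have "c - tensor_push (\<lambda>x. x) d \<in> tensor_relations R target_module ?A"
      unfolding push_id by simp
    then show "\<exists>d. Poly_Mapping.keys d \<subseteq> carrier target_module \<times> carrier ?B \<and>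
        c - tensor_push (\<lambda>x. x) d \<in> tensor_relations R target_module ?A"
      using d(1) by (intro exI[of _ d]) (simp add: module_via_def)
  qed
  then have "(\<lambda>x. x) ` carrier ?B = {x \<in> carrier ?A. \<zero>\<^bsub>?Z\<^esub> = \<zero>\<^bsub>?Z\<^esub>}"
    by (rule iffD2[OF faithfully_flat_exact_iff[OF ff incl0 to_zero]])
  then have "K0 = K" by simp
  then show ?thesis by (rule equalityD2)
qed

lemma extension_least:
  assumes "submodule H S (free_module S n)" and "base_change ` U \<subseteq> H"
  shows "extension n U \<subseteq> H"
  unfolding extension_def using assms by (rule span_least)

lemma submodule_extension:
  assumes "U \<subseteq> carrier (free_module R n)"
  shows "submodule (extension n U) S (free_module S n)"
  unfolding extension_def
  using assms semilinear_map.map_mem[OF semilinear_base_change]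
  by (intro submodule_span module_free_module[OF S.is_cring]) auto

lemma base_change_extension: "x \<in> U \<Longrightarrow> base_change x \<in> extension n U"
  unfolding extension_def using span_superset[of "base_change ` U"] by auto

text \<open>An S-submodule of S is an ideal, so minimality of the generated ideal applies. It allows
  properties of elements of PS to be checked on the image of P whenever they cut out a
  submodule.\<close>

lemma extended_ideal_least:
  assumes H: "submodule H S (self_module S)" and hP: "h ` P \<subseteq> H"
  shows "extended_ideal S h P \<subseteq> H"
proof -
  interpret A: module S "self_module S" by (rule module_self[OF S.is_cring])
  have neg: "\<ominus>\<^bsub>self_module S\<^esub> a = \<ominus>\<^bsub>S\<^esub> a" for a
    by (simp add: a_inv_def m_inv_def module_via_def)
  note HE = A.submoduleE[OF H, simplified, unfolded neg]
  have "subgroup H (add_monoid S)"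
    by (rule S.add.subgroupI) (use HE in \<open>auto simp: a_inv_def[symmetric]\<close>)
  moreover have "a \<otimes>\<^bsub>S\<^esub> x \<in> H" if "a \<in> H" "x \<in> carrier S" for a x
    using HE(1) HE(4)[OF that(2,1)] that S.m_comm[of a x] by auto
  ultimately have "ideal H S"
    using HE(4) S.ring_axioms by (intro idealI)
  then show ?thesis using hP S.genideal_minimal by (simp add: extended_ideal_def)
qed

text \<open>The scalars s with s e_i in the extension of U form a submodule of S. It contains the
  image of P because p e_i already lies in U over R, hence it contains all of PS.\<close>

lemma scaled_unit_extension:
  assumes i: "i < n" and U: "submodule U R (free_module R n)"
    and P: "\<And>p. p \<in> P \<Longrightarrow> p \<in> carrier R \<and> p \<odot>\<^bsub>free_module R n\<^esub> unit_vector R i \<in> U"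
    and s: "s \<in> extended_ideal S h P"
  shows "s \<odot>\<^bsub>free_module S n\<^esub> unit_vector S i \<in> extension n U"
proof -
  interpret F: module R "free_module R n" by (rule module_free_module[OF R.is_cring])
  interpret A: module S "self_module S" by (rule module_self[OF S.is_cring])
  interpret G: module S "free_module S n" by (rule module_free_module[OF S.is_cring])
  interpret b: semilinear_map R S h "free_module R n" "free_module S n" base_change
    by (rule semilinear_base_change)
  interpret e: semilinear_map S S "\<lambda>r. r" "self_module S" "free_module S n"
      "\<lambda>s. s \<odot>\<^bsub>free_module S n\<^esub> unit_vector S i"
    by unfold_locales
      (use unit_vector_closed[OF S.is_cring i] in \<open>auto simp: G.smult_l_distr G.smult_assoc1\<close>)
  note E = submodule_extension[OF F.submoduleE(1)[OF U]]
  have "h p \<odot>\<^bsub>free_module S n\<^esub> unit_vector S i \<in> extension n U" if "p \<in> P" for p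
    using base_change_extension[of "p \<odot>\<^bsub>free_module R n\<^esub> unit_vector R i" U n] P[OF that]
      unit_vector_closed[OF R.is_cring i]
    by (simp add: b.map_smult base_change_unit_vector)
  then have "h ` P \<subseteq> {s \<in> carrier (self_module S). s \<odot>\<^bsub>free_module S n\<^esub> unit_vector S i \<in> extension n U}"
    using P by auto
  from extended_ideal_least[OF e.submodule_preimage[OF E] this] s show ?thesis by auto
qed

end

section \<open>Relations modulo the extended ideal come from relations modulo P\<close>

lemma lincomb_Suc:
  assumes "module R M" and "m \<in> {..<Suc n} \<rightarrow> carrier M" and "\<And>i. x i \<in> carrier R"
  shows "lincomb M (Suc n) m x = lincomb M n m x \<oplus>\<^bsub>M\<^esub> x n \<odot>\<^bsub>M\<^esub> m n"
proof -
  interpret module R M by fact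
  have "m i \<in> carrier M" if "i \<le> n" for i using assms(2) that by auto
  then show ?thesis
    unfolding lincomb_def lessThan_Suc using assms(3)
    by (subst M.finsum_insert) (auto simp: M.a_comm)
qed

lemma lincomb_cong:
  assumes "module R M" and "m \<in> {..<n} \<rightarrow> carrier M" and "\<And>i. x i \<in> carrier R"
    and "\<And>i. i < n \<Longrightarrow> m i = m' i" and "\<And>i. i < n \<Longrightarrow> x i = x' i"
  shows "lincomb M n m x = lincomb M n m' x'"
proof -
  interpret module R M by fact
  show ?thesis
    unfolding lincomb_def
  proof (rule M.finsum_cong')
    show "(\<lambda>i. x' i \<odot>\<^bsub>M\<^esub> m' i) \<in> {..<n} \<rightarrow> carrier M"
      using assms(2) by (auto simp: Pi_iff assms(3) simp flip: assms(4,5))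
  qed (simp_all add: assms(4,5))
qed

text \<open>The submodule \<open>U\<close> of \<open>R\<^sup>n\<^sup>+\<^sup>1\<close> with last coordinate in \<open>P\<close> turns relations
  modulo \<open>P\<close> into the kernel of a linear form, so that flatness applies without leaving
  submodules of free modules.\<close>

lemma (in ring_hom_cring) relations_extension:
  assumes ff: "faithfully_flat TYPE((nat \<Rightarrow> 'a) set) R target_module"
    and P: "ideal P R" and b: "b \<in> {..<n} \<rightarrow> carrier R"
  shows "relations S (extended_ideal S h P) n (\<lambda>i. h (b i)) \<subseteq> extension n (relations R P n b)"
proof
  let ?J = "extended_ideal S h P" and ?K = "relations R P n b"
  interpret P: ideal P R by (rule P)
  let ?F = "free_module R (Suc n)" and ?G = "free_module S (Suc n)"
  interpret F: module R ?F by (rule module_free_module[OF R.is_cring])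
  interpret G: module S ?G by (rule module_free_module[OF S.is_cring])
  note selfR = module_self[OF R.is_cring] and selfS = module_self[OF S.is_cring]
  \<comment> \<open>The last coefficient is -1, so the kernel of the form on U consists of the x
    with \<Sum> b_i x_i = x_n, where x_n lies in P. Dropping x_n gives the relations of b modulo
    P.\<close>
  define a where "a = (\<lambda>i. if i < n then b i else \<ominus>\<^bsub>R\<^esub> \<one>\<^bsub>R\<^esub>)"
  have bi: "b i \<in> carrier R" if "i < n" for i using b that by auto
  have ai: "a i \<in> carrier R" for i using bi by (simp add: a_def)
  have hb: "(\<lambda>i. h (b i)) \<in> {..<n} \<rightarrow> carrier S" using bi by auto
  define U where "U = {x \<in> carrier ?F. x n \<in> P}"
  have U: "submodule U R ?F"
  proof -
    have "linear_map R ?F (self_module R) (\<lambda>x. x n)"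
      using F.module_axioms selfR free_module_component[OF R.is_cring]
      by (auto simp: linear_map_iff linear_maps_def add_free_module smult_free_module)
    from semilinear_map.submodule_preimage[OF this ideal_submodule_self[OF R.is_cring P]]
    show ?thesis by (simp add: U_def)
  qed
  let ?W = "{x \<in> U. lincomb (self_module R) (Suc n) a x = \<zero>\<^bsub>R\<^esub>}"
  fix y assume "y \<in> relations S ?J n (\<lambda>i. h (b i))"
  then have y: "y \<in> carrier (free_module S n)" and t: "lincomb (self_module S) n (\<lambda>i. h (b i)) y \<in> ?J"
    by (simp_all add: relations_def)
  let ?t = "lincomb (self_module S) n (\<lambda>i. h (b i)) y"
  note yi = free_module_component[OF S.is_cring y]
  have tS: "?t \<in> carrier S"
    using semilinear_map.map_mem[OF linear_pairing[OF S.is_cring hb] y] by simp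
  \<comment> \<open>Appending the value t of the pairing to y makes the extended form vanish: its
    last term is -t.\<close>
  define v where "v = (\<lambda>i. if i = n then ?t else y i)"
  have v: "v \<in> carrier ?G" using y yi tS by (auto simp: v_def carrier_free_module)
  have vi: "v i \<in> carrier S" for i using yi tS by (simp add: v_def)
  have E: "submodule (extension (Suc n) U) S ?G"
    by (rule submodule_extension[OF F.submoduleE(1)[OF U]])
  \<comment> \<open>For i < n the unit vector already lies in U, its last entry being zero. In the
    last coordinate only multiples p e_n with p in P are available, which suffices because t lies in
    PS.\<close>
  have "v \<in> extension (Suc n) U"
  proof (rule free_module_memI[OF S.is_cring E v])
    fix i assume i: "i < Suc n"
    show "v i \<odot>\<^bsub>?G\<^esub> unit_vector S i \<in> extension (Suc n) U"
    proof (cases "i = n")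
      case True
      have "p \<odot>\<^bsub>?F\<^esub> unit_vector R n \<in> U" if "p \<in> P" for p
      proof -
        have "p \<in> carrier R" using that P.a_subset by auto
        then show ?thesis
          using that F.smult_closed[OF _ unit_vector_closed[OF R.is_cring, of n "Suc n"], of p]
          by (simp add: U_def smult_free_module unit_vector_def)
      qed
      then have "?t \<odot>\<^bsub>?G\<^esub> unit_vector S n \<in> extension (Suc n) U"
        using P.a_subset by (intro scaled_unit_extension[OF _ U _ t]) auto
      then show ?thesis using True by (simp add: v_def)
    next
      case False
      then have "unit_vector R i \<in> U"
        using i unit_vector_closed[OF R.is_cring i] by (simp add: U_def unit_vector_def)
      from base_change_extension[OF this] show ?thesis
        using G.submoduleE(4)[OF E vi] by (simp add: base_change_unit_vector)
    qed
  qed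
  moreover have "lincomb (self_module S) (Suc n) (\<lambda>i. h (a i)) v = \<zero>\<^bsub>S\<^esub>"
  proof -
    have "lincomb (self_module S) n (\<lambda>i. h (a i)) v = ?t"
      by (rule lincomb_cong[OF selfS]) (use ai vi in \<open>auto simp: a_def v_def\<close>)
    then show ?thesis
      using lincomb_Suc[OF selfS, of "\<lambda>i. h (a i)" n v] ai vi tS
      by (simp add: a_def v_def S.r_minus S.r_neg)
  qed
  ultimately have vW: "v \<in> extension (Suc n) ?W"
    using ai by (intro extension_kernel[OF ff U]) auto
  \<comment> \<open>Forgetting the last coordinate commutes with base change and maps the kernel W
    into the relations of b modulo P, hence its S-span into their S-span.\<close>
  let ?\<pi> = "\<lambda>z i. if i < n then z i else \<zero>\<^bsub>S\<^esub>" and ?\<rho> = "\<lambda>z i. if i < n then z i else \<zero>\<^bsub>R\<^esub>"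
  interpret p: semilinear_map S S "\<lambda>r. r" ?G "free_module S n" ?\<pi>
  proof -
    show "linear_map S ?G (free_module S n) ?\<pi>"
      using G.module_axioms module_free_module[OF S.is_cring, of n] free_module_component[OF S.is_cring]
      by (auto simp: linear_map_iff linear_maps_def carrier_free_module add_free_module smult_free_module fun_eq_iff)
  qed
  have KF: "?K \<subseteq> carrier (free_module R n)" by (auto simp: relations_def)
  have "?\<pi> (base_change x) \<in> extension n ?K" if x: "x \<in> ?W" for x
  proof -
    have xF: "x \<in> carrier ?F" "x n \<in> P" using x by (simp_all add: U_def)
    note xi = free_module_component[OF R.is_cring xF(1)]
    have \<rho>x: "?\<rho> x \<in> carrier (free_module R n)" using xi by (simp add: carrier_free_module)
    have "lincomb (self_module R) n a x = lincomb (self_module R) n b (?\<rho> x)"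
      by (rule lincomb_cong[OF selfR]) (use ai xi in \<open>auto simp: a_def\<close>)
    moreover have "lincomb (self_module R) n b (?\<rho> x) \<in> carrier R"
      using semilinear_map.map_mem[OF linear_pairing[OF R.is_cring b] \<rho>x] by simp
    ultimately have "lincomb (self_module R) n b (?\<rho> x) \<ominus>\<^bsub>R\<^esub> x n = \<zero>\<^bsub>R\<^esub>"
      using x lincomb_Suc[OF selfR, of a n x] ai xi by (simp add: a_def R.r_minus a_minus_def)
    then have "lincomb (self_module R) n b (?\<rho> x) = x n"
      using \<open>lincomb (self_module R) n b (?\<rho> x) \<in> carrier R\<close> xi by (simp add: R.r_right_minus_eq)
    then have "?\<rho> x \<in> ?K" using xF(2) \<rho>x by (simp add: relations_def)
    moreover have "?\<pi> (base_change x) = base_change (?\<rho> x)" by (auto simp: base_change_def)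
    ultimately show ?thesis using base_change_extension by metis
  qed
  then have "extension (Suc n) ?W \<subseteq> {z \<in> carrier ?G. ?\<pi> z \<in> extension n ?K}"
    using semilinear_map.map_mem[OF semilinear_base_change, of _ "Suc n"]
    by (intro extension_least p.submodule_preimage submodule_extension[OF KF]) (auto simp: U_def)
  then have "?\<pi> v \<in> extension n ?K" using vW by auto
  also have "?\<pi> v = y" using y by (auto simp: v_def carrier_free_module)
  finally show "y \<in> extension n ?K" .
qed

section \<open>Descent of finite generation modulo the ideal\<close>

lemma finite_subset_span:
  fixes M :: "('a, 'b) module"
  assumes M: "module R M" and B: "B \<subseteq> carrier M" and "finite Y" and "Y \<subseteq> module_span R M B"
  obtains F where "finite F" "F \<subseteq> B" "Y \<subseteq> module_span R M F"
proof -
  from assms(3,4) have "\<exists>F. finite F \<and> F \<subseteq> B \<and> Y \<subseteq> module_span R M F"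
  proof (induction Y rule: finite_induct)
    case empty
    then show ?case by auto
  next
    case (insert y Y)
    then obtain F where F: "finite F" "F \<subseteq> B" "Y \<subseteq> module_span R M F" by auto
    obtain F' where F': "finite F'" "F' \<subseteq> B" "y \<in> module_span R M F'"
      using span_finitary[OF M B, of y] insert.prems by auto
    have "module_span R M F \<subseteq> module_span R M (F \<union> F')" "module_span R M F' \<subseteq> module_span R M (F \<union> F')"
      by (rule span_mono, simp)+
    then show ?case using F F' by (intro exI[of _ "F \<union> F'"]) auto
  qed
  with that show thesis by blast
qed

text \<open>The finitely many generators over S use only finitely many relations over R. Let K0 be
  the span of these together with P^n. Its S-span contains all relations over S, in particular the
  base change of K, so K and K0 have the same S-span and faithfulness gives K = K0.\<close>

lemma (in ring_hom_cring) coherent_modulo_descent: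
  assumes ff: "faithfully_flat TYPE((nat \<Rightarrow> 'a) set) R target_module" and P: "ideal P R"
    and coh: "coherent_modulo S (extended_ideal S h P) (carrier S)"
  shows "coherent_modulo R P (carrier R)"
  unfolding coherent_modulo_def
proof (intro allI ballI)
  fix n :: nat and b assume b: "b \<in> {..<n} \<rightarrow> carrier R"
  let ?F = "free_module R n" and ?G = "free_module S n" and ?J = "extended_ideal S h P"
  let ?K = "relations R P n b" and ?L = "relations S ?J n (\<lambda>i. h (b i))"
  interpret P: ideal P R by (rule P)
  interpret F: module R ?F by (rule module_free_module[OF R.is_cring])
  interpret G: module S ?G by (rule module_free_module[OF S.is_cring])
  interpret b: semilinear_map R S h ?F ?G base_change by (rule semilinear_base_change)
  have hb: "(\<lambda>i. h (b i)) \<in> {..<n} \<rightarrow> carrier S" using b by auto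
  have hPS: "h ` P \<subseteq> carrier S" using P.a_subset by auto
  have J: "ideal ?J S" unfolding extended_ideal_def by (rule S.genideal_ideal[OF hPS])
  have hPJ: "h ` P \<subseteq> ?J" unfolding extended_ideal_def by (rule S.genideal_self[OF hPS])
  have KF: "?K \<subseteq> carrier ?F" by (auto simp: relations_def)
  have bKG: "base_change ` ?K \<subseteq> carrier ?G" using KF b.map_mem by auto
  note K = submodule_relations[OF R.is_cring P b]
  note VP = vectors_in_subset_relations[OF R.is_cring P b]
  obtain Y where Y: "finite Y" "Y \<subseteq> ?L" "?L \<subseteq> module_span S ?G (Y \<union> vectors_in S ?J n)"
    using coh hb unfolding coherent_modulo_def finite_modulo_def by metis
  have "Y \<subseteq> module_span S ?G (base_change ` ?K)"
    using Y(2) relations_extension[OF ff P b] unfolding extension_def by auto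
  \<comment> \<open>Here generators over S are traded for elements of K: each element of
    \<open>Y\<close> lies in the S-span of K and so involves finitely many of its elements.\<close>
  from finite_subset_span[OF G.module_axioms bKG Y(1) this]
  obtain Z' where Z': "finite Z'" "Z' \<subseteq> base_change ` ?K" "Y \<subseteq> module_span S ?G Z'" .
  obtain Z where Z: "finite Z" "Z \<subseteq> ?K" "Z' = base_change ` Z"
    using finite_subset_image[OF Z'(1,2)] by metis
  define K0 where "K0 = module_span R ?F (Z \<union> vectors_in R P n)"
  have ZV: "Z \<union> vectors_in R P n \<subseteq> ?K" using Z(2) VP by simp
  have K0: "submodule K0 R ?F"
    unfolding K0_def using ZV KF by (intro submodule_span[OF F.module_axioms]) auto
  have K0K: "K0 \<subseteq> ?K" unfolding K0_def by (rule span_least[OF K ZV])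
  have ZVK0: "Z \<subseteq> K0" "vectors_in R P n \<subseteq> K0"
    unfolding K0_def using span_superset[of "Z \<union> vectors_in R P n" R ?F] by auto
  note E = submodule_extension[OF F.submoduleE(1)[OF K0]]
  have "Y \<subseteq> extension n K0"
    using Z'(3) unfolding Z(3) extension_def
    by (rule order_trans) (intro span_mono image_mono ZVK0)
  \<comment> \<open>P^n was put into \<open>K0\<close> for this purpose: its S-span is (PS)^n, the
    part up to which generators over S are known.\<close>
  moreover have "vectors_in S ?J n \<subseteq> extension n K0"
  proof
    fix x assume "x \<in> vectors_in S ?J n"
    then have x: "x \<in> carrier ?G" "\<And>i. x i \<in> ?J" by (auto simp: vectors_in_def)
    show "x \<in> extension n K0"
    proof (rule free_module_memI[OF S.is_cring E x(1)])
      fix i assume i: "i < n"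
      show "x i \<odot>\<^bsub>?G\<^esub> unit_vector S i \<in> extension n K0"
      proof (rule scaled_unit_extension[OF i K0 _ x(2)])
        fix p assume p: "p \<in> P"
        then have pR: "p \<in> carrier R" using P.a_subset by auto
        then have "p \<odot>\<^bsub>?F\<^esub> unit_vector R i \<in> vectors_in R P n"
          using p F.smult_closed[OF pR unit_vector_closed[OF R.is_cring i]]
          by (auto simp: vectors_in_def smult_free_module unit_vector_def)
        then show "p \<in> carrier R \<and> p \<odot>\<^bsub>?F\<^esub> unit_vector R i \<in> K0" using pR ZVK0(2) by auto
      qed
    qed
  qed
  ultimately have "?L \<subseteq> extension n K0"
    using Y(3) span_least[OF E, of "Y \<union> vectors_in S ?J n"] by auto
  moreover have "base_change ` ?K \<subseteq> ?L"
    using hPJ b.map_mem pairing_base_change[OF b] by (auto simp: relations_def)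
  ultimately have "extension n ?K \<subseteq> extension n K0"
    by (intro extension_least[OF E]) auto
  from extension_reflects_subset[OF ff K0 K K0K this] Z(1,2)
  show "finite_modulo R ?F (vectors_in R P n) ?K"
    unfolding finite_modulo_def K0_def by (intro exI[of _ Z] conjI)
qed

section \<open>The radical as an ideal, and the conclusion\<close>

text \<open>The factor \<open>z\<close> allows an induction on \<open>n + m\<close> that avoids the binomial expansion.\<close>

lemma radical_add_closed:
  assumes S: "cring S" and J: "ideal J S" and x: "x \<in> carrier S" and y: "y \<in> carrier S" and z: "z \<in> carrier S"
    and "x [^]\<^bsub>S\<^esub> (n::nat) \<otimes>\<^bsub>S\<^esub> z \<in> J" and "y [^]\<^bsub>S\<^esub> (m::nat) \<otimes>\<^bsub>S\<^esub> z \<in> J"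
  shows "(x \<oplus>\<^bsub>S\<^esub> y) [^]\<^bsub>S\<^esub> (n + m) \<otimes>\<^bsub>S\<^esub> z \<in> J"
  using assms(5-)
proof (induction "n + m" arbitrary: n m z)
  case 0
  then show ?case by simp
next
  case (Suc k)
  interpret S: cring S by (rule S)
  interpret J: ideal J S by (rule J)
  show ?case
  proof (cases "n = 0 \<or> m = 0")
    case True
    \<comment> \<open>With a zero exponent one of the two hypotheses reads 1 z \<in> J.\<close>
    then have "z \<in> J" using Suc.prems by auto
    then show ?thesis using x y by (simp add: J.I_l_closed)
  next
    case False
    then obtain n' m' where nm: "n = Suc n'" "m = Suc m'" by (metis nat.exhaust)
    let ?s = "x \<oplus>\<^bsub>S\<^esub> y"
    \<comment> \<open>One factor x + y is split off: the summand with x z needs only exponents n - 1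
      and m, the one with y z only n and m - 1, so the sum of exponents drops by one in
      both.\<close>
    have "x [^]\<^bsub>S\<^esub> n' \<otimes>\<^bsub>S\<^esub> (x \<otimes>\<^bsub>S\<^esub> z) \<in> J" "y [^]\<^bsub>S\<^esub> m' \<otimes>\<^bsub>S\<^esub> (y \<otimes>\<^bsub>S\<^esub> z) \<in> J"
      using Suc.prems x y by (simp_all add: nm S.m_assoc)
    moreover have "y [^]\<^bsub>S\<^esub> m \<otimes>\<^bsub>S\<^esub> (x \<otimes>\<^bsub>S\<^esub> z) \<in> J" "x [^]\<^bsub>S\<^esub> n \<otimes>\<^bsub>S\<^esub> (y \<otimes>\<^bsub>S\<^esub> z) \<in> J"
      using J.I_l_closed[OF Suc.prems(3) x] J.I_l_closed[OF Suc.prems(2) y] Suc.prems(1) x y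
      by (simp_all add: S.m_lcomm)
    ultimately have "?s [^]\<^bsub>S\<^esub> (n' + m) \<otimes>\<^bsub>S\<^esub> (x \<otimes>\<^bsub>S\<^esub> z) \<in> J" "?s [^]\<^bsub>S\<^esub> (n + m') \<otimes>\<^bsub>S\<^esub> (y \<otimes>\<^bsub>S\<^esub> z) \<in> J"
      using Suc.hyps(1)[of n' m "x \<otimes>\<^bsub>S\<^esub> z"] Suc.hyps(1)[of n m' "y \<otimes>\<^bsub>S\<^esub> z"] Suc.hyps(2) Suc.prems(1) x y nm
      by simp_all
    then have "?s [^]\<^bsub>S\<^esub> k \<otimes>\<^bsub>S\<^esub> (x \<otimes>\<^bsub>S\<^esub> z) \<oplus>\<^bsub>S\<^esub> ?s [^]\<^bsub>S\<^esub> k \<otimes>\<^bsub>S\<^esub> (y \<otimes>\<^bsub>S\<^esub> z) \<in> J"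
      using Suc.hyps(2) nm by (intro J.a_closed) simp_all
    also have "?s [^]\<^bsub>S\<^esub> k \<otimes>\<^bsub>S\<^esub> (x \<otimes>\<^bsub>S\<^esub> z) \<oplus>\<^bsub>S\<^esub> ?s [^]\<^bsub>S\<^esub> k \<otimes>\<^bsub>S\<^esub> (y \<otimes>\<^bsub>S\<^esub> z) = ?s [^]\<^bsub>S\<^esub> Suc k \<otimes>\<^bsub>S\<^esub> z"
      using x y Suc.prems(1) by (simp add: S.m_assoc S.l_distr S.r_distr)
    finally show ?thesis using Suc.hyps(2) by simp
  qed
qed

lemma ideal_radical:
  assumes S: "cring S" and J: "ideal J S"
  shows "ideal (radical S J) S"
proof -
  interpret S: cring S by (rule S)
  interpret J: ideal J S by (rule J)
  have mult: "s \<otimes>\<^bsub>S\<^esub> x \<in> radical S J" if s: "s \<in> carrier S" and x: "x \<in> radical S J" for s x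
  proof -
    obtain n :: nat where n: "x [^]\<^bsub>S\<^esub> n \<in> J" "x \<in> carrier S" using x by (auto simp: radical_def)
    then have "(s \<otimes>\<^bsub>S\<^esub> x) [^]\<^bsub>S\<^esub> n \<in> J"
      using s by (simp add: S.nat_pow_distrib J.I_l_closed)
    then show ?thesis using n(2) s by (auto simp: radical_def)
  qed
  have "subgroup (radical S J) (add_monoid S)"
  proof (rule group.subgroupI)
    show "group (add_monoid S)" by (rule S.a_group)
    have "\<zero>\<^bsub>S\<^esub> [^]\<^bsub>S\<^esub> (1::nat) \<in> J" by simp
    then have "\<zero>\<^bsub>S\<^esub> \<in> radical S J" unfolding radical_def by blast
    then show "radical S J \<noteq> {}" by auto
    fix x assume x: "x \<in> radical S J"
    then have xS: "x \<in> carrier S" by (simp add: radical_def)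
    show "inv\<^bsub>add_monoid S\<^esub> x \<in> radical S J"
      using mult[of "\<ominus>\<^bsub>S\<^esub> \<one>\<^bsub>S\<^esub>" x] x xS by (simp add: S.l_minus a_inv_def[symmetric])
    fix y assume y: "y \<in> radical S J"
    obtain n m :: nat where "x [^]\<^bsub>S\<^esub> n \<in> J" "y [^]\<^bsub>S\<^esub> m \<in> J" "y \<in> carrier S"
      using x y by (auto simp: radical_def)
    then have "(x \<oplus>\<^bsub>S\<^esub> y) [^]\<^bsub>S\<^esub> (n + m) \<in> J"
      using radical_add_closed[OF S J xS, of y "\<one>\<^bsub>S\<^esub>" n m] xS by simp
    then show "x \<otimes>\<^bsub>add_monoid S\<^esub> y \<in> radical S J"
      using xS \<open>y \<in> carrier S\<close> by (auto simp: radical_def)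
  qed (auto simp: radical_def)
  moreover have "x \<otimes>\<^bsub>S\<^esub> s \<in> radical S J" if "x \<in> radical S J" "s \<in> carrier S" for x s
    using mult[OF that(2,1)] that S.m_comm[of x s] by (simp add: radical_def)
  ultimately show ?thesis
    using mult S.ring_axioms by (intro idealI)
qed

lemma subset_radical:
  assumes "cring S" and "ideal J S"
  shows "J \<subseteq> radical S J"
proof
  interpret S: cring S by fact
  interpret J: ideal J S by fact
  fix x assume "x \<in> J"
  then have "x \<in> carrier S" "x [^]\<^bsub>S\<^esub> (1::nat) \<in> J" using J.a_subset by auto
  then show "x \<in> radical S J" unfolding radical_def by blast
qed

theorem proposition2p6:
  fixes R :: "('a, 'r) ring_scheme" and S :: "('b, 's) ring_scheme"
    and f :: "'a \<Rightarrow> 'b" and P :: "'a set"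
  assumes "cring R" and "cring S"
    and "finite_ring_hom R S f"
    and "faithfully_flat_ring_hom R S f"
    and "primeideal P R"
    and "coherent_ring (S Quot radical S (extended_ideal S f P))"
    and "coherent_module (S Quot extended_ideal S f P)
      (quotient_ideal_module S (radical S (extended_ideal S f P)) (extended_ideal S f P))"
  shows "coherent_ring (R Quot P)"
proof -
  interpret primeideal P R by fact
  interpret f: ring_hom_cring R S f
    using assms(1,2,4)
    by (simp add: ring_hom_cring_def ring_hom_cring_axioms_def faithfully_flat_ring_hom_def)
  let ?J = "extended_ideal S f P"
  have "f ` P \<subseteq> carrier S" using a_subset by auto
  then have J: "ideal ?J S" unfolding extended_ideal_def by (rule f.S.genideal_ideal)
  note rad = ideal_radical[OF assms(2) J] and sub = subset_radical[OF assms(2) J]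
  have "coherent_modulo S (radical S ?J) (carrier S)"
    using assms(6) ideal.coherent_quotient_ring_iff[OF rad assms(2)] by blast
  \<comment> \<open>Coherence of the nilradical contributes twice: its finite generation and the
    finite generation of syzygies of its finite families.\<close>
  moreover have "finite_modulo S (self_module S) ?J (radical S ?J)" "coherent_modulo S ?J (radical S ?J)"
    using assms(7) ideal.coherent_quotient_module_iff[OF J assms(2) rad sub] by simp_all
  ultimately have "coherent_modulo S ?J (carrier S)"
    by (rule coherent_modulo_extension[OF assms(2) J rad sub])
  moreover have "faithfully_flat TYPE((nat \<Rightarrow> 'a) set) R (module_via f S)"
    using assms(4) by (simp add: faithfully_flat_ring_hom_def)
  ultimately have "coherent_modulo R P (carrier R)"
    by (intro f.coherent_modulo_descent[OF _ is_ideal])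
  then show ?thesis using coherent_quotient_ring_iff[OF assms(1)] by blast
qed

end
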